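(* Assume the OMv conjecture holds. Then for every $\varepsilon>0$ there is no algorithm for incremental maximum cardinality bipartite matching on graphs with $n$ nodes that has amortized time $O(n^{1-\varepsilon})$ per edge insertion and $O(n^{2-\varepsilon})$ time per query. The same holds for decremental maximum cardinality bipartite matching, with amortized time $O(n^{1-\varepsilon})$ per edge deletion and $O(n^{2-\varepsilon})$ per query.
   Context: Incremental (resp. decremental) maximum cardinality bipartite matching: maintain a bipartite graph on a fixed set of $n$ nodes under edge insertions (resp. edge deletions), and answer queries asking for the size of a maximum matching of the current graph. The algorithm gets no preprocessing. The incremental version starts from the empty graph. The decremental version starts from a suitable initial graph (the complete bipartite graph in the dense case). Online matrix-vector multiplication (OMv): an $n\times n$ boolean matrix $M$ is given and may be preprocessed; then $n$ boolean vectors $v^1,\dots,v^n$ arrive one at a time, and $Mv^i$ (over the Boolean semiring) must be output before $v^{i+1}$ is revealed. OMv conjecture: for no $\varepsilon>0$ is there an algorithm solving OMv in total time $O(n^{3-\varepsilon})$. *)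

theory Defs
  imports
    Complex_Main
    "HOL-Library.Landau_Symbols"
    "HOL-Library.Disjoint_Sets"
begin

section \<open>A word RAM\<close>

text \<open>
  Algorithms are fixed finite programs of a small imperative language over a random-access
  memory. The memory consists of banks (arrays) of words, \<open>s a i\<close> being cell \<open>i\<close> of bank \<open>a\<close>.
  Bank names are literals of the program text, so a program uses finitely many banks; cell
  indices are computed at run time. Arithmetic, comparisons and bitwise operations on words
  take unit time.

  The word length is enforced by the capacity \<open>W\<close>: an execution exists only if every index and
  every intermediate value is below \<open>W\<close>. With unbounded words at unit cost, whole rows of a
  matrix could be packed into a single word and the conjecture below would be false.
\<close>

type_synonym mem = "nat \<Rightarrow> nat \<Rightarrow> nat"

datatype binop =
  Add | Sub | Mul | Div | Mod | Less | Equal | BitAnd | BitOr | BitXor | ShiftL | ShiftR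

fun val_op :: "binop \<Rightarrow> nat \<Rightarrow> nat \<Rightarrow> nat" where
  "val_op Add x y = x + y"
| "val_op Sub x y = x - y"
| "val_op Mul x y = x * y"
| "val_op Div x y = x div y"
| "val_op Mod x y = x mod y"
| "val_op Less x y = of_bool (x < y)"
| "val_op Equal x y = of_bool (x = y)"
| "val_op BitAnd x y = and x y"
| "val_op BitOr x y = or x y"
| "val_op BitXor x y = xor x y"
| "val_op ShiftL x y = push_bit y x"
| "val_op ShiftR x y = drop_bit y x"

datatype expr = Const nat | Get nat expr | Bin binop expr expr

fun val :: "expr \<Rightarrow> mem \<Rightarrow> nat" where
  "val (Const k) s = k"
| "val (Get a e) s = s a (val e s)"
| "val (Bin f d e) s = val_op f (val d s) (val e s)"

fun fits :: "nat \<Rightarrow> expr \<Rightarrow> mem \<Rightarrow> bool" where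
  "fits W (Const k) s \<longleftrightarrow> k < W"
| "fits W (Get a e) s \<longleftrightarrow> fits W e s \<and> val (Get a e) s < W"
| "fits W (Bin f d e) s \<longleftrightarrow> fits W d s \<and> fits W e s \<and> val (Bin f d e) s < W"

fun cost :: "expr \<Rightarrow> nat" where
  "cost (Const k) = 1"
| "cost (Get a e) = cost e + 1"
| "cost (Bin f d e) = cost d + cost e + 1"

text \<open>\<open>Put a d e\<close> is the assignment \<open>a[d] := e\<close>; a test succeeds if its value is nonzero.\<close>

datatype com =
  Skip
| Put nat expr expr
| Seq com com
| Cond expr com com
| While expr com

text \<open>
  \<open>run W c s t s'\<close>: with word capacity \<open>W\<close>, program \<open>c\<close> started in \<open>s\<close> halts in \<open>s'\<close> after exactly
  \<open>t\<close> time units. The relation is deterministic: \<open>W\<close>, \<open>c\<close> and \<open>s\<close> determine \<open>t\<close> and \<open>s'\<close>.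
\<close>

inductive run :: "nat \<Rightarrow> com \<Rightarrow> mem \<Rightarrow> nat \<Rightarrow> mem \<Rightarrow> bool" for W :: nat where
  Skip: "run W Skip s 1 s"
| Put: "fits W d s \<Longrightarrow> fits W e s \<Longrightarrow>
    run W (Put a d e) s (cost d + cost e + 1) (s(a := (s a)(val d s := val e s)))"
| Seq: "run W c s t s' \<Longrightarrow> run W d s' t' s'' \<Longrightarrow> run W (Seq c d) s (t + t') s''"
| CondTrue: "fits W e s \<Longrightarrow> val e s \<noteq> 0 \<Longrightarrow> run W c s t s' \<Longrightarrow>
    run W (Cond e c d) s (cost e + 1 + t) s'"
| CondFalse: "fits W e s \<Longrightarrow> val e s = 0 \<Longrightarrow> run W d s t s' \<Longrightarrow>
    run W (Cond e c d) s (cost e + 1 + t) s'"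
| WhileFalse: "fits W e s \<Longrightarrow> val e s = 0 \<Longrightarrow> run W (While e c) s (cost e + 1) s"
| WhileTrue: "fits W e s \<Longrightarrow> val e s \<noteq> 0 \<Longrightarrow> run W c s t s' \<Longrightarrow> run W (While e c) s' t' s'' \<Longrightarrow>
    run W (While e c) s (cost e + 1 + t + t') s''"

text \<open>
  On instances of size \<open>n\<close> words have \<open>O(log n)\<close> bits, that is, polynomial capacity. The constant
  \<open>w\<close> is chosen together with the program, independently of \<open>n\<close>.
\<close>

definition capacity :: "nat \<Rightarrow> nat \<Rightarrow> nat" where
  "capacity w n = (n + 2) ^ w"


section \<open>Online Boolean matrix-vector multiplication\<close>

definition bool_mat_vec :: "nat \<Rightarrow> (nat \<Rightarrow> nat \<Rightarrow> bool) \<Rightarrow> (nat \<Rightarrow> bool) \<Rightarrow> nat \<Rightarrow> bool" where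
  "bool_mat_vec n M v i \<longleftrightarrow> (\<exists>j<n. M i j \<and> v j)"

text \<open>
  Memory interface: \<open>n\<close> is in cell 0 of bank 0, the matrix is stored row by row in bank 1, the
  current vector is delivered in bank 2 and the product is expected in bank 3. All other cells
  are initially 0.
\<close>

definition omv_start :: "nat \<Rightarrow> (nat \<Rightarrow> nat \<Rightarrow> bool) \<Rightarrow> mem" where
  "omv_start n M = (\<lambda>a i.
     if a = 0 \<and> i = 0 then n
     else if a = 1 \<and> i < n * n then of_bool (M (i div n) (i mod n))
     else 0)"

definition put_vec :: "nat \<Rightarrow> (nat \<Rightarrow> bool) \<Rightarrow> mem \<Rightarrow> mem" where
  "put_vec n v s = s(2 := (\<lambda>j. of_bool (j < n \<and> v j)))"

text \<open>
  \<open>omv_serves W mul n M vs s t\<close>: from memory \<open>s\<close>, successive runs of \<open>mul\<close> answer the vectors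
  \<open>vs\<close> correctly in total time \<open>t\<close>. The answer to a vector is read off before the next vector is
  written, so it cannot depend on later vectors.
\<close>

inductive omv_serves ::
    "nat \<Rightarrow> com \<Rightarrow> nat \<Rightarrow> (nat \<Rightarrow> nat \<Rightarrow> bool) \<Rightarrow> (nat \<Rightarrow> bool) list \<Rightarrow> mem \<Rightarrow> nat \<Rightarrow> bool"
  for W :: nat and mul :: com and n :: nat and M :: "nat \<Rightarrow> nat \<Rightarrow> bool" where
  Nil: "omv_serves W mul n M [] s 0"
| Cons: "run W mul (put_vec n v s) t s' \<Longrightarrow>
    (\<And>i. i < n \<Longrightarrow> s' 3 i = of_bool (bool_mat_vec n M v i)) \<Longrightarrow>
    omv_serves W mul n M vs s' t' \<Longrightarrow>
    omv_serves W mul n M (v # vs) s (t + t')"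

text \<open>The preprocessing program \<open>pre\<close> is part of the total time.\<close>

definition omv_algorithm :: "com \<Rightarrow> com \<Rightarrow> nat \<Rightarrow> (nat \<Rightarrow> real) \<Rightarrow> bool" where
  "omv_algorithm pre mul w T \<longleftrightarrow>
     (\<forall>n M vs. length vs = n \<longrightarrow>
       (\<exists>t0 s t. run (capacity w n) pre (omv_start n M) t0 s \<and>
                 omv_serves (capacity w n) mul n M vs s t \<and>
                 real (t0 + t) \<le> T n))"

definition OMv_conjecture :: bool where
  "OMv_conjecture \<longleftrightarrow>
     (\<forall>\<epsilon>>0. \<not> (\<exists>pre mul w T.
        T \<in> O(\<lambda>n. real n powr (3 - \<epsilon>)) \<and> omv_algorithm pre mul w T))"


section \<open>Partially dynamic maximum cardinality bipartite matching\<close>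

text \<open>A graph on the nodes \<open>{..<n}\<close> is given by its set of edges, which are two-element sets.\<close>

type_synonym edges = "nat set set"

definition bipartite :: "nat set \<Rightarrow> edges \<Rightarrow> bool" where
  "bipartite V E \<longleftrightarrow>
     (\<exists>A B. A \<union> B = V \<and> A \<inter> B = {} \<and> (\<forall>e\<in>E. \<exists>a\<in>A. \<exists>b\<in>B. e = {a, b}))"

definition complete_bipartite :: "nat set \<Rightarrow> nat set \<Rightarrow> edges" where
  "complete_bipartite A B = {{a, b} | a b. a \<in> A \<and> b \<in> B}"

definition matching :: "edges \<Rightarrow> edges \<Rightarrow> bool" where
  "matching E F \<longleftrightarrow> F \<subseteq> E \<and> disjoint F"

definition max_matching_size :: "edges \<Rightarrow> nat" where
  "max_matching_size E = Max {card F | F. matching E F}"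

text \<open>\<open>Update x y\<close> inserts (or deletes) the edge \<open>{x, y}\<close>.\<close>

datatype request = Update nat nat | Query

fun is_update :: "request \<Rightarrow> bool" where
  "is_update (Update x y) \<longleftrightarrow> True"
| "is_update Query \<longleftrightarrow> False"

definition num_updates :: "request list \<Rightarrow> nat" where
  "num_updates rs = length (filter is_update rs)"

definition num_queries :: "request list \<Rightarrow> nat" where
  "num_queries rs = length (filter (\<lambda>r. \<not> is_update r) rs)"

definition insert_edge :: "nat set \<Rightarrow> edges \<Rightarrow> edges" where
  "insert_edge e E = insert e E"

definition delete_edge :: "nat set \<Rightarrow> edges \<Rightarrow> edges" where
  "delete_edge e E = E - {e}"

fun valid_insertions :: "nat \<Rightarrow> edges \<Rightarrow> request list \<Rightarrow> bool" where
  "valid_insertions n E [] \<longleftrightarrow> True"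
| "valid_insertions n E (Update x y # rs) \<longleftrightarrow>
     {x, y} \<notin> E \<and> bipartite {..<n} (insert_edge {x, y} E) \<and>
     valid_insertions n (insert_edge {x, y} E) rs"
| "valid_insertions n E (Query # rs) \<longleftrightarrow> valid_insertions n E rs"

fun valid_deletions :: "edges \<Rightarrow> request list \<Rightarrow> bool" where
  "valid_deletions E [] \<longleftrightarrow> True"
| "valid_deletions E (Update x y # rs) \<longleftrightarrow>
     {x, y} \<in> E \<and> valid_deletions (delete_edge {x, y} E) rs"
| "valid_deletions E (Query # rs) \<longleftrightarrow> valid_deletions E rs"

text \<open>
  Memory interface: bank 0 initially holds the parameters of the instance and all other cells
  are 0. The endpoints of an updated edge are delivered in cells 0 and 1 of bank 1, and the
  answer to a query is expected in cell 0 of bank 2. The first program run is the one for the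
  first request: there is no preprocessing.
\<close>

definition put_edge :: "nat \<Rightarrow> nat \<Rightarrow> mem \<Rightarrow> mem" where
  "put_edge x y s = s(1 := (\<lambda>_. 0)(0 := x, 1 := y))"

text \<open>
  \<open>serves W upd qry change rs E s t\<close>: from memory \<open>s\<close> and current graph \<open>E\<close>, running \<open>upd\<close> for
  each update and \<open>qry\<close> for each query answers all queries in \<open>rs\<close> correctly in total time \<open>t\<close>,
  where \<open>change\<close> is the effect of an update on the graph.
\<close>

inductive serves ::
    "nat \<Rightarrow> com \<Rightarrow> com \<Rightarrow> (nat set \<Rightarrow> edges \<Rightarrow> edges) \<Rightarrow> request list \<Rightarrow> edges \<Rightarrow> mem \<Rightarrow> nat \<Rightarrow> bool"
  for W :: nat and upd qry :: com and change :: "nat set \<Rightarrow> edges \<Rightarrow> edges" where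
  Nil: "serves W upd qry change [] E s 0"
| Update: "run W upd (put_edge x y s) t s' \<Longrightarrow>
    serves W upd qry change rs (change {x, y} E) s' t' \<Longrightarrow>
    serves W upd qry change (Update x y # rs) E s (t + t')"
| Query: "run W qry s t s' \<Longrightarrow> s' 2 0 = max_matching_size E \<Longrightarrow>
    serves W upd qry change rs E s' t' \<Longrightarrow>
    serves W upd qry change (Query # rs) E s (t + t')"

text \<open>
  In the following two definitions \<open>f\<close> and \<open>g\<close> bound the amortized time per update and per
  query: any sequence of \<open>k\<close> updates and \<open>q\<close> queries, in any order, is served in total time at
  most \<open>k * f n + q * g n\<close>.
\<close>

definition incremental_matching_algorithm ::
    "com \<Rightarrow> com \<Rightarrow> nat \<Rightarrow> (nat \<Rightarrow> real) \<Rightarrow> (nat \<Rightarrow> real) \<Rightarrow> bool" where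
  "incremental_matching_algorithm upd qry w f g \<longleftrightarrow>
     (\<forall>n rs. valid_insertions n {} rs \<longrightarrow>
       (\<exists>t. serves (capacity w n) upd qry insert_edge rs {}
              (\<lambda>a i. if a = 0 \<and> i = 0 then n else 0) t \<and>
            real t \<le> real (num_updates rs) * f n + real (num_queries rs) * g n))"

text \<open>
  The initial graph is the complete bipartite graph with sides \<open>{..<m}\<close> and \<open>{m..<n}\<close>. The
  algorithm is told \<open>n\<close> and \<open>m\<close>, which determine this graph.
\<close>

definition decremental_matching_algorithm ::
    "com \<Rightarrow> com \<Rightarrow> nat \<Rightarrow> (nat \<Rightarrow> real) \<Rightarrow> (nat \<Rightarrow> real) \<Rightarrow> bool" where
  "decremental_matching_algorithm upd qry w f g \<longleftrightarrow>
     (\<forall>n m rs. m \<le> n \<longrightarrow> valid_deletions (complete_bipartite {..<m} {m..<n}) rs \<longrightarrow>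
       (\<exists>t. serves (capacity w n) upd qry delete_edge rs (complete_bipartite {..<m} {m..<n})
              (\<lambda>a i. if a = 0 \<and> i = 0 then n else if a = 0 \<and> i = 1 then m else 0) t \<and>
            real t \<le> real (num_updates rs) * f n + real (num_queries rs) * g n))"

end

theory Submission
  imports Defs
begin

text \<open>
  Let \<open>k\<close> be the cube root of \<open>n\<close>. Cut the matrix into \<open>k\<^sup>2 \<times> k\<^sup>2\<close> blocks of size \<open>k\<close>, and the
  vectors into \<open>k\<^sup>2\<close> groups of \<open>k\<close>. For every block and every group, a fresh instance of the matching
  algorithm on \<open>8 * k\<close> nodes stores the block as a bipartite graph and answers, for each vector of the
  group, whether a pair \<open>u, v\<close> satisfies \<open>u\<^sup>T M v = 1\<close>: with \<open>s\<close> joined to the rows of \<open>u\<close> and \<open>t\<close> to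
  the columns of \<open>v\<close>, a matching of size \<open>2 * k\<close> can be augmented iff the answer is yes. Each vector has
  its own \<open>s\<close> and \<open>t\<close>; a leaf attached to a node takes it out of the game, which allows to deactivate
  them by insertions, and to activate them by deletions. Thus an instance gets \<open>O(k\<^sup>2)\<close> updates and
  \<open>k\<close> queries.

  For \<open>u\<close> we take the rows of the block that are not yet known to be 1 in the product. If the answer
  is no, the block contributes nothing new. If it is yes, the block is searched exhaustively in time
  \<open>k\<^sup>2\<close>, which happens at most \<open>k\<^sup>3\<close> times per vector because each time a new row is found. The total
  is \<open>k\<^sup>6 * O(k\<^sup>2 * f (8 * k) + k * g (8 * k)) + O(k\<^sup>8)\<close>.
\<close>

section \<open>Running time with a potential\<close>

text \<open>The exponents explain the sizes. Storing a block takes order \<open>k ^ 2\<close>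
  updates, and \<open>k\<close> queries at a cost near \<open>k ^ 2\<close> weigh as much as these
  updates at a cost near \<open>k\<close>; hence groups of \<open>k\<close> vectors. Then
  \<open>k ^ 6\<close> instances at a cost below \<open>k ^ 3\<close> stay below
  \<open>k ^ 9\<close>, the order of \<open>n ^ 3\<close>. Searching each block that contains a 1 of
  the product, for up to \<open>k ^ 3\<close> vectors and \<open>k ^ 4\<close> blocks, would already
  cost \<open>k ^ 9\<close>; charging searches to new rows avoids this. The obstacle is that
  amortized bounds speak only about a complete request sequence of one instance, whereas vectors
  arrive one by one: \<open>k ^ 4\<close> instances advance in turn, and a single call has no bound
  of its own. Moreover, later requests depend on earlier answers. The proof therefore fixes all
  request lists beforehand, describing partial products mathematically (\<open>hit\<close>,
  \<open>left\<close>), puts the total cost of the lists into a potential, and lets every call spend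
  from it. Only the lists in the proof know future vectors, the programs do not.\<close>

definition steps :: "nat \<Rightarrow> com \<Rightarrow> mem \<Rightarrow> nat \<Rightarrow> nat \<Rightarrow> (nat \<Rightarrow> mem \<Rightarrow> bool) \<Rightarrow> bool" where
  "steps W c s \<phi> T Q \<longleftrightarrow> (\<exists>t s' \<phi>'. run W c s t s' \<and> t + \<phi>' \<le> \<phi> + T \<and> Q \<phi>' s')"

lemma steps_mono:
  assumes "steps W c s \<phi> T Q" "T \<le> T'" "\<And>\<phi>' s'. Q \<phi>' s' \<Longrightarrow> Q' \<phi>' s'"
  shows "steps W c s \<phi> T' Q'"
  using assms unfolding steps_def by (meson add_left_mono order_trans)

text \<open>Potential is prepaid time, so borrowing \<open>d\<close> at the start merely adds
  \<open>d\<close> to the bound. In this way the searches for one vector are charged once, in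
  \<open>steps_multiply\<close>.\<close>

lemma steps_pot:
  assumes "steps W c s (\<phi> + d) T Q"
  shows "steps W c s \<phi> (d + T) Q"
  using assms unfolding steps_def by (simp add: add.assoc)

lemma steps_Skip: "Q \<phi> s \<Longrightarrow> steps W Skip s \<phi> 1 Q"
  unfolding steps_def using run.Skip by fastforce

lemma steps_Put:
  assumes "fits W d s" "fits W e s" "Q \<phi> (s(a := (s a)(val d s := val e s)))"
  shows "steps W (Put a d e) s \<phi> (cost d + cost e + 1) Q"
  unfolding steps_def
  by (rule exI[of _ "cost d + cost e + 1"], rule exI, rule exI[of _ \<phi>])
    (use assms run.Put[OF assms(1,2), of a] in auto)

lemma steps_Seq:
  assumes "steps W c s \<phi> T (\<lambda>\<phi>' s'. steps W d s' \<phi>' T' Q)"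
  shows "steps W (Seq c d) s \<phi> (T + T') Q"
proof -
  obtain t s' \<phi>' where 1: "run W c s t s'" "t + \<phi>' \<le> \<phi> + T" "steps W d s' \<phi>' T' Q"
    using assms unfolding steps_def[of W c] by blast
  then obtain t' s'' \<phi>'' where 2: "run W d s' t' s''" "t' + \<phi>'' \<le> \<phi>' + T'" "Q \<phi>'' s''"
    unfolding steps_def by blast
  show ?thesis unfolding steps_def
    using run.Seq[OF 1(1) 2(1)] 1(2) 2(2,3) by (intro exI[of _ "t + t'"] exI[of _ s''] exI[of _ \<phi>'']) auto
qed

lemma steps_Cond:
  assumes "fits W e s" "val e s \<noteq> 0 \<Longrightarrow> steps W c s \<phi> T Q" "val e s = 0 \<Longrightarrow> steps W d s \<phi> T Q"
  shows "steps W (Cond e c d) s \<phi> (cost e + 1 + T) Q"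
proof (cases "val e s = 0")
  case True
  then obtain t s' \<phi>' where "run W d s t s'" "t + \<phi>' \<le> \<phi> + T" "Q \<phi>' s'"
    using assms(3) unfolding steps_def by blast
  then show ?thesis using run.CondFalse[OF assms(1) True] unfolding steps_def
    by (intro exI[of _ "cost e + 1 + t"] exI[of _ s'] exI[of _ \<phi>']) auto
next
  case False
  then obtain t s' \<phi>' where "run W c s t s'" "t + \<phi>' \<le> \<phi> + T" "Q \<phi>' s'"
    using assms(2) unfolding steps_def by blast
  then show ?thesis using run.CondTrue[OF assms(1) False] unfolding steps_def
    by (intro exI[of _ "cost e + 1 + t"] exI[of _ s'] exI[of _ \<phi>']) auto
qed

text \<open>The invariant is indexed by the iteration number and carries the potential, so
  \<open>T\<close> bounds only what an iteration spends beyond its drop in potential.\<close>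

lemma steps_While:
  assumes step: "\<And>j \<phi> s. j < m \<Longrightarrow> I j \<phi> s \<Longrightarrow>
      fits W e s \<and> val e s \<noteq> 0 \<and> steps W c s \<phi> T (I (Suc j))"
    and stop: "\<And>\<phi> s. I m \<phi> s \<Longrightarrow> fits W e s \<and> val e s = 0"
    and "I j \<phi> s" "j \<le> m"
  shows "steps W (While e c) s \<phi> ((m - j) * (T + cost e + 1) + cost e + 1) (I m)"
  using assms(3,4)
proof (induction "m - j" arbitrary: j \<phi> s)
  case 0
  then have "I m \<phi> s" by simp
  then have "run W (While e c) s (cost e + 1) s" using stop run.WhileFalse by blast
  then show ?case unfolding steps_def using \<open>I m \<phi> s\<close> 0(1)
    by (intro exI[of _ "cost e + 1"] exI[of _ s] exI[of _ \<phi>]) auto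
next
  case (Suc d)
  then have j: "j < m" by simp
  note st = step[OF j Suc(3)]
  then obtain t s' \<phi>' where 1: "run W c s t s'" "t + \<phi>' \<le> \<phi> + T" "I (Suc j) \<phi>' s'"
    unfolding steps_def by blast
  have "steps W (While e c) s' \<phi>' ((m - Suc j) * (T + cost e + 1) + cost e + 1) (I m)"
    using Suc(1)[of "Suc j" \<phi>' s'] Suc(2) 1(3) j by auto
  then obtain t' s'' \<phi>'' where 2: "run W (While e c) s' t' s''"
    "t' + \<phi>'' \<le> \<phi>' + ((m - Suc j) * (T + cost e + 1) + cost e + 1)" "I m \<phi>'' s''"
    unfolding steps_def by blast
  have *: "m - j = Suc (m - Suc j)" using j by simp
  show ?case unfolding steps_def
    using run.WhileTrue[OF conjunct1[OF st] _ 1(1) 2(1)] st 1(2) 2(2,3)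
    by (intro exI[of _ "cost e + 1 + t + t'"] exI[of _ s''] exI[of _ \<phi>'']) (auto simp: *)
qed

abbreviation var :: "nat \<Rightarrow> expr" where "var a \<equiv> Get a (Const 0)"
abbreviation assign :: "nat \<Rightarrow> expr \<Rightarrow> com" where "assign a e \<equiv> Put a (Const 0) e"

definition count_loop :: "nat \<Rightarrow> expr \<Rightarrow> com \<Rightarrow> com" where
  "count_loop i e c = Seq (assign i (Const 0))
     (While (Bin Less (var i) e) (Seq c (assign i (Bin Add (var i) (Const 1)))))"

text \<open>The bound \<open>e\<close> is evaluated anew in each test, therefore the invariant has
  to fix its value. Besides \<open>cost e\<close>, a test takes 4 units and the increment 6; the
  final 7 is the initial assignment plus the failing test.\<close>

lemma steps_count_loop:
  assumes init: "I 0 \<phi> (s(i := (s i)(0 := 0)))"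
    and bound: "\<And>j \<phi> s. j \<le> m \<Longrightarrow> I j \<phi> s \<Longrightarrow> s i 0 = j \<and> fits W e s \<and> val e s = m"
    and body: "\<And>j \<phi> s. j < m \<Longrightarrow> I j \<phi> s \<Longrightarrow> steps W c s \<phi> T
      (\<lambda>\<phi>' s'. s' i 0 = j \<and> I (Suc j) \<phi>' (s'(i := (s' i)(0 := Suc j))))"
    and W: "m < W" "1 < W"
  shows "steps W (count_loop i e c) s \<phi> (m * (T + cost e + 10) + cost e + 7) (I m)"
proof -
  have step: "fits W (Bin Less (var i) e) s \<and> val (Bin Less (var i) e) s \<noteq> 0 \<and>
      steps W (Seq c (assign i (Bin Add (var i) (Const 1)))) s \<phi> (T + 6) (I (Suc j))"
    if "j < m" "I j \<phi> s" for j \<phi> s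
  proof (intro conjI)
    show "steps W (Seq c (assign i (Bin Add (var i) (Const 1)))) s \<phi> (T + 6) (I (Suc j))"
    proof (rule steps_Seq, rule steps_mono[OF body[OF that]], rule order.refl)
      fix \<phi>' s'
      assume "s' i 0 = j \<and> I (Suc j) \<phi>' (s'(i := (s' i)(0 := Suc j)))"
      then show "steps W (assign i (Bin Add (var i) (Const 1))) s' \<phi>' 6 (I (Suc j))"
        using that W by (intro steps_mono[OF steps_Put[where Q = "I (Suc j)"]]) auto
    qed
  qed (use bound[of j \<phi> s] that W in auto)
  have loop: "steps W (While (Bin Less (var i) e) (Seq c (assign i (Bin Add (var i) (Const 1)))))
      s \<phi> ((m - 0) * (T + 6 + cost (Bin Less (var i) e) + 1) + cost (Bin Less (var i) e) + 1) (I m)"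
    if "I 0 \<phi> s" for \<phi> s
    by (rule steps_While[where I = I and j = 0 and m = m, OF step]) (use bound[of m] W that in auto)
  have "steps W (count_loop i e c) s \<phi> (3 + ((m - 0) * (T + 6 + cost (Bin Less (var i) e) + 1) +
      cost (Bin Less (var i) e) + 1)) (I m)"
    unfolding count_loop_def
    by (rule steps_Seq, rule steps_mono[OF steps_Put[where Q = "I 0"]]) (use init W loop in auto)
  then show ?thesis
    by (rule steps_mono) (auto simp: algebra_simps)
qed

section \<open>Running many instances side by side\<close>

text \<open>
  Cell \<open>i\<close> of bank \<open>a\<close> of instance \<open>r\<close> is kept in cell \<open>i * R + r\<close> of bank \<open>21 + a\<close>. Bank 1 has
  to be erased before each update, which would take too long; instead each update moves it to a
  fresh part of bank 22, selected by the number of updates of instance \<open>r\<close> counted in cell \<open>r\<close>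
  of bank 20. At run time, \<open>R\<close> and \<open>r\<close> are in the registers 5 and 6.
\<close>

definition view :: "nat \<Rightarrow> nat \<Rightarrow> mem \<Rightarrow> mem" where
  "view R r s a i = s (21 + a) (if a = 1 then (i * R + s 20 r) * R + r else i * R + r)"

definition address :: "nat \<Rightarrow> expr \<Rightarrow> expr" where
  "address a e = Bin Add (Bin Mul
     (if a = 1 then Bin Add (Bin Mul e (var 5)) (Get 20 (var 6)) else e) (var 5)) (var 6)"

fun sim_expr :: "expr \<Rightarrow> expr" where
  "sim_expr (Const k) = Const k"
| "sim_expr (Get a e) = Get (21 + a) (address a (sim_expr e))"
| "sim_expr (Bin f d e) = Bin f (sim_expr d) (sim_expr e)"

fun sim :: "com \<Rightarrow> com" where
  "sim Skip = Skip"
| "sim (Put a d e) = Put (21 + a) (address a (sim_expr d)) (sim_expr e)"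
| "sim (Seq c d) = Seq (sim c) (sim d)"
| "sim (Cond e c d) = Cond (sim_expr e) (sim c) (sim d)"
| "sim (While e c) = While (sim_expr e) (sim c)"

text \<open>The two bounds make \<open>r\<close> and the update counter digits in base
  \<open>R\<close>, so that cells of different instances and of different copies of bank 1 never
  coincide.\<close>

definition selected :: "nat \<Rightarrow> nat \<Rightarrow> mem \<Rightarrow> bool" where
  "selected R r s \<longleftrightarrow> s 5 0 = R \<and> s 6 0 = r \<and> r < R \<and> s 20 r < R"

text \<open>All that a simulated run of instance \<open>r\<close> may touch: its own residue class
  in the simulated banks, and within bank 22 only the copy current at the start. This protects the
  other instances as well as the copies that are still blank.\<close>

definition frame :: "nat \<Rightarrow> nat \<Rightarrow> mem \<Rightarrow> mem \<Rightarrow> bool" where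
  "frame R r s s' \<longleftrightarrow> (\<forall>a i. s' a i \<noteq> s a i \<longrightarrow>
     20 < a \<and> i mod R = r \<and> (a = 22 \<longrightarrow> i div R mod R = s 20 r))"

lemma frame_low: "frame R r s s' \<Longrightarrow> a \<le> 20 \<Longrightarrow> s' a = s a"
  unfolding frame_def by (metis ext leD)

lemma frame_refl: "frame R r s s"
  by (simp add: frame_def)

lemma frame_trans: "frame R r s s' \<Longrightarrow> frame R r s' s'' \<Longrightarrow> frame R r s s''"
  unfolding frame_def by (metis less_irrefl)

lemma frame_selected: "frame R r s s' \<Longrightarrow> selected R r s \<Longrightarrow> selected R r s'"
  unfolding selected_def by (simp add: frame_low)

lemma cost_address: "cost (address a e) \<le> cost e + 13"
  by (simp add: address_def)

text \<open>The worst case is an access to bank 1: its address adds 13 units and the access itself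
  one more, all charged to the single unit of the original \<open>Get\<close>.\<close>

lemma cost_sim_expr: "cost (sim_expr e) \<le> 14 * cost e"
  by (induction e) (use cost_address in \<open>auto intro: order_trans[OF cost_address]\<close>)

lemma val_address:
  assumes "selected R r s"
  shows "val (address a e) s = (if a = 1 then (val e s * R + s 20 r) * R + r else val e s * R + r)"
  using assms by (simp add: address_def selected_def)

lemma val_sim_expr:
  assumes "selected R r s"
  shows "val (sim_expr e) s = val e (view R r s)"
  by (induction e) (use assms in \<open>auto simp: val_address view_def\<close>)

lemma interleave_less:
  fixes x :: nat
  assumes "x < m" "r < R"
  shows "x * R + r < m * R"
proof -
  have "x * R + r < Suc x * R" using assms(2) by simp
  also have "\<dots> \<le> m * R" using assms(1) by (intro mult_right_mono) auto
  finally show ?thesis .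
qed

text \<open>An address has at most three digits in base \<open>R\<close>, the leading one below
  \<open>m\<close>; this is why simulating capacity \<open>m\<close> takes a factor
  \<open>R * R\<close>.\<close>

lemma fits_address:
  assumes "selected R r s" "fits W e s" "val e s < m" "m * R * R < W"
  shows "fits W (address a e) s"
proof -
  let ?x = "val e s" and ?c = "s 20 r"
  have rR: "r < R" and cR: "?c < R" using assms(1) by (auto simp: selected_def)
  have R: "R \<le> R * R" "m * R \<le> m * R * R" "R * R \<le> m * R * R" using assms(3) rR by auto
  have "?x * R + ?c \<le> (?x * R + ?c) * R" using rR by auto
  then have "(?x * R + ?c) * R + r < W" "?x * R + r < W" "?x * R + ?c < W" "R < W"
    using interleave_less[OF interleave_less[OF assms(3) cR] rR] interleave_less[OF assms(3) rR] R assms(4)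
    by linarith+
  then show ?thesis using assms cR rR
    by (simp add: address_def selected_def)
qed

lemma fits_sim_expr:
  assumes "selected R r s" "m * R * R < W" "fits m e (view R r s)"
  shows "fits W (sim_expr e) s"
  using assms(3)
proof (induction e)
  case (Const k)
  then have "k * 1 < m * (R * R)" using assms(1) by (intro mult_less_le_imp_less) (auto simp: selected_def)
  then show ?case using assms(2) by (simp add: mult.assoc)
next
  case (Get a e)
  have "m * 1 \<le> m * (R * R)" using assms(1) by (intro mult_left_mono) (auto simp: selected_def)
  then have "m < W" using assms(2) by (simp only: mult.assoc mult_1_right)
  moreover have "val e (view R r s) < m"
    using Get.prems by (cases e) auto
  ultimately show ?case using Get assms(1,2) val_sim_expr[OF assms(1)] val_sim_expr[OF assms(1), of "Get a e"]
    by (auto intro!: fits_address[of R r s W _ m])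
next
  case (Bin f d e)
  have "m * 1 \<le> m * (R * R)" using assms(1) by (intro mult_left_mono) (auto simp: selected_def)
  then have "m < W" using assms(2) by (simp only: mult.assoc mult_1_right)
  then show ?case using Bin val_sim_expr[OF assms(1)] by auto
qed

lemma interleave_eq_iff:
  fixes r r' :: nat
  assumes "r < R" "r' < R"
  shows "x * R + r = y * R + r' \<longleftrightarrow> x = y \<and> r = r'"
proof
  assume eq: "x * R + r = y * R + r'"
  from arg_cong[OF eq, of "\<lambda>z. z div R"] arg_cong[OF eq, of "\<lambda>z. z mod R"]
  show "x = y \<and> r = r'" using assms by simp
qed simp

text \<open>Rule induction on the simulated run. The frame is proved along with the view because it
  keeps registers 5 and 6 and the counter in bank 20 intact, and with them the address translation
  for the rest of the run.\<close>

lemma run_sim: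
  assumes "run m c q t q'" "selected R r s" "view R r s = q" "m * R * R < W"
  shows "\<exists>t' s'. run W (sim c) s t' s' \<and> t' \<le> 14 * t \<and> view R r s' = q' \<and> frame R r s s'"
  using assms(1-3)
proof (induction arbitrary: s rule: run.induct)
  case (Skip q)
  then show ?case using run.Skip[of W s] frame_refl by fastforce
next
  case (Put d q e a)
  note sel = Put(3)
  let ?i = "if a = 1 then (val d q * R + s 20 r) * R + r else val d q * R + r"
  let ?s' = "s(21 + a := (s (21 + a))(?i := val e q))"
  have rR: "r < R" and cR: "s 20 r < R" using sel by (auto simp: selected_def)
  have "val d q < m" using Put(1) by (cases d) auto
  then have fd: "fits W (address a (sim_expr d)) s"
    using fits_sim_expr[OF sel assms(4)] Put val_sim_expr[OF sel]
    by (intro fits_address[OF sel _ _ assms(4)]) auto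
  have "run W (sim (Put a d e)) s (cost (address a (sim_expr d)) + cost (sim_expr e) + 1) ?s'"
    using run.Put[OF fd, of "sim_expr e" "21 + a"] fits_sim_expr[OF sel assms(4)] Put val_sim_expr[OF sel]
      val_address[OF sel] by auto
  moreover have "cost (address a (sim_expr d)) + cost (sim_expr e) + 1 \<le> 14 * (cost d + cost e + 1)"
    using cost_address[of a "sim_expr d"] cost_sim_expr[of d] cost_sim_expr[of e]
    by (simp del: One_nat_def)
  moreover have "view R r ?s' = q(a := (q a)(val d q := val e q))"
    unfolding Put(4)[symmetric] using interleave_eq_iff[OF rR rR] interleave_eq_iff[OF cR cR]
    by (auto simp: view_def fun_eq_iff)
  moreover have "frame R r s ?s'"
    using rR cR by (auto simp: frame_def)
  ultimately show ?case by blast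
next
  case (Seq c q t q' d t' q'')
  obtain u s' where 1: "run W (sim c) s u s'" "u \<le> 14 * t" "view R r s' = q'" "frame R r s s'"
    using Seq by blast
  obtain u' s'' where 2: "run W (sim d) s' u' s''" "u' \<le> 14 * t'" "view R r s'' = q''" "frame R r s' s''"
    using Seq.IH(2)[OF frame_selected[OF 1(4) Seq(5)] 1(3)] by blast
  show ?case using run.Seq[OF 1(1) 2(1)] 1(2) 2(2,3) frame_trans[OF 1(4) 2(4)]
    by (intro exI[of _ "u + u'"] exI[of _ s'']) auto
next
  case (CondTrue e q c t q' d)
  then obtain u s' where 1: "run W (sim c) s u s'" "u \<le> 14 * t" "view R r s' = q'" "frame R r s s'"
    by blast
  then show ?case
    using run.CondTrue[of W "sim_expr e" s "sim c" u s' "sim d"] CondTrue val_sim_expr[of R r s e]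
      fits_sim_expr[OF _ assms(4), of r s e] cost_sim_expr[of e]
    by (intro exI[of _ "cost (sim_expr e) + 1 + u"] exI[of _ s']) auto
next
  case (CondFalse e q d t q' c)
  then obtain u s' where 1: "run W (sim d) s u s'" "u \<le> 14 * t" "view R r s' = q'" "frame R r s s'"
    by blast
  then show ?case
    using run.CondFalse[of W "sim_expr e" s "sim d" u s' "sim c"] CondFalse val_sim_expr[of R r s e]
      fits_sim_expr[OF _ assms(4), of r s e] cost_sim_expr[of e]
    by (intro exI[of _ "cost (sim_expr e) + 1 + u"] exI[of _ s']) auto
next
  case (WhileFalse e q c)
  then show ?case
    using run.WhileFalse[of W "sim_expr e" s "sim c"] val_sim_expr[of R r s e]
      fits_sim_expr[OF _ assms(4), of r s e] cost_sim_expr[of e] frame_refl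
    by (intro exI[of _ "cost (sim_expr e) + 1"] exI[of _ s]) auto
next
  case (WhileTrue e q c t q' t' q'')
  obtain u s' where 1: "run W (sim c) s u s'" "u \<le> 14 * t" "view R r s' = q'" "frame R r s s'"
    using WhileTrue by blast
  obtain u' s'' where 2: "run W (sim (While e c)) s' u' s''" "u' \<le> 14 * t'" "view R r s'' = q''" "frame R r s' s''"
    using WhileTrue.IH(2)[OF frame_selected[OF 1(4) WhileTrue.prems(1)] 1(3)] by blast
  show ?case
    using run.WhileTrue[of W "sim_expr e" s "sim c" u s' u' s''] WhileTrue val_sim_expr[of R r s e] 1 2
      fits_sim_expr[OF _ assms(4), of r s e] cost_sim_expr[of e] frame_trans[OF 1(4) 2(4)]
    by (intro exI[of _ "cost (sim_expr e) + 1 + u + u'"] exI[of _ s'']) auto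
qed

section \<open>Requests of all instances, paid by a common potential\<close>

datatype act = Upd nat nat | Ask "nat set"

inductive performs :: "nat \<Rightarrow> com \<Rightarrow> com \<Rightarrow> act list \<Rightarrow> mem \<Rightarrow> nat \<Rightarrow> bool"
  for m :: nat and upd qry :: com where
  Nil: "performs m upd qry [] q 0"
| Upd: "run m upd (put_edge x y q) t q' \<Longrightarrow> performs m upd qry as q' t' \<Longrightarrow>
    performs m upd qry (Upd x y # as) q (t + t')"
| Ask: "run m qry q t q' \<Longrightarrow> q' 2 0 \<in> S \<Longrightarrow> performs m upd qry as q' t' \<Longrightarrow>
    performs m upd qry (Ask S # as) q (t + t')"

inductive_cases performs_UpdE: "performs m upd qry (Upd x y # as) q t"
inductive_cases performs_AskE: "performs m upd qry (Ask S # as) q t"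

text \<open>
  Here \<open>todo r\<close> are the actions that instance \<open>r\<close> still has to perform. The potential pays for the
  simulation of all of them; thus amortized bounds of the single instances need not be related to
  the individual calls.
\<close>

definition ready ::
    "nat \<Rightarrow> com \<Rightarrow> com \<Rightarrow> nat \<Rightarrow> nat \<Rightarrow> (nat \<Rightarrow> act list) \<Rightarrow> nat \<Rightarrow> mem \<Rightarrow> bool" where
  "ready m upd qry R I todo \<phi> s \<longleftrightarrow> (\<exists>b.
     (\<forall>r<I. performs m upd qry (todo r) (view R r s) (b r) \<and> s 20 r + length (todo r) < R \<and>
       (\<forall>i c. s 20 r < c \<longrightarrow> c < R \<longrightarrow> s 22 ((i * R + c) * R + r) = 0)) \<and>
     14 * (\<Sum>r<I. b r) \<le> \<phi>)"

lemma ready_cong: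
  assumes "ready m upd qry R I todo \<phi> s" "\<And>a. 20 \<le> a \<Longrightarrow> s' a = s a" "\<phi> \<le> \<phi>'"
  shows "ready m upd qry R I todo \<phi>' s'"
proof -
  have "view R r s' = view R r s" for r
    using assms(2) by (simp add: view_def fun_eq_iff)
  then show ?thesis using assms unfolding ready_def by (simp, meson order_trans)
qed

lemma frame_view:
  assumes "frame R r s s'" "r' \<noteq> r" "r' < R"
  shows "view R r' s' = view R r' s"
proof -
  have "s' a i = s a i" if "i mod R = r'" for a i
    using assms that unfolding frame_def by metis
  moreover have "s' 20 = s 20" using assms(1) by (simp add: frame_low)
  ultimately show ?thesis using assms(3) by (auto simp: view_def fun_eq_iff)
qed

text \<open>The two low digits of a cell of bank 22 name its instance and its copy, so a run can
  only reach the copy selected by the counter.\<close>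

lemma frame_fresh:
  assumes "frame R r s s'" "r' < R" "c < R" "r' = r \<Longrightarrow> s 20 r < c"
  shows "s' 22 ((i * R + c) * R + r') = s 22 ((i * R + c) * R + r')"
proof (rule ccontr)
  assume "\<not> ?thesis"
  with assms(1) have "((i * R + c) * R + r') mod R = r" "((i * R + c) * R + r') div R mod R = s 20 r"
    unfolding frame_def by blast+
  moreover have "((i * R + c) * R + r') mod R = r'" "((i * R + c) * R + r') div R mod R = c"
    using assms(2,3) by (simp_all add: div_mult_self3)
  ultimately show False using assms(4) by simp
qed

lemma sum_split_off:
  fixes b :: "nat \<Rightarrow> nat"
  assumes "r < I" "b r = t + t'"
  shows "(\<Sum>i<I. (b(r := t')) i) + t = (\<Sum>i<I. b i)"
proof -
  have "(\<Sum>i<I. (b(r := t')) i) = t' + (\<Sum>i\<in>{..<I} - {r}. b i)"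
    using assms(1) by (subst sum.remove[of _ r]) (auto intro!: sum.cong)
  moreover have "(\<Sum>i<I. b i) = b r + (\<Sum>i\<in>{..<I} - {r}. b i)"
    using assms(1) by (intro sum.remove) auto
  ultimately show ?thesis using assms(2) by simp
qed

definition call_update :: "com \<Rightarrow> com" where
  "call_update upd = Seq (Put 20 (var 6) (Bin Add (Get 20 (var 6)) (Const 1)))
     (Seq (Put 22 (address 1 (Const 0)) (var 7))
     (Seq (Put 22 (address 1 (Const 1)) (var 8)) (sim upd)))"

definition call_query :: "com \<Rightarrow> com" where
  "call_query qry = Seq (sim qry) (assign 12 (Get 23 (address 2 (Const 0))))"

text \<open>Advancing the counter swaps in a copy of bank 1 that is still zero. Two writes then have
  the effect of \<open>put_edge\<close>, which overwrites a whole bank.\<close>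

lemma view_fresh:
  assumes "r < R" "s 20 r + 1 < R" "\<And>i c. s 20 r < c \<Longrightarrow> c < R \<Longrightarrow> s 22 ((i * R + c) * R + r) = 0"
    and s': "s' = s(20 := (s 20)(r := s 20 r + 1), 22 := (s 22)
      ((0 * R + (s 20 r + 1)) * R + r := x, (1 * R + (s 20 r + 1)) * R + r := y))"
  shows "view R r s' = put_edge x y (view R r s)"
proof (intro ext)
  fix a i
  let ?c = "s 20 r + 1"
  have "(i * R + ?c) * R + r = (j * R + ?c) * R + r \<longleftrightarrow> i = j" for j
    using interleave_eq_iff[OF assms(1,1)] interleave_eq_iff[OF assms(2,2)] by auto
  note eq = this[of 0] this[of 1]
  show "view R r s' a i = put_edge x y (view R r s) a i"
  proof (cases "a = 1")
    case True
    have "view R r s' a i = (if (i * R + ?c) * R + r = (1 * R + ?c) * R + r then y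
        else if (i * R + ?c) * R + r = (0 * R + ?c) * R + r then x else s 22 ((i * R + ?c) * R + r))"
      using True by (simp add: view_def s')
    also have "\<dots> = (if i = 1 then y else if i = 0 then x else 0)"
      unfolding eq using assms(2) assms(3)[of ?c i] by simp
    finally show ?thesis using True by (simp add: put_edge_def)
  next
    case False
    then show ?thesis by (auto simp: view_def s' put_edge_def)
  qed
qed

lemma less_capacity:
  fixes R :: nat
  assumes "2 * R * R < W" "0 < R"
  shows "R < W" "1 < W"
proof -
  have "R * 1 \<le> R * R" using assms(2) by (intro mult_left_mono) auto
  then have "2 * R \<le> 2 * R * R" by simp
  then show "R < W" "1 < W" using assms by linarith+
qed

text \<open>The 60 units cover the bookkeeping only. The simulated run, whose length is unknown for
  a single call, is paid entirely from the potential.\<close>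

lemma steps_call_update:
  assumes ready: "ready m upd qry R I todo \<phi> s" and todo: "todo r = Upd x y # as"
    and r: "r < I" "I \<le> R" and W: "m * R * R < W" "2 * R * R < W"
    and regs: "s 5 0 = R" "s 6 0 = r" "s 7 0 = x" "s 8 0 = y" "x < W" "y < W"
  shows "steps W (call_update upd) s \<phi> 60
    (\<lambda>\<phi>' s'. ready m upd qry R I (todo(r := as)) \<phi>' s' \<and> (\<forall>a<20. s' a = s a))"
proof -
  let ?c = "s 20 r + 1"
  obtain b where b: "\<And>r. r < I \<Longrightarrow> performs m upd qry (todo r) (view R r s) (b r)"
    "\<And>r. r < I \<Longrightarrow> s 20 r + length (todo r) < R"
    "\<And>r i c. r < I \<Longrightarrow> s 20 r < c \<Longrightarrow> c < R \<Longrightarrow> s 22 ((i * R + c) * R + r) = 0"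
    "14 * (\<Sum>r<I. b r) \<le> \<phi>"
    using ready unfolding ready_def by blast
  have c: "?c < R" and rR: "r < R" using b(2)[OF r(1)] todo r by auto
  obtain t t' q' where run: "run m upd (put_edge x y (view R r s)) t q'"
    "performs m upd qry as q' t'" "b r = t + t'"
    using b(1)[OF r(1)] unfolding todo by (elim performs_UpdE) blast
  define s1 where "s1 = s(20 := (s 20)(r := ?c))"
  define s2 where "s2 = s1(22 := (s1 22)((0 * R + ?c) * R + r := x))"
  define s3 where "s3 = s2(22 := (s2 22)((1 * R + ?c) * R + r := y))"
  have sel: "selected R r s1" "selected R r s2" "selected R r s3"
    using regs c rR by (auto simp: selected_def s1_def s2_def s3_def)
  have RW: "R < W" "1 < W" using less_capacity[OF W(2)] rR by auto
  have "view R r s3 = put_edge x y (view R r s)"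
    by (rule view_fresh[OF rR c b(3)[OF r(1)]]) (auto simp: s3_def s2_def s1_def)
  then obtain u s4 where sim: "run W (sim upd) s3 u s4" "u \<le> 14 * t" "view R r s4 = q'" "frame R r s3 s4"
    using run_sim[OF run(1) sel(3) _ W(1)] by blast
  have fr: "frame R r s1 s4"
  proof -
    have "((i * R + ?c) * R + r) mod R = r" "((i * R + ?c) * R + r) div R mod R = ?c" for i
      using rR c by (simp_all add: div_mult_self3 del: add_Suc_right)
    note this[of 0] this[of 1]
    moreover have "a = 22 \<and> (i = (0 * R + ?c) * R + r \<or> i = (1 * R + ?c) * R + r)"
      if "s3 a i \<noteq> s1 a i" for a i
      using that unfolding s3_def s2_def by (auto split: if_splits)
    moreover have "s1 20 r = ?c" by (simp add: s1_def)
    moreover have "(20::nat) < 22" by simp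
    ultimately have "frame R r s1 s3"
      unfolding frame_def by metis
    then show ?thesis using sim(4) frame_trans by blast
  qed
  have s1: "view R r' s1 = view R r' s" if "r' \<noteq> r" for r'
    using that by (simp add: view_def s1_def fun_eq_iff)
  \<comment> \<open>Truncated subtraction is harmless: the share \<open>b r\<close> of this instance
    in the potential contains \<open>t\<close>, hence \<open>14 * t\<close> is at most
    \<open>\<phi>\<close>.\<close>
  have "ready m upd qry R I (todo(r := as)) (\<phi> - 14 * t) s4"
    unfolding ready_def
  proof (intro exI[of _ "b(r := t')"] conjI allI impI)
    fix r' assume r': "r' < I"
    then have r'R: "r' < R" using r by simp
    show "performs m upd qry ((todo(r := as)) r') (view R r' s4) ((b(r := t')) r')"
      using run(2) sim(3) frame_view[OF fr, of r'] s1[of r'] b(1)[OF r'] r'R by auto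
    have cnt: "s4 20 r' = (if r' = r then ?c else s 20 r')"
      using frame_low[OF fr, of 20] by (simp add: s1_def)
    then show "s4 20 r' + length ((todo(r := as)) r') < R"
      using b(2)[OF r'] todo by auto
    fix i c' assume c': "s4 20 r' < c'" "c' < R"
    have "s4 22 ((i * R + c') * R + r') = s1 22 ((i * R + c') * R + r')"
      using c' cnt by (intro frame_fresh[OF fr r'R]) (auto simp: s1_def)
    then show "s4 22 ((i * R + c') * R + r') = 0"
      using b(3)[OF r', of c' i] c' cnt by (auto simp: s1_def split: if_splits)
  next
    show "14 * (\<Sum>i<I. (b(r := t')) i) \<le> \<phi> - 14 * t"
      using sum_split_off[of r I b t t', OF r(1) run(3)] b(4) by linarith
  qed
  moreover have "14 * t \<le> \<phi>" using sum_split_off[of r I b t t', OF r(1) run(3)] b(4) by linarith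
  moreover have "\<forall>a<20. s4 a = s a"
    using frame_low[OF fr] by (auto simp: s1_def)
  ultimately have last: "steps W (sim upd) s3 \<phi> 0
      (\<lambda>\<phi>' s'. ready m upd qry R I (todo(r := as)) \<phi>' s' \<and> (\<forall>a<20. s' a = s a))"
    unfolding steps_def using sim(1,2)
    by (intro exI[of _ u] exI[of _ s4] exI[of _ "\<phi> - 14 * t"]) auto
  have va: "val (address 1 (Const 0)) s1 = (0 * R + ?c) * R + r"
    "val (address 1 (Const 1)) s2 = (1 * R + ?c) * R + r"
    using val_address[OF sel(1), of 1 "Const 0"] val_address[OF sel(2), of 1 "Const 1"]
    by (simp_all add: s1_def s2_def)
  have fi: "fits W (address 1 (Const 0)) s1" "fits W (address 1 (Const 1)) s2"
    using RW by (auto intro!: fits_address[OF sel(1) _ _ W(2)] fits_address[OF sel(2) _ _ W(2)])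
  have "steps W (Put 22 (address 1 (Const 1)) (var 8)) s2 \<phi> 18
      (\<lambda>\<phi>' s'. \<phi>' = \<phi> \<and> s' = s3)"
    by (rule steps_mono[OF steps_Put[where Q = "\<lambda>\<phi>' s'. \<phi>' = \<phi> \<and> s' = s3"]])
      (use fi va RW regs in \<open>auto simp: s1_def s2_def s3_def address_def\<close>)
  then have 3: "steps W (Seq (Put 22 (address 1 (Const 1)) (var 8)) (sim upd)) s2 \<phi> (18 + 0)
      (\<lambda>\<phi>' s'. ready m upd qry R I (todo(r := as)) \<phi>' s' \<and> (\<forall>a<20. s' a = s a))"
    by (intro steps_Seq, elim steps_mono) (use last in auto)
  have "steps W (Put 22 (address 1 (Const 0)) (var 7)) s1 \<phi> 18
      (\<lambda>\<phi>' s'. \<phi>' = \<phi> \<and> s' = s2)"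
    by (rule steps_mono[OF steps_Put[where Q = "\<lambda>\<phi>' s'. \<phi>' = \<phi> \<and> s' = s2"]])
      (use fi va RW regs in \<open>auto simp: s1_def s2_def address_def\<close>)
  then have 2: "steps W (Seq (Put 22 (address 1 (Const 0)) (var 7))
       (Seq (Put 22 (address 1 (Const 1)) (var 8)) (sim upd))) s1 \<phi> (18 + (18 + 0))
      (\<lambda>\<phi>' s'. ready m upd qry R I (todo(r := as)) \<phi>' s' \<and> (\<forall>a<20. s' a = s a))"
    by (intro steps_Seq, elim steps_mono) (use 3 in auto)
  have "steps W (Put 20 (var 6) (Bin Add (Get 20 (var 6)) (Const 1))) s \<phi> 18
      (\<lambda>\<phi>' s'. \<phi>' = \<phi> \<and> s' = s1)"
    by (rule steps_mono[OF steps_Put[where Q = "\<lambda>\<phi>' s'. \<phi>' = \<phi> \<and> s' = s1"]])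
      (use RW regs rR c in \<open>auto simp: s1_def\<close>)
  then have "steps W (call_update upd) s \<phi> (18 + (18 + (18 + 0)))
      (\<lambda>\<phi>' s'. ready m upd qry R I (todo(r := as)) \<phi>' s' \<and> (\<forall>a<20. s' a = s a))"
    unfolding call_update_def by (intro steps_Seq, elim steps_mono) (use 2 in auto)
  then show ?thesis by (rule steps_mono) auto
qed

text \<open>The answer is copied into register 12 by an ordinary assignment, so every element of
  \<open>S\<close> has to be a word.\<close>

lemma steps_call_query:
  assumes ready: "ready m upd qry R I todo \<phi> s" and todo: "todo r = Ask S # as"
    and r: "r < I" "I \<le> R" and W: "m * R * R < W" "2 * R * R < W"
    and regs: "s 5 0 = R" "s 6 0 = r" "\<And>a. a \<in> S \<Longrightarrow> a < W"
  shows "steps W (call_query qry) s \<phi> 60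
    (\<lambda>\<phi>' s'. ready m upd qry R I (todo(r := as)) \<phi>' s' \<and> (\<forall>a<20. a \<noteq> 12 \<longrightarrow> s' a = s a) \<and> s' 12 0 \<in> S)"
proof -
  obtain b where b: "\<And>r. r < I \<Longrightarrow> performs m upd qry (todo r) (view R r s) (b r)"
    "\<And>r. r < I \<Longrightarrow> s 20 r + length (todo r) < R"
    "\<And>r i c. r < I \<Longrightarrow> s 20 r < c \<Longrightarrow> c < R \<Longrightarrow> s 22 ((i * R + c) * R + r) = 0"
    "14 * (\<Sum>r<I. b r) \<le> \<phi>"
    using ready unfolding ready_def by blast
  have rR: "r < R" using r by auto
  have sel: "selected R r s" using b(2)[OF r(1)] rR regs by (simp add: selected_def)
  obtain t t' q' where run: "run m qry (view R r s) t q'" "q' 2 0 \<in> S"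
    "performs m upd qry as q' t'" "b r = t + t'"
    using b(1)[OF r(1)] unfolding todo by (elim performs_AskE) blast
  have RW: "R < W" "0 < W" using less_capacity[OF W(2)] rR by auto
  obtain u s1 where sim: "run W (sim qry) s u s1" "u \<le> 14 * t" "view R r s1 = q'" "frame R r s s1"
    using run_sim[OF run(1) sel _ W(1)] by blast
  have sel1: "selected R r s1" using frame_selected[OF sim(4) sel] .
  have rd: "ready m upd qry R I (todo(r := as)) (\<phi> - 14 * t) s1"
    unfolding ready_def
  proof (intro exI[of _ "b(r := t')"] conjI allI impI)
    fix r' assume r': "r' < I"
    then have r'R: "r' < R" using r by simp
    show "performs m upd qry ((todo(r := as)) r') (view R r' s1) ((b(r := t')) r')"
      using run(3) sim(3) frame_view[OF sim(4), of r'] b(1)[OF r'] r'R by auto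
    have cnt: "s1 20 = s 20"
      using frame_low[OF sim(4), of 20] by simp
    then show "s1 20 r' + length ((todo(r := as)) r') < R"
      using b(2)[OF r'] todo by auto
    fix i c assume c: "s1 20 r' < c" "c < R"
    have "s1 22 ((i * R + c) * R + r') = s 22 ((i * R + c) * R + r')"
      using c cnt by (intro frame_fresh[OF sim(4) r'R]) auto
    then show "s1 22 ((i * R + c) * R + r') = 0"
      using b(3)[OF r', of c i] c cnt by auto
  next
    show "14 * (\<Sum>i<I. (b(r := t')) i) \<le> \<phi> - 14 * t"
      using sum_split_off[of r I b t t', OF r(1) run(4)] b(4) by linarith
  qed
  have "14 * t \<le> \<phi>" using sum_split_off[of r I b t t', OF r(1) run(4)] b(4) by linarith
  then have first: "steps W (sim qry) s \<phi> 0 (\<lambda>\<phi>' s'. \<phi>' = \<phi> - 14 * t \<and> s' = s1)"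
    unfolding steps_def using sim(1,2)
    by (intro exI[of _ u] exI[of _ s1] exI[of _ "\<phi> - 14 * t"]) auto
  have "val (Get 23 (address 2 (Const 0))) s1 = q' 2 0"
    using val_address[OF sel1, of 2 "Const 0"] unfolding sim(3)[symmetric] by (simp add: view_def)
  moreover have "fits W (address 2 (Const 0)) s1"
    using RW by (intro fits_address[OF sel1 _ _ W(2)]) auto
  ultimately have "steps W (assign 12 (Get 23 (address 2 (Const 0)))) s1 (\<phi> - 14 * t) 60
    (\<lambda>\<phi>' s'. ready m upd qry R I (todo(r := as)) \<phi>' s' \<and> (\<forall>a<20. a \<noteq> 12 \<longrightarrow> s' a = s a) \<and> s' 12 0 \<in> S)"
    using frame_low[OF sim(4)] RW regs(3)[OF run(2)] run(2)
    by (intro steps_mono[OF steps_Put[where Q = "\<lambda>\<phi>' s'. ready m upd qry R I (todo(r := as)) \<phi>' s' \<and> (\<forall>a<20. a \<noteq> 12 \<longrightarrow> s' a = s a) \<and> s' 12 0 \<in> S"]])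
      (auto simp: address_def intro: ready_cong[OF rd])
  then have "steps W (call_query qry) s \<phi> (0 + 60)
    (\<lambda>\<phi>' s'. ready m upd qry R I (todo(r := as)) \<phi>' s' \<and> (\<forall>a<20. a \<noteq> 12 \<longrightarrow> s' a = s a) \<and> s' 12 0 \<in> S)"
    unfolding call_query_def by (intro steps_Seq) (rule steps_mono[OF first], auto)
  then show ?thesis by simp
qed

section \<open>Matchings and vertex covers\<close>

text \<open>Matching edges are disjoint, so each of them picks a covering node of its own: the easy
  half of Koenig's theorem.\<close>

lemma matching_card_le_cover:
  assumes "matching E F" "finite C" "\<And>e. e \<in> E \<Longrightarrow> e \<inter> C \<noteq> {}"
  shows "card F \<le> card C"
proof -
  have "\<forall>e\<in>F. \<exists>x. x \<in> e \<inter> C"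
    using assms(1,3) unfolding matching_def by blast
  then obtain h where h: "\<And>e. e \<in> F \<Longrightarrow> h e \<in> e \<inter> C"
    using bchoice by metis
  have "inj_on h F"
  proof (rule inj_onI)
    fix e e' assume "e \<in> F" "e' \<in> F" "h e = h e'"
    then have "h e \<in> e \<inter> e'" using h[of e] h[of e'] by auto
    then show "e = e'" using assms(1) \<open>e \<in> F\<close> \<open>e' \<in> F\<close> unfolding matching_def disjoint_def by blast
  qed
  moreover have "h ` F \<subseteq> C" using h by blast
  ultimately show ?thesis using assms(2) by (rule card_inj_on_le)
qed

lemma finite_matching_sizes: "finite E \<Longrightarrow> finite {card F |F. matching E F}"
  by (rule finite_subset[of _ "card ` Pow E"]) (auto simp: matching_def)

lemma max_matching_le_cover:
  assumes "finite E" "finite C" "\<And>e. e \<in> E \<Longrightarrow> e \<inter> C \<noteq> {}"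
  shows "max_matching_size E \<le> card C"
proof -
  have "matching E {}" by (simp add: matching_def)
  then show ?thesis unfolding max_matching_size_def
    using assms matching_card_le_cover[OF _ assms(2,3)]
    by (subst Max_le_iff) (auto simp: finite_matching_sizes)
qed

lemma card_le_max_matching: "finite E \<Longrightarrow> matching E F \<Longrightarrow> card F \<le> max_matching_size E"
  unfolding max_matching_size_def by (rule Max_ge) (auto simp: finite_matching_sizes)

section \<open>The reduction graph\<close>

text \<open>
  An edge between node \<open>X < 4 * k\<close> and node \<open>4 * k + Y\<close>, \<open>Y < 4 * k\<close>, is represented by \<open>(X, Y)\<close>.
  For \<open>i, p < k\<close> the left nodes are \<open>s\<^sub>p = p\<close>, \<open>a\<^sub>i = k + i\<close>, \<open>d\<^sub>i = 2 * k + i\<close>, \<open>q\<^sub>p = 3 * k + p\<close>;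
  the right nodes are given by \<open>Y = i\<close> for \<open>c\<^sub>i\<close>, \<open>k + i\<close> for \<open>b\<^sub>i\<close>, \<open>2 * k + p\<close> for \<open>t\<^sub>p\<close>, \<open>3 * k + p\<close>
  for \<open>l\<^sub>p\<close>. A path \<open>s\<^sub>p, c\<^sub>i, a\<^sub>i, b\<^sub>j, d\<^sub>j, t\<^sub>p\<close> witnesses \<open>u i \<and> M i j \<and> v j\<close>. The leaf \<open>l\<^sub>p\<close> at
  \<open>s\<^sub>p\<close> and the leaf \<open>q\<^sub>p\<close> at \<open>t\<^sub>p\<close> take slot \<open>p\<close> out of the game.
\<close>

definition edge :: "nat \<Rightarrow> nat \<times> nat \<Rightarrow> nat set" where
  "edge k z = {fst z, 4 * k + snd z}"

definition board :: "nat \<Rightarrow> (nat \<times> nat) set" where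
  "board k = {..<4 * k} \<times> {..<4 * k}"

definition core :: "nat \<Rightarrow> (nat \<Rightarrow> nat \<Rightarrow> bool) \<Rightarrow> (nat \<times> nat) set" where
  "core k M = {(k + i, i) |i. i < 2 * k} \<union> {(k + i, k + j) |i j. i < k \<and> j < k \<and> M i j}"

definition rows :: "nat \<Rightarrow> nat \<Rightarrow> (nat \<Rightarrow> bool) \<Rightarrow> (nat \<Rightarrow> bool) \<Rightarrow> (nat \<times> nat) set" where
  "rows k p u v = {(p, i) |i. i < k \<and> u i} \<union> {(2 * k + j, 2 * k + p) |j. j < k \<and> v j}"

definition leaves :: "nat \<Rightarrow> nat \<Rightarrow> (nat \<times> nat) set" where
  "leaves k p = {(p, 3 * k + p), (3 * k + p, 2 * k + p)}"

definition slot :: "nat \<Rightarrow> nat \<Rightarrow> (nat \<times> nat) set" where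
  "slot k p = rows k p (\<lambda>_. True) (\<lambda>_. True) \<union> leaves k p"

definition pairs :: "nat \<Rightarrow> (nat \<Rightarrow> nat \<Rightarrow> bool) \<Rightarrow> (nat \<Rightarrow> (nat \<times> nat) set) \<Rightarrow> (nat \<times> nat) set" where
  "pairs k M S = core k M \<union> (\<Union>p<k. S p)"

abbreviation hits :: "nat \<Rightarrow> (nat \<Rightarrow> nat \<Rightarrow> bool) \<Rightarrow> (nat \<Rightarrow> bool) \<Rightarrow> (nat \<Rightarrow> bool) \<Rightarrow> bool" where
  "hits k M u v \<equiv> \<exists>i<k. \<exists>j<k. u i \<and> M i j \<and> v j"

lemma inj_on_edge: "inj_on (edge k) (board k)"
  by (auto simp: inj_on_def board_def edge_def doubleton_eq_iff)

lemma core_board: "core k M \<subseteq> board k"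
  by (auto simp: core_def board_def)

lemma slot_board: "p < k \<Longrightarrow> slot k p \<subseteq> board k"
  by (auto simp: slot_def rows_def leaves_def board_def)

lemma rows_slot: "rows k p u v \<subseteq> slot k p"
  by (auto simp: slot_def rows_def)

lemma leaves_slot: "leaves k p \<subseteq> slot k p"
  by (auto simp: slot_def)

lemma slot_disjoint: "p < k \<Longrightarrow> p' < k \<Longrightarrow> p \<noteq> p' \<Longrightarrow> slot k p \<inter> slot k p' = {}"
  by (auto simp: slot_def rows_def leaves_def)

lemma core_slot_disjoint: "p < k \<Longrightarrow> core k M \<inter> slot k p = {}"
  by (auto simp: core_def slot_def rows_def leaves_def)

lemma rows_leaves_disjoint: "p < k \<Longrightarrow> rows k p u v \<inter> leaves k p = {}"
  by (auto simp: rows_def leaves_def)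

lemma pairs_board: "(\<And>p. p < k \<Longrightarrow> S p \<subseteq> slot k p) \<Longrightarrow> pairs k M S \<subseteq> board k"
  using core_board slot_board unfolding pairs_def by blast

lemma pairs_add:
  assumes "p < k"
  shows "pairs k M S \<union> D = pairs k M (S(p := S p \<union> D))"
  using assms by (auto simp: pairs_def split: if_splits)

lemma pairs_diff:
  assumes "p < k" "\<And>p. p < k \<Longrightarrow> S p \<subseteq> slot k p" "D \<subseteq> slot k p"
  shows "pairs k M S - D = pairs k M (S(p := S p - D))"
proof -
  have "D \<inter> core k M = {}" "\<And>p'. p' < k \<Longrightarrow> p' \<noteq> p \<Longrightarrow> D \<inter> S p' = {}"
    using assms core_slot_disjoint slot_disjoint by blast+
  then show ?thesis using assms(1) by (auto simp: pairs_def split: if_splits)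
qed

lemma pairs_slot:
  assumes "p < k" "\<And>p. p < k \<Longrightarrow> S p \<subseteq> slot k p"
  shows "pairs k M S \<inter> slot k p = S p"
  using assms core_slot_disjoint[of p k M] slot_disjoint[of p k] unfolding pairs_def by blast

lemma max_matching_graph_le: "P \<subseteq> board k \<Longrightarrow> max_matching_size (edge k ` P) \<le> 8 * k"
  using max_matching_le_cover[of "edge k ` P" "{..<8 * k}"] finite_subset[of P "board k"]
  by (force simp: board_def edge_def)

text \<open>With \<open>s\<^sub>p\<close> and \<open>t\<^sub>p\<close> unmatched, the edges
  \<open>a\<^sub>i c\<^sub>i\<close> and \<open>d\<^sub>j b\<^sub>j\<close> and both leaf edges of
  each slot in \<open>L\<close> form a matching of size \<open>2 * (k + card L)\<close>. A hit
  provides an augmenting path; without one, a vertex cover of the same size shows that this matching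
  is maximum.\<close>

lemma max_matching_pairs:
  assumes p: "p < k" and L: "L \<subseteq> {..<k} - {p}"
    and S: "S p = rows k p u v" "\<And>l. l \<in> L \<Longrightarrow> leaves k l \<subseteq> S l \<and> S l \<subseteq> slot k l"
      "\<And>l. l < k \<Longrightarrow> l \<notin> L \<Longrightarrow> l \<noteq> p \<Longrightarrow> S l = {}"
  shows "2 * (k + card L) < max_matching_size (edge k ` pairs k M S) \<longleftrightarrow> hits k M u v"
proof -
  let ?E = "edge k ` pairs k M S"
  have "pairs k M S \<subseteq> board k"
    using S rows_slot by (intro pairs_board) (metis empty_subsetI)
  moreover have "finite (board k)" by (simp add: board_def)
  ultimately have fin: "finite ?E" using finite_subset by blast
  have finL: "finite L" using L finite_subset by blast
  show ?thesis
  proof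
    assume "hits k M u v"
    then obtain i j where ij: "i < k" "j < k" "u i" "M i j" "v j" by blast
    \<comment> \<open>The matching after augmentation along \<open>s\<^sub>p, c\<^sub>i, a\<^sub>i,
      b\<^sub>j, d\<^sub>j, t\<^sub>p\<close>, as a map on left nodes. A slot node in
      \<open>L\<close> goes to its leaf; \<open>X - k\<close> is the partner of all others, also of
      the leaves \<open>q\<close>.\<close>
    define mate where "mate X = (if X = p then i else if X = k + i then k + j
      else if X = 2 * k + j then 2 * k + p else if X < k then 3 * k + X else X - k)" for X
    define D where "D = {k..<3 * k} \<union> ({p} \<union> (L \<union> (\<lambda>l. 3 * k + l) ` L))"
    have rng: "(k \<le> X \<and> X < 3 * k) \<or> X = p \<or> (X < k \<and> X \<noteq> p) \<or>
        (3 * k \<le> X \<and> X < 4 * k \<and> X \<noteq> 3 * k + p)" if "X \<in> D" for X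
      using that L unfolding D_def by auto
    define unmate where "unmate Y = (if Y = i then p else if Y = k + j then k + i
      else if Y = 2 * k + p then 2 * k + j else if 3 * k \<le> Y then Y - 3 * k else Y + k)" for Y
    have "unmate (mate X) = X" if "X \<in> D" for X
      using rng[OF that] p ij(1,2) unfolding mate_def unmate_def by (elim disjE conjE) (simp_all, arith+)
    then have "inj_on mate D" by (rule inj_on_inverseI)
    moreover have D: "D \<subseteq> {..<4 * k}" unfolding D_def using p L by auto
    ultimately have dis: "disjoint ((\<lambda>X. edge k (X, mate X)) ` D)"
      "inj_on (\<lambda>X. edge k (X, mate X)) D"
      unfolding disjoint_def inj_on_def by (auto simp: edge_def doubleton_eq_iff)
    have "card (L \<union> (\<lambda>l. 3 * k + l) ` L) = card L + card L"
      using L finL by (subst card_Un_disjoint) (auto simp: card_image)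
    moreover have "card ({p} \<union> (L \<union> (\<lambda>l. 3 * k + l) ` L)) = 1 + card (L \<union> (\<lambda>l. 3 * k + l) ` L)"
      using L finL p by (subst card_Un_disjoint) auto
    moreover have "card D = 2 * k + card ({p} \<union> (L \<union> (\<lambda>l. 3 * k + l) ` L))"
      unfolding D_def using L finL p by (subst card_Un_disjoint) auto
    ultimately have "card D = 2 * k + (1 + (card L + card L))" by simp
    then have "card ((\<lambda>X. edge k (X, mate X)) ` D) = 2 * (k + card L) + 1"
      using dis(2) by (simp add: card_image)
    moreover have "(X, mate X) \<in> pairs k M S" if "X \<in> D" for X
    proof -
      have "(l, 3 * k + l) \<in> pairs k M S" "(3 * k + l, 2 * k + l) \<in> pairs k M S" if "l \<in> L" for l
        using S(2)[OF that] L that by (auto simp: leaves_def pairs_def)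
      moreover have "(X, X - k) \<in> pairs k M S" if "k \<le> X" "X < 3 * k"
        using that by (auto simp: pairs_def core_def intro!: exI[of _ "X - k"])
      moreover have "(p, i) \<in> pairs k M S" "(k + i, k + j) \<in> pairs k M S"
        "(2 * k + j, 2 * k + p) \<in> pairs k M S"
        using ij p S(1) by (auto simp: pairs_def core_def rows_def)
      moreover have "X \<in> {k..<3 * k} \<or> X = p \<or> X \<in> L \<or> (\<exists>l\<in>L. X = 3 * k + l)"
        using that unfolding D_def by blast
      ultimately show ?thesis using p L ij unfolding mate_def by (elim disjE bexE) auto
    qed
    then have "matching ?E ((\<lambda>X. edge k (X, mate X)) ` D)"
      using dis(1) by (auto simp: matching_def)
    ultimately show "2 * (k + card L) < max_matching_size ?E"
      using card_le_max_matching[OF fin] by fastforce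
  next
    assume "2 * (k + card L) < max_matching_size ?E"
    moreover have "max_matching_size ?E \<le> 2 * (k + card L)" if no: "\<not> hits k M u v"
    proof -
      \<comment> \<open>Take \<open>c\<^sub>i\<close> if \<open>u i\<close> and
        \<open>a\<^sub>i\<close> otherwise, \<open>d\<^sub>j\<close> if \<open>v j\<close> and
        \<open>b\<^sub>j\<close> otherwise; slots in \<open>L\<close> are covered by their nodes
        \<open>s\<close> and \<open>t\<close>. An uncovered matrix edge
        \<open>a\<^sub>i b\<^sub>j\<close> would require \<open>u i\<close> and \<open>v j\<close>,
        which is a hit.\<close>
      define C where "C = ((\<lambda>i. if u i then 4 * k + i else k + i) ` {..<k} \<union>
        (\<lambda>j. if v j then 2 * k + j else 5 * k + j) ` {..<k}) \<union> (L \<union> (\<lambda>l. 6 * k + l) ` L)"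
      have "e \<inter> C \<noteq> {}" if e: "e \<in> ?E" for e
      proof -
        obtain X Y where XY: "e = {X, 4 * k + Y}" "(X, Y) \<in> pairs k M S"
          using e by (auto simp: edge_def)
        have "X \<in> C \<or> 4 * k + Y \<in> C"
        proof (cases "(X, Y) \<in> core k M")
          case True
          then consider i where "i < k" "X = k + i" "Y = i" | j where "j < k" "X = 2 * k + j" "Y = k + j"
            | i j where "i < k" "j < k" "X = k + i" "Y = k + j" "M i j"
            unfolding core_def by (auto; (metis add.assoc add_less_cancel_left le_Suc_ex mult_2 not_less))
          then show ?thesis
          proof cases
            case (1 i)
            then show ?thesis by (cases "u i") (auto simp: C_def)
          next
            case (2 j)
            then show ?thesis by (cases "v j") (auto simp: C_def)
          next
            case (3 i j)
            then show ?thesis using no by (cases "u i"; cases "v j") (auto simp: C_def)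
          qed
        next
          case False
          then obtain l where l: "l < k" "(X, Y) \<in> S l" using XY(2) by (auto simp: pairs_def)
          show ?thesis
          proof (cases "l = p")
            case True
            then show ?thesis using l S(1) unfolding C_def rows_def
              by (auto simp: image_iff)
          next
            case False
            then have "l \<in> L" "(X, Y) \<in> slot k l" using l S(2,3) by blast+
            then show ?thesis unfolding C_def slot_def rows_def leaves_def by auto
          qed
        qed
        then show ?thesis using XY(1) by blast
      qed
      moreover have "card C \<le> (k + k) + (card L + card L)"
        unfolding C_def
        by (intro order_trans[OF card_Un_le] add_mono order_trans[OF card_image_le]) (auto simp: finL)
      moreover have "finite C" using finL by (simp add: C_def)
      ultimately show ?thesis using max_matching_le_cover[OF fin, of C] by fastforce
    qed
    ultimately show "hits k M u v" by fastforce
  qed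
qed

section \<open>Requests of one instance\<close>

text \<open>The flag \<open>dec\<close> selects the decremental version throughout.\<close>

definition upd_pair :: "nat \<Rightarrow> nat \<times> nat \<Rightarrow> act" where
  "upd_pair k z = Upd (fst z) (4 * k + snd z)"

definition base :: "bool \<Rightarrow> nat \<Rightarrow> (nat \<Rightarrow> nat \<Rightarrow> bool) \<Rightarrow> (nat \<times> nat) set" where
  "base dec k M = pairs k M (\<lambda>p. if dec then slot k p else {})"

text \<open>Insertions produce the base graph from the empty graph, deletions remove its complement
  from the complete one. The order is that of the loop in \<open>init_code\<close>, which encodes a
  pair as a number below \<open>(4 * k) * (4 * k)\<close>.\<close>

definition base_list :: "bool \<Rightarrow> nat \<Rightarrow> (nat \<Rightarrow> nat \<Rightarrow> bool) \<Rightarrow> (nat \<times> nat) list" where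
  "base_list dec k M = map (\<lambda>e. (e div (4 * k), e mod (4 * k)))
     (filter (\<lambda>e. ((e div (4 * k), e mod (4 * k)) \<in> base dec k M) \<noteq> dec) [0..<(4 * k) * (4 * k)])"

definition row_list :: "bool \<Rightarrow> nat \<Rightarrow> nat \<Rightarrow> (nat \<Rightarrow> bool) \<Rightarrow> (nat \<Rightarrow> bool) \<Rightarrow> (nat \<times> nat) list" where
  "row_list b k p u v = map (\<lambda>i. (p, i)) (filter (\<lambda>i. u i = b) [0..<k]) @
     map (\<lambda>j. (2 * k + j, 2 * k + p)) (filter (\<lambda>j. v j = b) [0..<k])"

definition leaf_list :: "nat \<Rightarrow> nat \<Rightarrow> (nat \<times> nat) list" where
  "leaf_list k p = [(p, 3 * k + p), (3 * k + p, 2 * k + p)]"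

text \<open>The inner conditional counts the slots that carry leaves in phase \<open>p\<close>: the
  earlier ones if leaves get inserted, the later ones if leaves get deleted.\<close>

definition threshold :: "bool \<Rightarrow> nat \<Rightarrow> nat \<Rightarrow> nat" where
  "threshold dec k p = 2 * (k + (if dec then k - Suc p else p))"

text \<open>A set instead of the exact size: the program only compares with the threshold, so
  \<open>phase\<close> can be written down without mentioning the graph. The bound
  \<open>8 * k\<close> guarantees that the answer fits into a word.\<close>

definition answers :: "nat \<Rightarrow> nat \<Rightarrow> bool \<Rightarrow> nat set" where
  "answers k thr b = {a. a \<le> 8 * k \<and> (thr < a \<longleftrightarrow> b)}"

text \<open>Both versions arrive at the same slot, \<open>rows k p u v\<close> without leaves:
  insertions build it from the empty slot, deletions carve it out of the full one. Afterwards
  \<open>post_list\<close> retires the slot, by attaching its leaves or by deleting its remaining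
  edges.\<close>

definition pre_list :: "bool \<Rightarrow> nat \<Rightarrow> nat \<Rightarrow> (nat \<Rightarrow> bool) \<Rightarrow> (nat \<Rightarrow> bool) \<Rightarrow> (nat \<times> nat) list" where
  "pre_list dec k p u v = row_list (\<not> dec) k p u v @ (if dec then leaf_list k p else [])"

definition post_list :: "bool \<Rightarrow> nat \<Rightarrow> nat \<Rightarrow> (nat \<Rightarrow> bool) \<Rightarrow> (nat \<Rightarrow> bool) \<Rightarrow> (nat \<times> nat) list" where
  "post_list dec k p u v = (if dec then row_list True k p u v else leaf_list k p)"

definition phase ::
    "bool \<Rightarrow> nat \<Rightarrow> (nat \<Rightarrow> nat \<Rightarrow> bool) \<Rightarrow> nat \<Rightarrow> (nat \<Rightarrow> bool) \<Rightarrow> (nat \<Rightarrow> bool) \<Rightarrow> act list" where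
  "phase dec k M p u v = map (upd_pair k) (pre_list dec k p u v) @
     Ask (answers k (threshold dec k p) (hits k M u v)) # map (upd_pair k) (post_list dec k p u v)"

text \<open>A single predicate for both versions: it yields valid request sequences
  (\<open>legal_valid\<close>) and turns correct answers into accepted ones
  (\<open>legal_performs\<close>).\<close>

fun legal :: "bool \<Rightarrow> nat \<Rightarrow> (nat \<times> nat) set \<Rightarrow> act list \<Rightarrow> bool" where
  "legal dec k P [] \<longleftrightarrow> True"
| "legal dec k P (Upd x y # as) \<longleftrightarrow> (\<exists>z\<in>board k. Upd x y = upd_pair k z \<and> (z \<in> P \<longleftrightarrow> dec) \<and>
     legal dec k (if dec then P - {z} else insert z P) as)"
| "legal dec k P (Ask S # as) \<longleftrightarrow> max_matching_size (edge k ` P) \<in> S \<and> legal dec k P as"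

fun request_of :: "act \<Rightarrow> request" where
  "request_of (Upd x y) = Update x y"
| "request_of (Ask S) = Query"

definition change :: "bool \<Rightarrow> nat set \<Rightarrow> edges \<Rightarrow> edges" where
  "change dec = (if dec then delete_edge else insert_edge)"

lemma legal_append_updates:
  assumes "distinct zs" "set zs \<subseteq> board k" "\<And>z. z \<in> set zs \<Longrightarrow> z \<in> P \<longleftrightarrow> dec"
    "legal dec k (if dec then P - set zs else P \<union> set zs) as"
  shows "legal dec k P (map (upd_pair k) zs @ as)"
  using assms
proof (induction zs arbitrary: P)
  case (Cons z zs)
  let ?P = "if dec then P - {z} else insert z P"
  have "(if dec then ?P - set zs else ?P \<union> set zs) = (if dec then P - set (z # zs) else P \<union> set (z # zs))"
    by auto
  then have "legal dec k ?P (map (upd_pair k) zs @ as)"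
    using Cons.prems by (intro Cons.IH) auto
  moreover have "z \<in> board k" "z \<in> P \<longleftrightarrow> dec" using Cons.prems by simp_all
  ultimately have "legal dec k P (Upd (fst z) (4 * k + snd z) # map (upd_pair k) zs @ as)"
    unfolding legal.simps using upd_pair_def by metis
  then show ?case by (simp add: upd_pair_def[of k z])
qed (simp split: if_splits)

lemma edge_image:
  assumes "P \<subseteq> board k" "z \<in> board k"
  shows "edge k z \<in> edge k ` P \<longleftrightarrow> z \<in> P" "edge k ` P - {edge k z} = edge k ` (P - {z})"
  using assms inj_on_image_mem_iff[OF inj_on_edge assms(2,1)] inj_on_image_set_diff[OF inj_on_edge[of k], of P "{z}"]
  by auto

lemma bipartite_graph:
  assumes "P \<subseteq> board k"
  shows "bipartite {..<8 * k} (edge k ` P)"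
  unfolding bipartite_def
proof (rule exI[of _ "{..<4 * k}"], rule exI[of _ "{4 * k..<8 * k}"], intro conjI ballI)
  fix e assume "e \<in> edge k ` P"
  then obtain X Y where "e = {X, 4 * k + Y}" "X < 4 * k" "Y < 4 * k"
    using assms by (auto simp: edge_def board_def)
  then show "\<exists>a\<in>{..<4 * k}. \<exists>b\<in>{4 * k..<8 * k}. e = {a, b}"
    by (intro bexI[of _ X] bexI[of _ "4 * k + Y"]) auto
qed auto

lemma legal_valid:
  assumes "legal dec k P as" "P \<subseteq> board k"
  shows "if dec then valid_deletions (edge k ` P) (map request_of as)
    else valid_insertions (8 * k) (edge k ` P) (map request_of as)"
  using assms
proof (induction dec k P as rule: legal.induct)
  case (2 dec k P x y as)
  then obtain z where z: "z \<in> board k" "Upd x y = upd_pair k z" "z \<in> P \<longleftrightarrow> dec"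
    "legal dec k (if dec then P - {z} else insert z P) as" by auto
  have xy: "{x, y} = edge k z" using z(2) by (simp add: edge_def upd_pair_def)
  show ?case
  proof (cases dec)
    case True
    have "P - {z} \<subseteq> board k" using 2(3) by blast
    then show ?thesis
      using 2(1)[OF z(1,4)] z(3) edge_image[OF 2(3) z(1)] True by (simp add: xy delete_edge_def)
  next
    case False
    have "insert z P \<subseteq> board k" using 2(3) z(1) by blast
    then show ?thesis
      using 2(1)[OF z(1,4)] z(3) edge_image(1)[OF 2(3) z(1)] bipartite_graph[of "insert z P" k] False
      by (simp add: xy insert_edge_def)
  qed
qed simp_all

lemma legal_performs:
  assumes "legal dec k P as" "P \<subseteq> board k"
    "serves m upd qry (change dec) (map request_of as) (edge k ` P) q t"
  shows "performs m upd qry as q t"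
  using assms
proof (induction dec k P as arbitrary: q t rule: legal.induct)
  case (1 dec k P)
  then show ?case by (auto elim: serves.cases intro: performs.Nil)
next
  case (2 dec k P x y as)
  then obtain z where z: "z \<in> board k" "Upd x y = upd_pair k z" "z \<in> P \<longleftrightarrow> dec"
    "legal dec k (if dec then P - {z} else insert z P) as" by auto
  have xy: "change dec {x, y} (edge k ` P) = edge k ` (if dec then P - {z} else insert z P)"
    using z(2) edge_image[OF 2(3) z(1)]
    by (simp add: edge_def upd_pair_def change_def delete_edge_def insert_edge_def)
  obtain t1 t2 q' where "t = t1 + t2" "run m upd (put_edge x y q) t1 q'"
    "serves m upd qry (change dec) (map request_of as) (change dec {x, y} (edge k ` P)) q' t2"
    using 2(4) by (auto elim: serves.cases)
  moreover have "(if dec then P - {z} else insert z P) \<subseteq> board k" using 2(3) z(1) by auto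
  ultimately show ?case
    using 2(1)[OF z(1,4), of q' t2] unfolding xy by (simp add: performs.Upd)
next
  case (3 dec k P S as)
  obtain t1 t2 q' where "t = t1 + t2" "run m qry q t1 q'" "q' 2 0 = max_matching_size (edge k ` P)"
    "serves m upd qry (change dec) (map request_of as) (edge k ` P) q' t2"
    using 3(4) by (auto elim: serves.cases)
  then show ?case using 3(1)[of q' t2] 3(2,3) by (simp add: performs.Ask)
qed

lemma set_row_list: "set (row_list b k p u v) = rows k p (\<lambda>i. u i = b) (\<lambda>j. v j = b)"
  by (auto simp: row_list_def rows_def)

lemma set_leaf_list: "set (leaf_list k p) = leaves k p"
  by (auto simp: leaf_list_def leaves_def)

lemma distinct_row_list: "p < k \<Longrightarrow> distinct (row_list b k p u v)"
  by (auto simp: row_list_def distinct_map inj_on_def)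

lemma distinct_leaf_list: "p < k \<Longrightarrow> distinct (leaf_list k p)"
  by (auto simp: leaf_list_def)

text \<open>Earlier and later slots exchange their roles between the two versions. In each of them
  the slots other than \<open>p\<close> either carry leaves, forming \<open>L\<close>, or are empty,
  so \<open>max_matching_pairs\<close> serves both.\<close>

lemma legal_phase:
  assumes p: "p < k" and S: "\<And>l. l < k \<Longrightarrow> S l = (if l < p then if dec then {} else rows k l (U l) (V l) \<union> leaves k l
      else if dec then slot k l else {})"
    and next': "legal dec k (pairs k M (S(p := if dec then {} else rows k p u v \<union> leaves k p))) as"
  shows "legal dec k (pairs k M S) (phase dec k M p u v @ as)"
proof -
  define L where "L = (if dec then {p<..<k} else {..<p})"
  let ?Q = "pairs k M (S(p := rows k p u v))"
  have SS: "S l \<subseteq> slot k l" if "l < k" for l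
    using S[OF that] rows_slot[of k l] leaves_slot[of k l] by auto
  have SS': "(S(p := rows k p u v)) l \<subseteq> slot k l" if "l < k" for l
    using SS[OF that] rows_slot by auto
  note sb = subset_trans[OF rows_slot slot_board[OF p]] subset_trans[OF leaves_slot slot_board[OF p]]
  have mem: "z \<in> pairs k M S \<longleftrightarrow> dec" if "z \<in> slot k p" for z
    using pairs_slot[OF p SS, where M = M] S[OF p] that by (auto split: if_splits)
  have "2 * (k + card L) < max_matching_size (edge k ` ?Q) \<longleftrightarrow> hits k M u v"
  proof (rule max_matching_pairs[OF p])
    show "L \<subseteq> {..<k} - {p}" using p by (auto simp: L_def)
    show "leaves k l \<subseteq> (S(p := rows k p u v)) l \<and> (S(p := rows k p u v)) l \<subseteq> slot k l" if "l \<in> L" for l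
    proof -
      have "l < k" "l \<noteq> p" using that p by (auto simp: L_def split: if_splits)
      then show ?thesis using that S[of l] SS[of l] leaves_slot[of k l] by (auto simp: L_def split: if_splits)
    qed
    show "(S(p := rows k p u v)) l = {}" if "l < k" "l \<notin> L" "l \<noteq> p" for l
      using that S[of l] by (auto simp: L_def split: if_splits)
  qed simp
  moreover have "2 * (k + card L) = threshold dec k p"
    by (auto simp: L_def threshold_def)
  ultimately have ask: "max_matching_size (edge k ` ?Q) \<in> answers k (threshold dec k p) (hits k M u v)"
    using max_matching_graph_le[OF pairs_board[OF SS', where M = M]] by (simp add: answers_def del: fun_upd_apply)
  have post: "legal dec k ?Q (map (upd_pair k) (post_list dec k p u v) @ as)"
  proof (rule legal_append_updates)
    show "distinct (post_list dec k p u v)"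
      using distinct_row_list[OF p] distinct_leaf_list[OF p] by (simp add: post_list_def)
    show "set (post_list dec k p u v) \<subseteq> board k"
      using sb by (simp add: post_list_def set_row_list set_leaf_list)
    show "z \<in> ?Q \<longleftrightarrow> dec" if "z \<in> set (post_list dec k p u v)" for z
    proof -
      have "z \<in> slot k p"
        using that rows_slot[of k p] leaves_slot[of k p]
        by (auto simp: post_list_def set_row_list set_leaf_list split: if_splits)
      moreover have "?Q \<inter> slot k p = (S(p := rows k p u v)) p"
        by (rule pairs_slot[OF p SS'])
      ultimately have "z \<in> ?Q \<longleftrightarrow> z \<in> rows k p u v" unfolding fun_upd_same by blast
      then show ?thesis
        using that rows_leaves_disjoint[OF p, of u v]
        by (auto simp: post_list_def set_row_list set_leaf_list split: if_splits)
    qed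
    show "legal dec k (if dec then ?Q - set (post_list dec k p u v) else ?Q \<union> set (post_list dec k p u v)) as"
    proof -
      let ?S = "S(p := rows k p u v)"
      have "?Q - rows k p u v = pairs k M (?S(p := ?S p - rows k p u v))"
        by (rule pairs_diff[OF p SS' rows_slot])
      then show ?thesis
        using next' pairs_add[OF p, of M ?S "leaves k p"]
        by (auto simp: post_list_def set_row_list set_leaf_list fun_upd_same simp del: fun_upd_apply)
    qed
  qed
  have pre: "legal dec k (pairs k M S) (map (upd_pair k) (pre_list dec k p u v) @ bs)"
    if "legal dec k ?Q bs" for bs
  proof (rule legal_append_updates)
    have leafrow: "set (row_list (\<not> dec) k p u v) \<inter> set (leaf_list k p) = {}"
      using rows_leaves_disjoint[OF p] by (simp add: set_row_list set_leaf_list)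
    then show "distinct (pre_list dec k p u v)"
      using distinct_row_list[OF p] distinct_leaf_list[OF p] by (cases dec) (simp_all add: pre_list_def)
    show "set (pre_list dec k p u v) \<subseteq> board k"
      using sb by (cases dec) (simp_all add: pre_list_def set_row_list set_leaf_list)
    have sub: "set (pre_list dec k p u v) \<subseteq> slot k p"
      using rows_slot[of k p] leaves_slot[of k p] by (auto simp: pre_list_def set_row_list set_leaf_list)
    then show "z \<in> pairs k M S \<longleftrightarrow> dec" if "z \<in> set (pre_list dec k p u v)" for z
      using that mem by blast
    have "(if dec then S p - set (pre_list dec k p u v) else S p \<union> set (pre_list dec k p u v)) = rows k p u v"
      using S[OF p] rows_leaves_disjoint[OF p, of u v]
      by (auto simp: pre_list_def set_row_list set_leaf_list slot_def rows_def)
    then show "legal dec k (if dec then pairs k M S - set (pre_list dec k p u v)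
        else pairs k M S \<union> set (pre_list dec k p u v)) bs"
      using that pairs_add[OF p, of M S] pairs_diff[OF p SS sub, of M] by (auto split: if_splits)
  qed
  show ?thesis unfolding phase_def using ask post by (simp add: pre)
qed

lemma legal_phases:
  assumes "p \<le> k"
    "\<And>l. l < k \<Longrightarrow> S l = (if l < p then if dec then {} else rows k l (U l) (V l) \<union> leaves k l
      else if dec then slot k l else {})"
  shows "legal dec k (pairs k M S) (concat (map (\<lambda>p. phase dec k M p (U p) (V p)) [p..<k]))"
  using assms
proof (induction "k - p" arbitrary: p S)
  case 0
  then show ?case by simp
next
  case (Suc d)
  then have p: "p < k" by simp
  have "legal dec k (pairs k M (S(p := if dec then {} else rows k p (U p) (V p) \<union> leaves k p)))
    (concat (map (\<lambda>p. phase dec k M p (U p) (V p)) [Suc p..<k]))"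
    using Suc p by (intro Suc.hyps(1)) auto
  then show ?case
    unfolding upt_conv_Cons[OF p] list.map concat.simps
    by (intro legal_phase[OF p Suc.prems(2)]) auto
qed

definition instance_acts :: "bool \<Rightarrow> nat \<Rightarrow> (nat \<Rightarrow> nat \<Rightarrow> bool) \<Rightarrow> (nat \<Rightarrow> nat \<Rightarrow> bool) \<Rightarrow>
    (nat \<Rightarrow> nat \<Rightarrow> bool) \<Rightarrow> act list" where
  "instance_acts dec k M U V = map (upd_pair k) (base_list dec k M) @
     concat (map (\<lambda>p. phase dec k M p (U p) (V p)) [0..<k])"

lemma base_board: "base dec k M \<subseteq> board k"
  unfolding base_def by (rule pairs_board) auto

lemma set_base_list: "set (base_list dec k M) = {z \<in> board k. (z \<in> base dec k M) \<noteq> dec}"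
proof -
  have "(X, Y) \<in> set (base_list dec k M)"
    if "X < 4 * k" "Y < 4 * k" "((X, Y) \<in> base dec k M) \<noteq> dec" for X Y
    using that interleave_less[OF that(1,2)]
    by (auto simp: base_list_def image_iff intro!: bexI[of _ "X * (4 * k) + Y"])
  moreover have "e div (4 * k) < 4 * k \<and> e mod (4 * k) < 4 * k" if "e < (4 * k) * (4 * k)" for e
    using that by (metis less_mult_imp_div_less mod_less_divisor mult_eq_0_iff not_gr_zero not_less_zero)
  ultimately show ?thesis
    by (auto simp: board_def base_list_def)
qed

lemma distinct_base_list: "distinct (base_list dec k M)"
proof -
  have "inj (\<lambda>e. (e div (4 * k), e mod (4 * k)))"
    by (rule injI) (metis Pair_inject div_mult_mod_eq)
  then show ?thesis unfolding base_list_def distinct_map by (auto intro: inj_on_subset)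
qed

lemma legal_instance:
  "legal dec k (if dec then board k else {}) (instance_acts dec k M U V)"
  unfolding instance_acts_def
proof (rule legal_append_updates[OF distinct_base_list])
  have "(if dec then (if dec then board k else {}) - set (base_list dec k M)
       else (if dec then board k else {}) \<union> set (base_list dec k M)) = base dec k M"
    using base_board[of dec k M] by (auto simp: set_base_list)
  then show "legal dec k (if dec then (if dec then board k else {}) - set (base_list dec k M)
       else (if dec then board k else {}) \<union> set (base_list dec k M))
     (concat (map (\<lambda>p. phase dec k M p (U p) (V p)) [0..<k]))"
    using legal_phases[of 0 k "\<lambda>p. if dec then slot k p else {}" dec U V M] by (simp add: base_def)
qed (auto simp: set_base_list)

lemma length_phase: "length (phase dec k M p u v) \<le> 4 * k + 3"
proof -
  have "length (row_list b k p u v) \<le> 2 * k" for b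
    using length_filter_le[of "\<lambda>i. u i = b" "[0..<k]"] length_filter_le[of "\<lambda>i. v i = b" "[0..<k]"]
    by (simp add: row_list_def)
  from this[of True] this[of False] show ?thesis
    by (auto simp: phase_def pre_list_def post_list_def leaf_list_def)
qed

text \<open>The board contributes \<open>16 * k ^ 2\<close>, and the \<open>k\<close> phases of
  length at most \<open>4 * k + 3\<close> contribute at most \<open>7 * k ^ 2\<close>.\<close>

lemma length_instance_acts: "length (instance_acts dec k M U V) \<le> 23 * k\<^sup>2"
proof -
  have "length (base_list dec k M) \<le> (4 * k) * (4 * k)"
    unfolding base_list_def using length_filter_le[of _ "[0..<(4 * k) * (4 * k)]"] by simp
  moreover have "length (concat (map (\<lambda>p. phase dec k M p (U p) (V p)) [0..<k])) \<le> k * (4 * k + 3)"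
    using sum_mono[of "{0..<k}" "\<lambda>p. length (phase dec k M p (U p) (V p))" "\<lambda>_. 4 * k + 3"]
    by (simp add: length_concat interv_sum_list_conv_sum_set_nat comp_def length_phase)
  ultimately have "length (instance_acts dec k M U V) \<le> 16 * (k * k) + (4 * (k * k) + 3 * k)"
    by (simp add: instance_acts_def algebra_simps)
  also have "\<dots> \<le> 16 * (k * k) + (4 * (k * k) + 3 * (k * k))" by simp
  finally show ?thesis by (simp add: power2_eq_square)
qed

lemma num_queries_instance: "num_queries (map request_of (instance_acts dec k M U V)) = k"
proof -
  have 1: "num_queries (map request_of (map (upd_pair k) zs)) = 0" for zs
    by (induction zs) (auto simp: num_queries_def upd_pair_def)
  have 2: "num_queries (map request_of (as @ bs)) =
      num_queries (map request_of as) + num_queries (map request_of bs)" for as bs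
    by (simp add: num_queries_def)
  have 3: "num_queries (map request_of (phase dec k M p u v)) = 1" for p u v
    using 1[unfolded num_queries_def] by (simp add: phase_def num_queries_def)
  have "num_queries (map request_of (concat (map (\<lambda>p. phase dec k M p (U p) (V p)) ps))) = length ps" for ps
  proof (induction ps)
    case Nil then show ?case by (simp add: num_queries_def)
  next
    case (Cons p ps) then show ?case using 3 by (simp add: 2 del: map_append)
  qed
  then show ?thesis using 1 by (simp add: instance_acts_def 2 del: map_append map_map)
qed

lemma num_updates_instance:
  "num_updates (map request_of (instance_acts dec k M U V)) \<le> 23 * k\<^sup>2"
  unfolding num_updates_def
  by (rule order_trans[OF length_filter_le]) (simp add: length_instance_acts)

section \<open>The programs\<close>

text \<open>
  Register \<open>a\<close> is cell 0 of bank \<open>a\<close>: 4 holds \<open>k\<close>; 5 and 6 hold \<open>R\<close> and the selected instance; 7 and 8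
  the end points of an update; 9, 10, 13 and 14 are loop counters; 11 counts the vectors; 12 is the
  answer to a query; 15 is the current slot; 16 and 17 are the first row and the first column of the
  block of the selected instance.
\<close>

fun power_expr :: "nat \<Rightarrow> expr" where
  "power_expr 0 = Const 1"
| "power_expr (Suc m) = Bin Mul (power_expr m) (var 4)"

text \<open>The two comparisons pad the matrix with zeros. Evaluation does not short-circuit: the
  cell is read in any case, and a stray value is multiplied by 0.\<close>

definition entry :: "expr \<Rightarrow> expr \<Rightarrow> expr" where
  "entry a b = Bin Mul (Bin Mul (Bin Less a (var 0)) (Bin Less b (var 0)))
     (Get 1 (Bin Add (Bin Mul a (var 0)) b))"

abbreviation scaled :: "nat \<Rightarrow> expr \<Rightarrow> expr" where
  "scaled a e \<equiv> Bin Add (Bin Mul (Const a) (var 4)) e"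

definition update_at :: "com \<Rightarrow> expr \<Rightarrow> expr \<Rightarrow> com" where
  "update_at upd x y = Seq (assign 7 x) (Seq (assign 8 (scaled 4 y)) (call_update upd))"

definition update_loop :: "com \<Rightarrow> expr \<Rightarrow> expr \<Rightarrow> expr \<Rightarrow> expr \<Rightarrow> com" where
  "update_loop upd b c x y = count_loop 9 b (Cond c (update_at upd x y) Skip)"

definition select :: "expr \<Rightarrow> com" where
  "select e = Seq (assign 6 e)
     (Seq (assign 16 (Bin Mul (Bin Div (Bin Mod (var 6) (power_expr 4)) (power_expr 2)) (var 4)))
       (assign 17 (Bin Mul (Bin Mod (Bin Mod (var 6) (power_expr 4)) (power_expr 2)) (var 4))))"

text \<open>Sums stand for disjunctions and products for conjunctions, following the right-hand side
  of \<open>base_iff\<close>. All terms are always evaluated; outside the block the entry is read at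
  some other position and the factor in front cancels it.\<close>

definition base_expr :: "bool \<Rightarrow> expr" where
  "base_expr dec = (let X = Bin Div (var 9) (Bin Mul (Const 4) (var 4));
       Y = Bin Mod (var 9) (Bin Mul (Const 4) (var 4)); d = Const (of_bool dec) in
     Bin Add (Bin Add
       (Bin Mul (Bin Equal X (Bin Add Y (var 4))) (Bin Add (Bin Less Y (Bin Mul (Const 2) (var 4))) d))
       (Bin Mul (Bin Mul (Bin Equal (Bin Div X (var 4)) (Const 1)) (Bin Equal (Bin Div Y (var 4)) (Const 1)))
         (entry (Bin Add (var 16) (Bin Sub X (var 4))) (Bin Add (var 17) (Bin Sub Y (var 4))))))
       (Bin Mul d (Bin Add (Bin Equal Y (scaled 3 X))
         (Bin Add (Bin Equal (Bin Add (Bin Div X (var 4)) (Bin Div Y (var 4))) (Const 0))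
           (Bin Mul (Bin Equal (Bin Div X (var 4)) (Const 2)) (Bin Equal (Bin Div Y (var 4)) (Const 2)))))))"

definition init_code :: "bool \<Rightarrow> com \<Rightarrow> com" where
  "init_code dec upd = update_loop upd (Bin Mul (Const 16) (power_expr 2))
     (if dec then Bin Equal (base_expr dec) (Const 0) else base_expr dec)
     (Bin Div (var 9) (Bin Mul (Const 4) (var 4))) (Bin Mod (var 9) (Bin Mul (Const 4) (var 4)))"

text \<open>Bank 0 of every instance has to hold the parameters of its graph: its cell 0 lies at
  \<open>r\<close> in bank 21 and its cell 1 at \<open>R + r\<close>.\<close>

definition preprocess :: "bool \<Rightarrow> com \<Rightarrow> com" where
  "preprocess dec upd =
     Seq (Seq (assign 4 (Const 1))
       (While (Bin Less (power_expr 3) (var 0)) (assign 4 (Bin Add (var 4) (Const 1)))))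
     (Seq (assign 5 (Bin Mul (Const 64) (power_expr 6)))
     (Seq (count_loop 10 (power_expr 6) (Seq (Put 21 (var 10) (Bin Mul (Const 8) (var 4)))
       (Put 21 (Bin Add (var 5) (var 10)) (Bin Mul (Const (if dec then 4 else 0)) (var 4)))))
     (count_loop 10 (power_expr 6) (Seq (select (var 10)) (init_code dec upd)))))"

text \<open>Bank 3 marks the rows already known to be 1, which is the complement of
  \<open>u\<close>; hence the negated constant in the first loop and the plain one in the
  second.\<close>

definition row_code :: "bool \<Rightarrow> com \<Rightarrow> com" where
  "row_code b upd = Seq
     (update_loop upd (var 4) (Bin Equal (Get 3 (Bin Add (var 16) (var 9))) (Const (of_bool (\<not> b))))
       (var 15) (var 9))
     (update_loop upd (var 4) (Bin Equal (Get 2 (Bin Add (var 17) (var 9))) (Const (of_bool b)))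
       (scaled 2 (var 9)) (scaled 2 (var 15)))"

definition leaf_code :: "com \<Rightarrow> com" where
  "leaf_code upd = Seq (update_at upd (var 15) (scaled 3 (var 15)))
     (update_at upd (scaled 3 (var 15)) (scaled 2 (var 15)))"

definition pre_code :: "bool \<Rightarrow> com \<Rightarrow> com" where
  "pre_code dec upd = Seq (row_code (\<not> dec) upd) (if dec then leaf_code upd else Skip)"

definition post_code :: "bool \<Rightarrow> com \<Rightarrow> com" where
  "post_code dec upd = (if dec then row_code True upd else leaf_code upd)"

definition threshold_expr :: "bool \<Rightarrow> expr" where
  "threshold_expr dec = Bin Mul (Const 2) (Bin Add (var 4)
     (if dec then Bin Sub (var 4) (Bin Add (var 15) (Const 1)) else var 15))"

definition search :: "bool \<Rightarrow> com" where
  "search dec = Cond (Bin Less (threshold_expr dec) (var 12))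
     (count_loop 13 (var 4) (count_loop 14 (var 4)
       (Cond (Bin Mul (entry (Bin Add (var 16) (var 13)) (Bin Add (var 17) (var 14)))
           (Get 2 (Bin Add (var 17) (var 14))))
         (Put 3 (Bin Add (var 16) (var 13)) (Const 1)) Skip))) Skip"

text \<open>The search comes last because it changes bank 3, from which the decremental
  \<open>post_code\<close> once more reads the same \<open>u\<close>.\<close>

definition block_code :: "bool \<Rightarrow> com \<Rightarrow> com \<Rightarrow> com" where
  "block_code dec upd qry =
     Seq (select (Bin Add (Bin Mul (Bin Div (var 11) (var 4)) (power_expr 4)) (var 10)))
     (Seq (pre_code dec upd) (Seq (call_query qry) (Seq (post_code dec upd) (search dec))))"

definition multiply :: "bool \<Rightarrow> com \<Rightarrow> com \<Rightarrow> com" where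
  "multiply dec upd qry =
     Seq (count_loop 10 (power_expr 3) (Put 3 (var 10) (Const 0)))
     (Seq (assign 15 (Bin Mod (var 11) (var 4)))
     (Seq (count_loop 10 (power_expr 4) (block_code dec upd qry))
       (assign 11 (Bin Add (var 11) (Const 1)))))"

section \<open>Correctness of the building blocks\<close>

lemma steps_SeqI:
  assumes "steps W c s \<phi> T P" "\<And>\<phi>' s'. P \<phi>' s' \<Longrightarrow> steps W d s' \<phi>' T' Q"
  shows "steps W (Seq c d) s \<phi> (T + T') Q"
  by (intro steps_Seq, rule steps_mono[OF assms(1)]) (use assms(2) in auto)

lemma steps_assign:
  assumes "fits W e s" "0 < W" "Q \<phi> (s(a := (s a)(0 := val e s)))"
  shows "steps W (assign a e) s \<phi> (cost e + 2) Q"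
  by (rule steps_mono[OF steps_Put[where Q = Q]]) (use assms in auto)

lemma steps_assign_Seq:
  assumes "fits W e s" "0 < W" "steps W c (s(a := (s a)(0 := val e s))) \<phi> T Q"
  shows "steps W (Seq (assign a e) c) s \<phi> (cost e + 2 + T) Q"
  by (rule steps_Seq, rule steps_assign) (use assms in auto)

lemma fits_val: "fits W e s \<Longrightarrow> val e s < W"
  by (cases e) auto

text \<open>Only low banks are tracked here; everything from bank 20 on belongs to the instances and
  is described by \<open>ready\<close>.\<close>

definition keeps :: "nat set \<Rightarrow> mem \<Rightarrow> mem \<Rightarrow> bool" where
  "keeps A s s' \<longleftrightarrow> (\<forall>a<20. a \<notin> A \<longrightarrow> s' a = s a)"

lemma keeps_trans: "keeps A s s' \<Longrightarrow> keeps A s' s'' \<Longrightarrow> keeps A s s''"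
  by (simp add: keeps_def)

lemma keeps_mono: "keeps A s s' \<Longrightarrow> A \<subseteq> B \<Longrightarrow> keeps B s s'"
  by (auto simp: keeps_def)

lemma keepsD: "keeps A s s' \<Longrightarrow> a < 20 \<Longrightarrow> a \<notin> A \<Longrightarrow> s' a = s a"
  by (simp add: keeps_def)

lemma cost_power_expr: "cost (power_expr m) = 3 * m + 1"
  by (induction m) auto

lemma val_power_expr: "val (power_expr m) s = s 4 0 ^ m"
  by (induction m) auto

lemma fits_power_expr:
  assumes "1 \<le> s 4 0" "s 4 0 ^ m < W"
  shows "fits W (power_expr m) s"
  using assms(2)
proof (induction m)
  case (Suc m)
  have "s 4 0 ^ m \<le> s 4 0 ^ Suc m" "s 4 0 ^ 1 \<le> s 4 0 ^ Suc m"
    using assms(1) by (intro power_increasing; simp)+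
  then have "s 4 0 ^ m < W" "s 4 0 < W"
    using Suc.prems by (auto simp del: power_Suc intro: le_less_trans)
  then show ?case using Suc assms(1) by (auto simp: val_power_expr mult.commute)
qed simp

locale instances =
  fixes m W :: nat and upd qry :: com and R I :: nat
  assumes capacity: "m * R * R < W" "2 * R * R < W" and I: "I \<le> R" "0 < R"
begin

abbreviation rdy :: "(nat \<Rightarrow> act list) \<Rightarrow> nat \<Rightarrow> mem \<Rightarrow> bool" where
  "rdy \<equiv> ready m upd qry R I"

lemma R_less: "R < W" "1 < W"
  using less_capacity[OF capacity(2) I(2)] .

lemma rdy_keeps:
  assumes "rdy todo \<phi> s" "\<And>a. 20 \<le> a \<Longrightarrow> s' a = s a"
  shows "rdy todo \<phi> s'"
  using ready_cong[OF assms order.refl] .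

text \<open>Register 7 is written before \<open>y\<close> is evaluated, which explains the changed
  memory in the hypotheses on \<open>y\<close>.\<close>

lemma steps_update_at:
  assumes "rdy todo \<phi> s" "todo r = Upd X (4 * s 4 0 + Y) # as" "r < I" "s 5 0 = R" "s 6 0 = r"
    and x: "fits W x s" "val x s = X"
    and y: "fits W (scaled 4 y) (s(7 := (s 7)(0 := X)))" "val y (s(7 := (s 7)(0 := X))) = Y"
  shows "steps W (update_at upd x y) s \<phi> (cost x + cost y + 69)
    (\<lambda>\<phi>' s'. rdy (todo(r := as)) \<phi>' s' \<and> keeps {7, 8} s s')"
proof -
  let ?s1 = "s(7 := (s 7)(0 := X))"
  let ?s2 = "?s1(8 := (?s1 8)(0 := 4 * s 4 0 + Y))"
  have "steps W (call_update upd) ?s2 \<phi> 60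
      (\<lambda>\<phi>' s'. rdy (todo(r := as)) \<phi>' s' \<and> keeps {7, 8} s s')"
  proof (rule steps_mono[OF steps_call_update[where m = m and qry = qry and R = R and I = I
        and todo = todo and r = r and as = as, OF _ assms(2,3) I(1) capacity]])
    show "rdy todo \<phi> ?s2" by (rule rdy_keeps[OF assms(1)]) simp
    show "X < W" using fits_val[OF x(1)] x(2) by simp
    show "4 * s 4 0 + Y < W" using fits_val[OF y(1)] y(2) by simp
  qed (use assms(4,5) in \<open>auto simp: keeps_def\<close>)
  then have "steps W (update_at upd x y) s \<phi> (cost x + 2 + (cost (scaled 4 y) + 2 + 60))
      (\<lambda>\<phi>' s'. rdy (todo(r := as)) \<phi>' s' \<and> keeps {7, 8} s s')"
    unfolding update_at_def using x y R_less by (intro steps_assign_Seq) (auto simp del: cost.simps)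
  then show ?thesis by (rule steps_mono) auto
qed

lemma steps_update_loop:
  assumes ready: "rdy todo \<phi> s"
    and todo: "todo r = map (\<lambda>i. Upd (X i) (4 * s 4 0 + Y i)) (filter P [0..<N]) @ as"
    and r: "r < I" "s 5 0 = R" "s 6 0 = r" and N: "N < W"
    and bound: "\<And>s'. keeps {7, 8, 9} s s' \<Longrightarrow> fits W b s' \<and> val b s' = N"
    and exprs: "\<And>s' i. keeps {7, 8, 9} s s' \<Longrightarrow> i < N \<Longrightarrow> s' 9 0 = i \<Longrightarrow>
      fits W c s' \<and> (val c s' \<noteq> 0 \<longleftrightarrow> P i) \<and> fits W x s' \<and> val x s' = X i \<and>
      fits W (scaled 4 y) s' \<and> val y s' = Y i"
  shows "steps W (update_loop upd b c x y) s \<phi>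
      (N * (cost b + cost c + cost x + cost y + 80) + cost b + 7)
    (\<lambda>\<phi>' s'. rdy (todo(r := as)) \<phi>' s' \<and> keeps {7, 8, 9} s s')"
proof -
  let ?todo = "\<lambda>j. todo(r := map (\<lambda>i. Upd (X i) (4 * s 4 0 + Y i)) (filter P [j..<N]) @ as)"
  let ?I = "\<lambda>j \<phi>' s'. rdy (?todo j) \<phi>' s' \<and> keeps {7, 8, 9} s s' \<and> s' 9 0 = j"
  have "steps W (update_loop upd b c x y) s \<phi>
      (N * ((cost c + 1 + (cost x + cost y + 69)) + cost b + 10) + cost b + 7) (?I N)"
    unfolding update_loop_def
  proof (rule steps_count_loop[where I = ?I])
    have "?todo 0 = todo" using todo by auto
    then show "?I 0 \<phi> (s(9 := (s 9)(0 := 0)))"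
      using rdy_keeps[OF ready] by (auto simp: keeps_def)
    show "s' 9 0 = j \<and> fits W b s' \<and> val b s' = N" if "?I j \<phi>' s'" for j \<phi>' s'
      using that bound by blast
    fix j \<phi>' s' assume j: "j < N" and inv: "?I j \<phi>' s'"
    have e: "fits W c s'" "val c s' \<noteq> 0 \<longleftrightarrow> P j" "fits W x s'" "val x s' = X j"
      using exprs[of s' j] inv j by auto
    let ?s1 = "s'(7 := (s' 7)(0 := X j))"
    have "fits W (scaled 4 y) ?s1 \<and> val y ?s1 = Y j"
      using exprs[of ?s1 j] inv j by (auto simp: keeps_def)
    moreover have "s' 4 = s 4" "s' 5 = s 5" "s' 6 = s 6" using inv by (auto simp: keeps_def)
    moreover have "?todo j r = Upd (X j) (4 * s 4 0 + Y j) # ?todo (Suc j) r" if "P j"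
      using that by (simp add: upt_conv_Cons[OF j])
    ultimately have upd: "steps W (update_at upd x y) s' \<phi>' (cost x + cost y + 69)
        (\<lambda>\<phi>' s''. rdy ((?todo j)(r := ?todo (Suc j) r)) \<phi>' s'' \<and> keeps {7, 8} s' s'')" if "P j"
      using inv r e that by (intro steps_update_at[where X = "X j" and Y = "Y j"]) auto
    let ?Q = "\<lambda>\<phi>' s'. s' 9 0 = j \<and> ?I (Suc j) \<phi>' (s'(9 := (s' 9)(0 := Suc j)))"
    show "steps W (Cond c (update_at upd x y) Skip) s' \<phi>' (cost c + 1 + (cost x + cost y + 69)) ?Q"
    proof (rule steps_Cond[OF e(1)])
      assume "val c s' \<noteq> 0"
      then have "P j" using e(2) by simp
      show "steps W (update_at upd x y) s' \<phi>' (cost x + cost y + 69) ?Q"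
      proof (rule steps_mono[OF upd[OF \<open>P j\<close>] order.refl])
        fix \<phi>'' s'' assume a: "rdy ((?todo j)(r := ?todo (Suc j) r)) \<phi>'' s'' \<and> keeps {7, 8} s' s''"
        then have "rdy (?todo (Suc j)) \<phi>'' s''" by simp
        moreover have "keeps {7, 8, 9} s s''" "s'' 9 0 = j"
          using inv a keeps_trans[of "{7, 8, 9}" s s' s''] keeps_mono[of "{7, 8}" s' s'' "{7, 8, 9}"]
          by (auto simp: keepsD)
        ultimately show "?Q \<phi>'' s''"
          using rdy_keeps[of "?todo (Suc j)" \<phi>'' s'' "s''(9 := (s'' 9)(0 := Suc j))"]
          by (auto simp: keeps_def)
      qed
    next
      assume "val c s' = 0"
      then have "?todo j = ?todo (Suc j)" using e(2) by (simp add: upt_conv_Cons[OF j])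
      then have "?Q \<phi>' s'"
        using inv rdy_keeps[of "?todo (Suc j)" \<phi>' s' "s'(9 := (s' 9)(0 := Suc j))"]
        by (auto simp: keeps_def)
      then show "steps W Skip s' \<phi>' (cost x + cost y + 69) ?Q"
        by (intro steps_mono[OF steps_Skip[where Q = ?Q]]) auto
    qed
  qed (use N R_less in auto)
  then show ?thesis by (rule steps_mono) (auto simp: algebra_simps)
qed

end

section \<open>Membership in the base graph, and the programs for one block\<close>

lemma div_eq_iff_bounds: "0 < k \<Longrightarrow> x div k = q \<longleftrightarrow> q * k \<le> x \<and> x < Suc q * k" for x k q :: nat
  by (metis div_nat_eqI dividend_less_div_times mult.commute mult_Suc times_div_less_eq_dividend)

text \<open>The condition \<open>X = Y + k\<close> unites the edges \<open>a c\<close> and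
  \<open>d b\<close>, where \<open>Y < 2 * k\<close>, with the leaf edges \<open>q t\<close>, its
  only other solutions on the board. The second line gives the matrix edges,
  \<open>Y = 3 * k + X\<close> the leaf edges \<open>s l\<close>, and the last two conditions all
  edges \<open>s c\<close> and \<open>d t\<close>.\<close>

lemma base_iff:
  assumes "0 < k" "X < 4 * k" "Y < 4 * k"
  shows "(X, Y) \<in> base dec k M \<longleftrightarrow> X = Y + k \<and> (Y < 2 * k \<or> dec) \<or>
    X div k = 1 \<and> Y div k = 1 \<and> M (X - k) (Y - k) \<or>
    dec \<and> (Y = 3 * k + X \<or> X div k + Y div k = 0 \<or> X div k = 2 \<and> Y div k = 2)"
proof -
  have c: "(X, Y) \<in> core k M \<longleftrightarrow> X = Y + k \<and> Y < 2 * k \<or>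
      (k \<le> X \<and> X < 2 * k \<and> k \<le> Y \<and> Y < 2 * k \<and> M (X - k) (Y - k))"
  proof -
    have "(X, Y) \<in> {(k + i, i) |i. i < 2 * k} \<longleftrightarrow> X = Y + k \<and> Y < 2 * k" by auto
    moreover have "(X, Y) \<in> {(k + i, k + j) |i j. i < k \<and> j < k \<and> M i j} \<longleftrightarrow>
        k \<le> X \<and> X < 2 * k \<and> k \<le> Y \<and> Y < 2 * k \<and> M (X - k) (Y - k)"
      by (force intro: exI[where x = "X - k"] exI[where x = "Y - k"])
    ultimately show ?thesis by (simp add: core_def)
  qed
  have r: "(\<exists>p<k. (X, Y) \<in> rows k p (\<lambda>_. True) (\<lambda>_. True)) \<longleftrightarrow>
      X < k \<and> Y < k \<or> 2 * k \<le> X \<and> X < 3 * k \<and> 2 * k \<le> Y \<and> Y < 3 * k"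
  proof -
    have "(X, Y) \<in> rows k X (\<lambda>_. True) (\<lambda>_. True)" if "X < k" "Y < k"
      using that by (simp add: rows_def)
    moreover have "(X, Y) \<in> rows k (Y - 2 * k) (\<lambda>_. True) (\<lambda>_. True) \<and> Y - 2 * k < k"
      if "2 * k \<le> X" "X < 3 * k" "2 * k \<le> Y" "Y < 3 * k"
      using that by (auto simp: rows_def intro: exI[of _ "X - 2 * k"])
    ultimately show ?thesis by (auto simp: rows_def)
  qed
  have l: "(\<exists>p<k. (X, Y) \<in> leaves k p) \<longleftrightarrow> Y = 3 * k + X \<or> X = Y + k \<and> 2 * k \<le> Y"
    using assms(2,3) by (auto simp: leaves_def intro: exI[of _ X] exI[of _ "X - 3 * k"])
  have b: "(X, Y) \<in> base dec k M \<longleftrightarrow> (X, Y) \<in> core k M \<or>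
      dec \<and> ((\<exists>p<k. (X, Y) \<in> rows k p (\<lambda>_. True) (\<lambda>_. True)) \<or> (\<exists>p<k. (X, Y) \<in> leaves k p))"
    unfolding base_def pairs_def slot_def by (cases dec) auto
  have d: "z div k = 0 \<longleftrightarrow> z < k" "z div k = 1 \<longleftrightarrow> k \<le> z \<and> z < 2 * k"
    "z div k = 2 \<longleftrightarrow> 2 * k \<le> z \<and> z < 3 * k" for z
    unfolding div_eq_iff_bounds[OF assms(1)] by auto
  show ?thesis
  proof (cases dec)
    case True
    have "Y < 2 * k \<or> 2 * k \<le> Y" by linarith
    then show ?thesis unfolding b c r l d add_is_0 using True by satx
  next
    case False
    then show ?thesis unfolding b c d by satx
  qed
qed

text \<open>Here \<open>m\<close> is the capacity that the simulated algorithm expects and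
  \<open>W\<close> that of the machine. The stride \<open>64 * k ^ 6\<close> exceeds both the number
  \<open>k ^ 6\<close> of instances and the at most \<open>23 * k ^ 2\<close> requests of each, and
  makes every value up to \<open>64 * k ^ 6\<close> a word.\<close>

locale reduction =
  fixes m W :: nat and upd qry :: com and dec :: bool and k n :: nat
    and M :: "nat \<Rightarrow> nat \<Rightarrow> bool" and V :: "nat \<Rightarrow> nat \<Rightarrow> bool"
  assumes k: "1 \<le> k" "n \<le> k ^ 3"
    and capacity: "m * (64 * k ^ 6) * (64 * k ^ 6) < W" "2 * (64 * k ^ 6) * (64 * k ^ 6) < W"
begin

sublocale instances m W upd qry "64 * k ^ 6" "k ^ 6"
  using k capacity by unfold_locales auto

lemma powers_le: "k \<le> k ^ 2" "k ^ 2 \<le> k ^ 3" "k ^ 3 \<le> k ^ 4" "k ^ 4 \<le> k ^ 5" "k ^ 5 \<le> k ^ 6"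
  using k(1) power_increasing[of 1 2 k] power_increasing[of 2 3 k] power_increasing[of 3 4 k]
    power_increasing[of 4 5 k] power_increasing[of 5 6 k] by simp_all

lemma small: "x \<le> 64 * k ^ 6 \<Longrightarrow> x < W"
  using R_less by linarith

lemma power_small: "i \<le> 6 \<Longrightarrow> k ^ i < W"
  using k(1) power_increasing[of i 6 k] by (intro small) auto

definition Mp :: "nat \<Rightarrow> nat \<Rightarrow> bool" where
  "Mp i j \<longleftrightarrow> i < n \<and> j < n \<and> M i j"

definition Vp :: "nat \<Rightarrow> nat \<Rightarrow> bool" where
  "Vp c j \<longleftrightarrow> j < n \<and> V c j"

text \<open>
  Instance \<open>r\<close> serves vectors \<open>(r div k\<^sup>4) * k + p\<close>, \<open>p < k\<close>, on the block with row index
  \<open>(r mod k\<^sup>4) div k\<^sup>2\<close> and column index \<open>(r mod k\<^sup>4) mod k\<^sup>2\<close>.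
\<close>

definition row :: "nat \<Rightarrow> nat" where
  "row r = (r mod k ^ 4) div k ^ 2 * k"

definition col :: "nat \<Rightarrow> nat" where
  "col r = (r mod k ^ 4) mod k ^ 2 * k"

definition globals :: "mem \<Rightarrow> bool" where
  "globals s \<longleftrightarrow> s 0 0 = n \<and> s 1 = omv_start n M 1 \<and> s 4 0 = k \<and> s 5 0 = 64 * k ^ 6"

definition at_block :: "nat \<Rightarrow> mem \<Rightarrow> bool" where
  "at_block r s \<longleftrightarrow> s 6 0 = r \<and> s 16 0 = row r \<and> s 17 0 = col r"

lemma row_le: "row r + k \<le> k ^ 3"
proof -
  have "r mod k ^ 4 < k ^ 2 * k ^ 2"
    using k(1) by (simp flip: power_add)
  then have "r mod k ^ 4 div k ^ 2 < k ^ 2" by (rule less_mult_imp_div_less)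
  then have "Suc (r mod k ^ 4 div k ^ 2) * k \<le> k ^ 2 * k" by (intro mult_right_mono) auto
  then show ?thesis by (simp add: row_def power2_eq_square power3_eq_cube)
qed

lemma col_le: "col r + k \<le> k ^ 3"
proof -
  have "r mod k ^ 4 mod k ^ 2 < k ^ 2" using k(1) by simp
  then have "Suc (r mod k ^ 4 mod k ^ 2) * k \<le> k ^ 2 * k" by (intro mult_right_mono) auto
  then show ?thesis by (simp add: col_def power2_eq_square power3_eq_cube)
qed

lemma globals_keeps: "globals s \<Longrightarrow> keeps A s s' \<Longrightarrow> A \<inter> {0, 1, 4, 5} = {} \<Longrightarrow> globals s'"
  by (auto simp: globals_def keeps_def)

lemma at_block_keeps: "at_block r s \<Longrightarrow> keeps A s s' \<Longrightarrow> A \<inter> {6, 16, 17} = {} \<Longrightarrow> at_block r s'"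
  by (auto simp: at_block_def keeps_def)

lemma fits_power: "globals s \<Longrightarrow> i \<le> 6 \<Longrightarrow> fits W (power_expr i) s"
  using fits_power_expr[of s i W] power_small k(1) by (simp add: globals_def)

lemma val_power: "globals s \<Longrightarrow> val (power_expr i) s = k ^ i"
  by (simp add: val_power_expr globals_def)

text \<open>The bound \<open>4 * k ^ 3\<close> leaves room for \<open>base_expr\<close>, which
  evaluates entries also for pairs of the board outside the block.\<close>

lemma entry:
  assumes "globals s" "fits W a s" "fits W b s" "val a s \<le> 4 * k ^ 3" "val b s \<le> 4 * k ^ 3"
  shows "fits W (entry a b) s" "val (entry a b) s = of_bool (Mp (val a s) (val b s))"
proof -
  let ?a = "val a s" and ?b = "val b s"
  have "?a * n \<le> (4 * k ^ 3) * k ^ 3" using assms(4) k(2) by (intro mult_mono) auto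
  also have "\<dots> = 4 * k ^ 6" by (simp flip: power_add)
  finally have "?a * n + ?b \<le> 64 * k ^ 6" "n \<le> 64 * k ^ 6" using assms(5) powers_le k(2) by linarith+
  then have "?a * n + ?b < W" "?a * n < W" "n < W" "1 < W" "0 < W"
    using small R_less by (auto intro: le_less_trans[OF le_add1])
  moreover have "s 1 i < 2" for i
    using assms(1) by (simp add: globals_def omv_start_def)
  moreover have "1 < W \<Longrightarrow> s 1 i < W" for i using \<open>s 1 i < 2\<close> by linarith
  ultimately show "fits W (entry a b) s"
    using assms(1-3) by (auto simp: entry_def globals_def)
  have "(?a * n + ?b) div n = ?a" "(?a * n + ?b) mod n = ?b" "?a * n + ?b < n * n" if "?a < n" "?b < n"
    using that interleave_less[OF that] by auto
  then show "val (entry a b) s = of_bool (Mp ?a ?b)"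
    using assms(1) by (auto simp: entry_def globals_def Mp_def omv_start_def)
qed

lemma steps_select:
  assumes "globals s" "fits W e s" "val e s = r"
  shows "steps W (select e) s \<phi> (cost e + 60)
    (\<lambda>\<phi>' s'. \<phi>' = \<phi> \<and> keeps {6, 16, 17} s s' \<and> at_block r s' \<and> (\<forall>a\<ge>20. s' a = s a))"
proof -
  have g: "globals (s(6 := (s 6)(0 := r)))" "globals (s(6 := (s 6)(0 := r), 16 := (s 16)(0 := row r)))"
    using assms(1) by (auto simp: globals_def)
  have rW: "r < W" using fits_val[OF assms(2)] assms(3) by simp
  have le: "row r < W" "col r < W" "r mod k ^ 4 < W" "r mod k ^ 4 div k ^ 2 < W" "r mod k ^ 4 mod k ^ 2 < W"
    "k < W" "0 < W" "1 < W" "k ^ 4 < W" "k ^ 2 < W"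
  proof -
    show mod: "r mod k ^ 4 < W" using le_less_trans[OF mod_less_eq_dividend rW] .
    show "r mod k ^ 4 div k ^ 2 < W" using le_less_trans[OF div_le_dividend mod] .
    show "r mod k ^ 4 mod k ^ 2 < W" using le_less_trans[OF mod_less_eq_dividend mod] .
    show "row r < W" "col r < W"
      using row_le[of r] col_le[of r] powers_le small[of "row r"] small[of "col r"] by linarith+
  qed (use power_small[of 1] power_small[of 2] power_small[of 4] R_less in auto)
  have "steps W (select e) s \<phi> (cost e + 2 + (29 + 29))
    (\<lambda>\<phi>' s'. \<phi>' = \<phi> \<and> keeps {6, 16, 17} s s' \<and> at_block r s' \<and> (\<forall>a\<ge>20. s' a = s a))"
    unfolding select_def
  proof (rule steps_assign_Seq[OF assms(2) le(7)], unfold assms(3))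
    let ?s1 = "s(6 := (s 6)(0 := r))"
    let ?s2 = "?s1(16 := (?s1 16)(0 := row r))"
    let ?e1 = "Bin Mul (Bin Div (Bin Mod (var 6) (power_expr 4)) (power_expr 2)) (var 4)"
    let ?e2 = "Bin Mul (Bin Mod (Bin Mod (var 6) (power_expr 4)) (power_expr 2)) (var 4)"
    have v1: "val ?e1 ?s1 = row r" "fits W ?e1 ?s1" "cost ?e1 + 2 = 29" 
      using g(1) le rW fits_power[OF g(1), of 4] fits_power[OF g(1), of 2]
      by (auto simp: val_power[OF g(1)] row_def cost_power_expr globals_def)
    have v2: "val ?e2 ?s2 = col r" "fits W ?e2 ?s2" "cost ?e2 + 2 = 29"
      using g(2) le rW fits_power[OF g(2), of 4] fits_power[OF g(2), of 2]
      by (auto simp: val_power[OF g(2)] col_def cost_power_expr globals_def)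
    let ?Q = "\<lambda>\<phi>' s'. \<phi>' = \<phi> \<and> keeps {6, 16, 17} s s' \<and> at_block r s' \<and> (\<forall>a\<ge>20. s' a = s a)"
    have "steps W (assign 17 ?e2) ?s2 \<phi> (cost ?e2 + 2) ?Q"
      by (rule steps_assign[OF v2(2) le(7)], unfold v2(1)) (auto simp: keeps_def at_block_def)
    then have "steps W (Seq (assign 16 ?e1) (assign 17 ?e2)) ?s1 \<phi> (cost ?e1 + 2 + (cost ?e2 + 2)) ?Q"
      by (intro steps_assign_Seq[OF v1(2) le(7)]) (simp only: v1(1))
    then show "steps W (Seq (assign 16 ?e1) (assign 17 ?e2)) ?s1 \<phi> (29 + 29) ?Q"
      unfolding v1(3) v2(3) .
  qed
  then show ?thesis by (simp add: add.commute)
qed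

lemma steps_row_code:
  assumes ready: "rdy todo \<phi> s" and todo: "todo r = map (upd_pair k) (row_list b k p u v) @ as"
    and r: "r < k ^ 6" and s: "globals s" "at_block r s" "s 15 0 = p" and p: "p < k"
    and u: "\<And>i. i < k \<Longrightarrow> s 3 (row r + i) = of_bool (\<not> u i)"
    and v: "\<And>j. j < k \<Longrightarrow> s 2 (col r + j) = of_bool (v j)"
  shows "steps W (row_code b upd) s \<phi> (300 * k)
    (\<lambda>\<phi>' s'. rdy (todo(r := as)) \<phi>' s' \<and> keeps {7, 8, 9} s s')"
proof -
  have less: "k < W" "x < 64 * k \<Longrightarrow> x < W" "x < k \<Longrightarrow> row r + x < W" "x < k \<Longrightarrow> col r + x < W"
    "row r < W" "col r < W" "0 < W" "1 < W" for x
    using powers_le small[of k] small[of x] small[of "row r + x"] small[of "col r + x"] R_less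
      small[of "row r"] small[of "col r"]
      row_le[of r] col_le[of r] by linarith+
  let ?as = "map (\<lambda>j. Upd (2 * k + j) (4 * k + (2 * k + p))) (filter (\<lambda>j. v j = b) [0..<k]) @ as"
  have regs: "s 5 0 = 64 * k ^ 6" "s 6 0 = r" "s 4 0 = k" using s by (auto simp: globals_def at_block_def)
  have facts: "s' 4 0 = k" "s' 5 0 = 64 * k ^ 6" "s' 6 0 = r" "s' 15 0 = p" "s' 16 0 = row r" "s' 17 0 = col r"
    "s' 2 = s 2" "s' 3 = s 3"
    if "keeps {7, 8, 9} s s'" for s'
    using that s by (auto simp: keeps_def globals_def at_block_def)
  have todo': "todo r = map (\<lambda>i. Upd p (4 * s 4 0 + i)) (filter (\<lambda>i. u i = b) [0..<k]) @ ?as"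
    unfolding todo row_list_def by (simp add: upd_pair_def comp_def regs)
  have 1: "steps W (update_loop upd (var 4) (Bin Equal (Get 3 (Bin Add (var 16) (var 9))) (Const (of_bool (\<not> b))))
      (var 15) (var 9)) s \<phi> (k * (cost (var 4) + cost (Bin Equal (Get 3 (Bin Add (var 16) (var 9))) (Const (of_bool (\<not> b))))
        + cost (var 15) + cost (var 9) + 80) + cost (var 4) + 7)
    (\<lambda>\<phi>' s'. rdy (todo(r := ?as)) \<phi>' s' \<and> keeps {7, 8, 9} s s')"
    by (rule steps_update_loop[where X = "\<lambda>_. p" and Y = "\<lambda>i. i", OF ready todo' r regs(1,2)])
      (use less p u in \<open>auto simp: facts\<close>)
  have 2: "steps W (update_loop upd (var 4) (Bin Equal (Get 2 (Bin Add (var 17) (var 9))) (Const (of_bool b)))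
      (scaled 2 (var 9)) (scaled 2 (var 15))) s' \<phi>' (k * (cost (var 4) +
        cost (Bin Equal (Get 2 (Bin Add (var 17) (var 9))) (Const (of_bool b)))
        + cost (scaled 2 (var 9)) + cost (scaled 2 (var 15)) + 80) + cost (var 4) + 7)
    (\<lambda>\<phi>'' s''. rdy ((todo(r := ?as))(r := as)) \<phi>'' s'' \<and> keeps {7, 8, 9} s' s'')"
    if "rdy (todo(r := ?as)) \<phi>' s' \<and> keeps {7, 8, 9} s s'" for \<phi>' s'
  proof (rule steps_update_loop[where X = "\<lambda>j. 2 * k + j" and Y = "\<lambda>_. 2 * k + p"])
    show "rdy (todo(r := ?as)) \<phi>' s'" using that by blast
    show "s' 5 0 = 64 * k ^ 6" "s' 6 0 = r" using facts that by blast+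
    fix s'' i assume "keeps {7, 8, 9} s' s''"
    then have "keeps {7, 8, 9} s s''" using that keeps_trans by blast
    note f = facts[OF this]
    show "fits W (var 4) s'' \<and> val (var 4) s'' = k" using f less by simp
    assume i: "i < k" "s'' 9 0 = i"
    then show "fits W (Bin Equal (Get 2 (Bin Add (var 17) (var 9))) (Const (of_bool b))) s'' \<and>
      (val (Bin Equal (Get 2 (Bin Add (var 17) (var 9))) (Const (of_bool b))) s'' \<noteq> 0 \<longleftrightarrow> v i = b) \<and>
      fits W (scaled 2 (var 9)) s'' \<and> val (scaled 2 (var 9)) s'' = 2 * k + i \<and>
      fits W (scaled 4 (scaled 2 (var 15))) s'' \<and> val (scaled 2 (var 15)) s'' = 2 * k + p"
      using f less p v[OF i(1)] less(2)[of 4] less(2)[of 2] k(1) by auto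
  qed (use that r less facts in auto)
  show ?thesis unfolding row_code_def
    by (rule steps_mono, rule steps_SeqI, rule 1, rule steps_mono, rule 2, assumption)
      (use k(1) in \<open>auto intro: keeps_trans\<close>)
qed


lemma steps_leaf_code:
  assumes ready: "rdy todo \<phi> s" and todo: "todo r = map (upd_pair k) (leaf_list k p) @ as"
    and r: "r < k ^ 6" and s: "globals s" "at_block r s" "s 15 0 = p" and p: "p < k"
  shows "steps W (leaf_code upd) s \<phi> (300 * k)
    (\<lambda>\<phi>' s'. rdy (todo(r := as)) \<phi>' s' \<and> keeps {7, 8, 9} s s')"
proof -
  have less: "x \<le> 64 * k \<Longrightarrow> x < W" "0 < W" "1 < W" for x
    using powers_le small[of x] R_less by linarith+
  have const: "2 < W" "3 < W" "4 < W"
    using less(1)[of 2] less(1)[of 3] less(1)[of 4] k(1) by linarith+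
  let ?as = "Upd (3 * k + p) (4 * k + (2 * k + p)) # as"
  have regs: "s' 4 0 = k" "s' 5 0 = 64 * k ^ 6" "s' 6 0 = r" "s' 15 0 = p" if "keeps {7, 8} s s'" for s'
    using that s by (auto simp: keeps_def globals_def at_block_def)
  note regs0 = regs[of s, unfolded keeps_def, simplified]
  have "todo r = Upd p (4 * s 4 0 + (3 * k + p)) # ?as"
    unfolding todo leaf_list_def by (simp add: upd_pair_def regs0)
  then have 1: "steps W (update_at upd (var 15) (scaled 3 (var 15))) s \<phi>
      (cost (var 15) + cost (scaled 3 (var 15)) + 69)
      (\<lambda>\<phi>' s'. rdy (todo(r := ?as)) \<phi>' s' \<and> keeps {7, 8} s s')"
    by (rule steps_update_at[OF ready _ r]) (use less const p regs0 in auto)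
  have 2: "steps W (update_at upd (scaled 3 (var 15)) (scaled 2 (var 15))) s' \<phi>'
      (cost (scaled 3 (var 15)) + cost (scaled 2 (var 15)) + 69)
      (\<lambda>\<phi>'' s''. rdy ((todo(r := ?as))(r := as)) \<phi>'' s'' \<and> keeps {7, 8} s' s'')"
    if "rdy (todo(r := ?as)) \<phi>' s' \<and> keeps {7, 8} s s'" for \<phi>' s'
    by (rule steps_update_at[where X = "3 * k + p" and Y = "2 * k + p"])
      (use that r less const p regs[of s'] in auto)
  show ?thesis unfolding leaf_code_def
    by (rule steps_mono, rule steps_SeqI, rule 1, rule steps_mono, rule 2, assumption)
      (use k(1) in \<open>auto simp: keeps_def\<close>)
qed

lemma steps_pre_code:
  assumes "rdy todo \<phi> s" "todo r = map (upd_pair k) (pre_list dec k p u v) @ as"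
    "r < k ^ 6" "globals s" "at_block r s" "s 15 0 = p" "p < k"
    "\<And>i. i < k \<Longrightarrow> s 3 (row r + i) = of_bool (\<not> u i)" "\<And>j. j < k \<Longrightarrow> s 2 (col r + j) = of_bool (v j)"
  shows "steps W (pre_code dec upd) s \<phi> (600 * k)
    (\<lambda>\<phi>' s'. rdy (todo(r := as)) \<phi>' s' \<and> keeps {7, 8, 9} s s')"
proof -
  let ?as = "(if dec then map (upd_pair k) (leaf_list k p) else []) @ as"
  have "todo r = map (upd_pair k) (row_list (\<not> dec) k p u v) @ ?as"
    using assms(2) by (simp add: pre_list_def)
  from steps_row_code[where todo = todo and \<phi> = \<phi> and s = s and r = r and b = "\<not> dec" and p = p
      and u = u and v = v and as = ?as, OF assms(1) this assms(3-9)]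
  have 1: "steps W (row_code (\<not> dec) upd) s \<phi> (300 * k)
      (\<lambda>\<phi>' s'. rdy (todo(r := ?as)) \<phi>' s' \<and> keeps {7, 8, 9} s s')" by blast
  have 2: "steps W (if dec then leaf_code upd else Skip) s' \<phi>' (300 * k)
      (\<lambda>\<phi>' s'. rdy (todo(r := as)) \<phi>' s' \<and> keeps {7, 8, 9} s s')"
    if s': "rdy (todo(r := ?as)) \<phi>' s' \<and> keeps {7, 8, 9} s s'" for \<phi>' s'
  proof (cases dec)
    case True
    have "steps W (leaf_code upd) s' \<phi>' (300 * k)
      (\<lambda>\<phi>'' s''. rdy ((todo(r := ?as))(r := as)) \<phi>'' s'' \<and> keeps {7, 8, 9} s' s'')"
    proof (rule steps_leaf_code[where p = p])
      show "rdy (todo(r := ?as)) \<phi>' s'" using s' by blast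
      show "globals s'" by (rule globals_keeps[OF assms(4) conjunct2[OF s']]) simp
      show "at_block r s'" by (rule at_block_keeps[OF assms(5) conjunct2[OF s']]) simp
      show "s' 15 0 = p" using keepsD[OF conjunct2[OF s'], of 15] assms(6) by simp
    qed (use True assms(3,7) in simp_all)
    then have "steps W (leaf_code upd) s' \<phi>' (300 * k)
        (\<lambda>\<phi>' s'. rdy (todo(r := as)) \<phi>' s' \<and> keeps {7, 8, 9} s s')"
      by (rule steps_mono) (use s' in \<open>auto intro: keeps_trans\<close>)
    then show ?thesis using True by simp
  next
    case False
    let ?Q = "\<lambda>\<phi>' s'. rdy (todo(r := as)) \<phi>' s' \<and> keeps {7, 8, 9} s s'"
    have "?Q \<phi>' s'" using s' False by simp
    then have "steps W Skip s' \<phi>' 1 ?Q" by (rule steps_Skip[where Q = ?Q])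
    then have "steps W Skip s' \<phi>' (300 * k) ?Q" by (rule steps_mono) (use k(1) in simp_all)
    then show ?thesis using False by simp
  qed
  have "steps W (pre_code dec upd) s \<phi> (300 * k + 300 * k)
      (\<lambda>\<phi>' s'. rdy (todo(r := as)) \<phi>' s' \<and> keeps {7, 8, 9} s s')"
    unfolding pre_code_def
  proof (rule steps_SeqI[OF 1])
    fix \<phi>' s' assume "rdy (todo(r := ?as)) \<phi>' s' \<and> keeps {7, 8, 9} s s'"
    then show "steps W (if dec then leaf_code upd else Skip) s' \<phi>' (300 * k)
      (\<lambda>\<phi>' s'. rdy (todo(r := as)) \<phi>' s' \<and> keeps {7, 8, 9} s s')" by (rule 2)
  qed
  then show ?thesis by simp
qed

lemma steps_post_code:
  assumes "rdy todo \<phi> s" "todo r = map (upd_pair k) (post_list dec k p u v) @ as"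
    "r < k ^ 6" "globals s" "at_block r s" "s 15 0 = p" "p < k"
    "\<And>i. i < k \<Longrightarrow> s 3 (row r + i) = of_bool (\<not> u i)" "\<And>j. j < k \<Longrightarrow> s 2 (col r + j) = of_bool (v j)"
  shows "steps W (post_code dec upd) s \<phi> (300 * k)
    (\<lambda>\<phi>' s'. rdy (todo(r := as)) \<phi>' s' \<and> keeps {7, 8, 9} s s')"
proof (cases dec)
  case True
  then have "todo r = map (upd_pair k) (row_list True k p u v) @ as"
    using assms(2) by (simp add: post_list_def)
  from steps_row_code[where todo = todo and \<phi> = \<phi> and s = s and r = r and b = True and p = p
      and u = u and v = v and as = as, OF assms(1) this assms(3-9)]
  show ?thesis using True by (simp add: post_code_def)
next
  case False
  then have "todo r = map (upd_pair k) (leaf_list k p) @ as"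
    using assms(2) by (simp add: post_list_def)
  from steps_leaf_code[where todo = todo and \<phi> = \<phi> and s = s and r = r and p = p and as = as,
      OF assms(1) this assms(3-7)]
  show ?thesis using False by (simp add: post_code_def)
qed

text \<open>The truth value is what the update loop tests; the bound on the value lets the enclosing
  sum in \<open>sum_expr\<close> fit.\<close>

lemma boolean_expr:
  assumes "fits W a s" "val a s = of_bool A" "fits W b s" "val b s = of_bool B"
    "fits W c s" "val c s = of_bool C" "fits W d s" "val d s = of_bool D" "3 < W"
  shows "fits W (Bin Mul (Const (of_bool P)) (Bin Add a (Bin Add b (Bin Mul c d)))) s \<and>
    val (Bin Mul (Const (of_bool P)) (Bin Add a (Bin Add b (Bin Mul c d)))) s \<le> 3 \<and>
    (val (Bin Mul (Const (of_bool P)) (Bin Add a (Bin Add b (Bin Mul c d)))) s \<noteq> 0 \<longleftrightarrow>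
      P \<and> (A \<or> B \<or> C \<and> D))"
  using assms by (cases A; cases B; cases C; cases D; cases P) simp_all

lemma sum_expr:
  assumes "fits W a s \<and> val a s \<le> 2 \<and> (val a s \<noteq> 0 \<longleftrightarrow> A)"
    "fits W b s \<and> val b s \<le> 1 \<and> (val b s \<noteq> 0 \<longleftrightarrow> B)"
    "fits W c s \<and> val c s \<le> 3 \<and> (val c s \<noteq> 0 \<longleftrightarrow> C)" "6 < W"
  shows "fits W (Bin Add (Bin Add a b) c) s \<and> val (Bin Add (Bin Add a b) c) s \<le> 6 \<and>
    (val (Bin Add (Bin Add a b) c) s \<noteq> 0 \<longleftrightarrow> A \<or> B \<or> C)"
  using assms by auto

lemma steps_init_code:
  assumes ready: "rdy todo \<phi> s"
    and todo: "todo r = map (upd_pair k) (base_list dec k (\<lambda>i j. Mp (row r + i) (col r + j))) @ as"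
    and r: "r < k ^ 6" and s: "globals s" "at_block r s"
  shows "steps W (init_code dec upd) s \<phi> (10000 * k ^ 2)
    (\<lambda>\<phi>' s'. rdy (todo(r := as)) \<phi>' s' \<and> keeps {7, 8, 9} s s')"
proof -
  let ?M = "\<lambda>i j. Mp (row r + i) (col r + j)"
  let ?c = "if dec then Bin Equal (base_expr dec) (Const 0) else base_expr dec"
  let ?X = "Bin Div (var 9) (Bin Mul (Const 4) (var 4))" and ?Y = "Bin Mod (var 9) (Bin Mul (Const 4) (var 4))"
  have less: "x \<le> 64 * k \<Longrightarrow> x < W" "x \<le> 64 * k ^ 2 \<Longrightarrow> x < W" "0 < W" "1 < W" for x
    using powers_le small[of x] R_less by linarith+
  have const: "2 < W" "3 < W" "4 < W" "5 < W" "6 < W" "16 < W"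
    using less(1)[of 2] less(1)[of 3] less(1)[of 4] less(1)[of 5] less(1)[of 6] less(1)[of 16] k(1) by linarith+
  have regs: "globals s'" "at_block r s'" if "keeps {7, 8, 9} s s'" for s'
    using that s by (auto intro: globals_keeps at_block_keeps)
  have base: "fits W (base_expr dec) s' \<and> val (base_expr dec) s' \<le> 6 \<and>
      (val (base_expr dec) s' \<noteq> 0 \<longleftrightarrow> (i div (4 * k), i mod (4 * k)) \<in> base dec k ?M)"
    if keeps: "keeps {7, 8, 9} s s'" and i: "i < (4 * k) * (4 * k)" "s' 9 0 = i" for s' i
  proof -
    let ?x = "i div (4 * k)" and ?y = "i mod (4 * k)"
    have xy: "?x < 4 * k" "?y < 4 * k" using less_mult_imp_div_less[OF i(1)] k(1) by auto
    have "i < W" using i(1) less(2)[of i] by (simp add: power2_eq_square)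
    have bounds: "?x < W" "?y < W" "?x + k < W" "?y + k < W" "3 * k + ?x < W" "3 * k < W" "2 * k < W" "k < W"
        "4 * k < W" "?x - k < W" "?y - k < W"
      by (rule less(1), insert xy, linarith)+
    have divs: "?x div k < 4" "?y div k < 4"
      using less_mult_imp_div_less[OF xy(1)] less_mult_imp_div_less[OF xy(2)] by auto
    have divb: "?x div k < W" "?y div k < W" "?x div k + ?y div k < W" 
      using divs const by linarith+
    have rc: "row r + (?x - k) \<le> 4 * k ^ 3" "col r + (?y - k) \<le> 4 * k ^ 3"
      using row_le[of r] col_le[of r] xy powers_le by linarith+
    have rcW: "row r + (?x - k) < W" "col r + (?y - k) < W" "row r < W" "col r < W"
      using rc row_le[of r] col_le[of r] powers_le small[of "row r + (?x - k)"] small[of "col r + (?y - k)"]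
        small[of "row r"] small[of "col r"] by linarith+
    note g = regs[OF keeps]
    have reg: "s' 4 0 = k" "s' 16 0 = row r" "s' 17 0 = col r" "s' 9 0 = i"
      using g i(2) by (auto simp: globals_def at_block_def)
    let ?a = "Bin Add (var 16) (Bin Sub ?X (var 4))" and ?b = "Bin Add (var 17) (Bin Sub ?Y (var 4))"
    have a: "fits W ?a s'" "fits W ?b s'" "val ?a s' = row r + (?x - k)" "val ?b s' = col r + (?y - k)"
      using reg bounds rcW less const \<open>i < W\<close> by auto
    have e: "fits W (entry ?a ?b) s'" "val (entry ?a ?b) s' = of_bool (?M (?x - k) (?y - k))"
      using entry[OF g(1) a(1,2)] rc a(3,4) by auto
    let ?d = "Const (of_bool dec)"
    let ?T1 = "Bin Mul (Bin Equal ?X (Bin Add ?Y (var 4))) (Bin Add (Bin Less ?Y (Bin Mul (Const 2) (var 4))) ?d)"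
    let ?T2 = "Bin Mul (Bin Mul (Bin Equal (Bin Div ?X (var 4)) (Const 1))
      (Bin Equal (Bin Div ?Y (var 4)) (Const 1))) (entry ?a ?b)"
    let ?T3 = "Bin Mul ?d (Bin Add (Bin Equal ?Y (scaled 3 ?X))
         (Bin Add (Bin Equal (Bin Add (Bin Div ?X (var 4)) (Bin Div ?Y (var 4))) (Const 0))
           (Bin Mul (Bin Equal (Bin Div ?X (var 4)) (Const 2)) (Bin Equal (Bin Div ?Y (var 4)) (Const 2)))))"
    have 1: "fits W ?T1 s' \<and> val ?T1 s' \<le> 2 \<and> (val ?T1 s' \<noteq> 0 \<longleftrightarrow> ?x = ?y + k \<and> (?y < 2 * k \<or> dec))"
      using reg bounds less const \<open>i < W\<close> by (auto simp: of_bool_def)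
    have 2: "fits W ?T2 s' \<and> val ?T2 s' \<le> 1 \<and>
        (val ?T2 s' \<noteq> 0 \<longleftrightarrow> ?x div k = 1 \<and> ?y div k = 1 \<and> ?M (?x - k) (?y - k))"
      using reg bounds divb less const \<open>i < W\<close> e by (auto simp: of_bool_def)
    let ?dx = "Bin Div ?X (var 4)" and ?dy = "Bin Div ?Y (var 4)"
    have d: "fits W ?dx s'" "val ?dx s' = ?x div k" "fits W ?dy s'" "val ?dy s' = ?y div k"
      using reg bounds divb less const \<open>i < W\<close> by simp_all
    have "fits W (Bin Equal ?Y (scaled 3 ?X)) s'"
      "val (Bin Equal ?Y (scaled 3 ?X)) s' = of_bool (?y = 3 * k + ?x)"
      using reg bounds less const \<open>i < W\<close> by auto
    moreover have "fits W (Bin Equal (Bin Add ?dx ?dy) (Const 0)) s'"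
      "val (Bin Equal (Bin Add ?dx ?dy) (Const 0)) s' = of_bool (?x div k + ?y div k = 0)"
      "fits W (Bin Equal ?dx (Const 2)) s'" "val (Bin Equal ?dx (Const 2)) s' = of_bool (?x div k = 2)"
      "fits W (Bin Equal ?dy (Const 2)) s'" "val (Bin Equal ?dy (Const 2)) s' = of_bool (?y div k = 2)"
      using d reg divb less const by simp_all
    ultimately have 3: "fits W ?T3 s' \<and> val ?T3 s' \<le> 3 \<and> (val ?T3 s' \<noteq> 0 \<longleftrightarrow>
        dec \<and> (?y = 3 * k + ?x \<or> ?x div k + ?y div k = 0 \<or> ?x div k = 2 \<and> ?y div k = 2))"
      by (intro boolean_expr) (use const in simp_all)
    show ?thesis
      unfolding base_iff[OF less_le_trans[OF zero_less_one k(1)] xy] base_expr_def Let_def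
      by (rule sum_expr[OF 1 2 3 const(5)])
  qed
  have "steps W (init_code dec upd) s \<phi> ((4 * k) * (4 * k) * (cost (Bin Mul (Const 16) (power_expr 2)) +
      cost ?c + cost ?X + cost ?Y + 80) + cost (Bin Mul (Const 16) (power_expr 2)) + 7)
    (\<lambda>\<phi>' s'. rdy (todo(r := as)) \<phi>' s' \<and> keeps {7, 8, 9} s s')"
    unfolding init_code_def
  proof (rule steps_update_loop[where X = "\<lambda>i. i div (4 * k)" and Y = "\<lambda>i. i mod (4 * k)"
        and P = "\<lambda>i. ((i div (4 * k), i mod (4 * k)) \<in> base dec k ?M) \<noteq> dec"])
    have k4: "s 4 0 = k" using s(1) by (simp add: globals_def)
    show "todo r = map (\<lambda>i. Upd (i div (4 * k)) (4 * s 4 0 + i mod (4 * k)))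
        (filter (\<lambda>i. ((i div (4 * k), i mod (4 * k)) \<in> base dec k ?M) \<noteq> dec) [0..<4 * k * (4 * k)]) @ as"
      unfolding todo base_list_def k4 by (simp add: upd_pair_def comp_def)
    show "s 5 0 = 64 * k ^ 6" "s 6 0 = r" using s by (auto simp: globals_def at_block_def)
    show "4 * k * (4 * k) < W" using less(2)[of "4 * k * (4 * k)"] by (simp add: power2_eq_square)
    fix s' assume keeps: "keeps {7, 8, 9} s s'"
    note g = regs[OF keeps]
    show "fits W (Bin Mul (Const 16) (power_expr 2)) s' \<and> val (Bin Mul (Const 16) (power_expr 2)) s' = 4 * k * (4 * k)"
      using fits_power[OF g(1), of 2] val_power[OF g(1), of 2] less(2)[of "16 * k ^ 2"] const
      by (auto simp: power2_eq_square)
    fix i assume i: "i < 4 * k * (4 * k)" "s' 9 0 = i"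
    have le: "i < W" using i(1) less(2)[of i] by (simp add: power2_eq_square)
    have xy: "i div (4 * k) < 4 * k" "i mod (4 * k) < 4 * k" using less_mult_imp_div_less[OF i(1)] k(1) by auto
    have lt: "i div (4 * k) < W" "i mod (4 * k) < W" "4 * k < W" "4 * k + i mod (4 * k) < W" "k < W"
      by (rule less(1), insert xy, linarith)+
    have "fits W ?c s' \<and> (val ?c s' \<noteq> 0 \<longleftrightarrow> ((i div (4 * k), i mod (4 * k)) \<in> base dec k ?M) \<noteq> dec)"
      using base[OF keeps i] less by auto
    then show "fits W ?c s' \<and> (val ?c s' \<noteq> 0 \<longleftrightarrow> ((i div (4 * k), i mod (4 * k)) \<in> base dec k ?M) \<noteq> dec) \<and>
        fits W ?X s' \<and> val ?X s' = i div (4 * k) \<and> fits W (scaled 4 ?Y) s' \<and> val ?Y s' = i mod (4 * k)"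
      using g(1) i(2) le lt const less by (auto simp: globals_def)
  qed (use ready r in auto)
  then show ?thesis
  proof (rule steps_mono)
    have "cost ?c \<le> 200"
      by (auto simp: base_expr_def Let_def entry_def)
    then have "4 * k * (4 * k) * (cost (Bin Mul (Const 16) (power_expr 2)) + cost ?c + cost ?X + cost ?Y + 80)
        \<le> 4 * k * (4 * k) * 400"
      by (intro mult_left_mono) (auto simp: cost_power_expr)
    moreover have "1 \<le> k ^ 2" using k(1) by simp
    moreover have "4 * k * (4 * k) * 400 = 6400 * k ^ 2" by (simp add: power2_eq_square)
    moreover have "cost (Bin Mul (Const 16) (power_expr 2)) = 9" by (simp add: cost_power_expr)
    ultimately show "4 * k * (4 * k) * (cost (Bin Mul (Const 16) (power_expr 2)) + cost ?c + cost ?X + cost ?Y + 80) +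
        cost (Bin Mul (Const 16) (power_expr 2)) + 7 \<le> 10000 * k ^ 2"
      by linarith
  qed
qed


text \<open>Comparing the answer with the threshold decides \<open>b\<close>. If \<open>b\<close> is
  false, every row with a 1 in this block is already marked, so skipping the search leaves the same
  bank 3 as performing it.\<close>

lemma steps_search:
  assumes s: "globals s" "at_block r s" "s 15 0 = p" "p < k"
    and hit: "s 3 = (\<lambda>x. of_bool (hit x))" and v: "s 2 = (\<lambda>j. of_bool (v j))"
    and ans: "s 12 0 \<in> answers k (threshold dec k p) b"
    and b: "b \<longleftrightarrow> hits k (\<lambda>i j. Mp (row r + i) (col r + j)) (\<lambda>i. \<not> hit (row r + i)) (\<lambda>j. v (col r + j))"
  shows "steps W (search dec) s \<phi> (30 + (if b then 100 * k ^ 2 else 0))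
    (\<lambda>\<phi>' s'. \<phi>' = \<phi> \<and> keeps {3, 13, 14} s s' \<and> (\<forall>a\<ge>20. s' a = s a) \<and>
      s' 3 = (\<lambda>x. of_bool (hit x \<or> (\<exists>i<k. x = row r + i \<and> (\<exists>j<k. Mp x (col r + j) \<and> v (col r + j))))))"
proof -
  have less: "x \<le> 64 * k \<Longrightarrow> x < W" "0 < W" "1 < W" for x
    using powers_le small[of x] R_less by linarith+
  have rcW: "i < k \<Longrightarrow> row r + i < W" "i < k \<Longrightarrow> col r + i < W" "row r < W" "col r < W" for i
    using row_le[of r] col_le[of r] powers_le small[of "row r + i"] small[of "col r + i"]
        small[of "row r"] small[of "col r"] by linarith+
  have rc: "i < k \<Longrightarrow> row r + i \<le> 4 * k ^ 3" "i < k \<Longrightarrow> col r + i \<le> 4 * k ^ 3" for i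
    using row_le[of r] col_le[of r] by linarith+
  let ?new = "\<lambda>x j. Mp x (col r + j) \<and> v (col r + j)"
  let ?a = "Bin Add (var 16) (var 13)" and ?b = "Bin Add (var 17) (var 14)"
  let ?body = "Cond (Bin Mul (entry ?a ?b) (Get 2 ?b)) (Put 3 ?a (Const 1)) Skip"
  let ?same = "\<lambda>\<phi>' s'. \<phi>' = \<phi> \<and> keeps {3, 13, 14} s s' \<and> (\<forall>a\<ge>20. s' a = s a)"
  let ?I = "\<lambda>i \<phi>' s'. ?same \<phi>' s' \<and> s' 13 0 = i \<and>
    s' 3 = (\<lambda>x. of_bool (hit x \<or> (\<exists>i'<i. x = row r + i' \<and> (\<exists>j<k. ?new x j))))"
  let ?J = "\<lambda>i j \<phi>' s'. ?same \<phi>' s' \<and> s' 13 0 = i \<and> s' 14 0 = j \<and>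
    s' 3 = (\<lambda>x. of_bool (hit x \<or> (\<exists>i'<i. x = row r + i' \<and> (\<exists>j<k. ?new x j)) \<or>
      x = row r + i \<and> (\<exists>j'<j. ?new x j')))"
  have regs: "globals s'" "s' 4 0 = k" "s' 16 0 = row r" "s' 17 0 = col r" "s' 2 = (\<lambda>j. of_bool (v j))"
    if "keeps {3, 13, 14} s s'" for s'
    using that s v globals_keeps[OF s(1) that] by (auto simp: keeps_def globals_def at_block_def)
  have body: "steps W ?body s' \<phi>' 48 (\<lambda>\<phi>'' s''. s'' 14 0 = j \<and> ?J i (Suc j) \<phi>'' (s''(14 := (s'' 14)(0 := Suc j))))"
    if ij: "i < k" "j < k" and J: "?J i j \<phi>' s'" for i j \<phi>' s'
  proof -
    note reg = regs[OF conjunct1[OF conjunct2[OF conjunct1[OF J]]]]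
    have J': "s' 13 0 = i" "s' 14 0 = j" using J by blast+
    have ab: "fits W ?a s'" "fits W ?b s'" "val ?a s' = row r + i" "val ?b s' = col r + j"
      using J' reg ij rcW less by simp_all
    have e: "fits W (entry ?a ?b) s'" "val (entry ?a ?b) s' = of_bool (Mp (row r + i) (col r + j))"
      using entry[OF reg(1) ab(1,2)] rc ij unfolding ab(3,4) by simp_all
    let ?Q = "\<lambda>\<phi>'' s''. s'' 14 0 = j \<and> ?J i (Suc j) \<phi>'' (s''(14 := (s'' 14)(0 := Suc j)))"
    have g: "fits W (Get 2 ?b) s'" "val (Get 2 ?b) s' = of_bool (v (col r + j))"
      using ab J' reg less by simp_all
    have c: "fits W (Bin Mul (entry ?a ?b) (Get 2 ?b)) s'"
      "val (Bin Mul (entry ?a ?b) (Get 2 ?b)) s' = of_bool (?new (row r + i) j)"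
      unfolding fits.simps(3) val.simps(3) val_op.simps e(2) g(2) using e(1) g(1) less by simp_all
    have "steps W ?body s' \<phi>' (cost (Bin Mul (entry ?a ?b) (Get 2 ?b)) + 1 + 7) ?Q"
    proof (rule steps_Cond[OF c(1)])
      assume "val (Bin Mul (entry ?a ?b) (Get 2 ?b)) s' \<noteq> 0"
      then have "?new (row r + i) j" unfolding c(2) by (simp split: if_splits)
      then have "?Q \<phi>' (s'(3 := (s' 3)(row r + i := 1)))"
        using J by (auto simp: keeps_def fun_eq_iff of_bool_def less_Suc_eq)
      then show "steps W (Put 3 ?a (Const 1)) s' \<phi>' 7 ?Q"
        using ab less by (intro steps_mono[OF steps_Put[where Q = ?Q]]) auto
    next
      assume "val (Bin Mul (entry ?a ?b) (Get 2 ?b)) s' = 0"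
      then have "\<not> ?new (row r + i) j" unfolding c(2) by (simp split: if_splits)
      then have "?Q \<phi>' s'"
        using J by (auto simp: keeps_def fun_eq_iff less_Suc_eq)
      then show "steps W Skip s' \<phi>' 7 ?Q"
        by (intro steps_mono[OF steps_Skip[where Q = ?Q]]) auto
    qed
    then show ?thesis by (rule steps_mono) (auto simp: entry_def)
  qed
  have inner: "steps W (count_loop 14 (var 4) ?body) s' \<phi>' (k * (48 + cost (var 4) + 10) + cost (var 4) + 7) (?J i k)"
    if i: "i < k" and I: "?I i \<phi>' s'" for i \<phi>' s'
  proof (rule steps_count_loop[where I = "?J i"])
    show "?J i 0 \<phi>' (s'(14 := (s' 14)(0 := 0)))" using I by (auto simp: keeps_def)
    show "s'' 14 0 = j \<and> fits W (var 4) s'' \<and> val (var 4) s'' = k" if "?J i j \<phi>'' s''" for j \<phi>'' s''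
      using that regs[of s''] less by auto
    show "steps W ?body s'' \<phi>'' 48 (\<lambda>\<phi>' s'. s' 14 0 = j \<and> ?J i (Suc j) \<phi>' (s'(14 := (s' 14)(0 := Suc j))))"
      if "j < k" "?J i j \<phi>'' s''" for j \<phi>'' s''
      by (rule body[OF i that])
  qed (use less in auto)
  have outer: "steps W (count_loop 13 (var 4) (count_loop 14 (var 4) ?body)) s \<phi>
      (k * ((k * (48 + cost (var 4) + 10) + cost (var 4) + 7) + cost (var 4) + 10) + cost (var 4) + 7) (?I k)"
  proof (rule steps_count_loop[where I = ?I])
    show "?I 0 \<phi> (s(13 := (s 13)(0 := 0)))" using hit by (auto simp: keeps_def)
    show "s'' 13 0 = i \<and> fits W (var 4) s'' \<and> val (var 4) s'' = k" if "?I i \<phi>'' s''" for i \<phi>'' s''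
      using that regs[of s''] less by auto
    fix i \<phi>' s' assume "i < k" "?I i \<phi>' s'"
    note step = inner[OF this]
    have eq: "(\<exists>i'<Suc i. x = row r + i' \<and> (\<exists>j<k. ?new x j)) \<longleftrightarrow>
        (\<exists>i'<i. x = row r + i' \<and> (\<exists>j<k. ?new x j)) \<or> x = row r + i \<and> (\<exists>j<k. ?new x j)" for x
      unfolding less_Suc_eq by blast
    show "steps W (count_loop 14 (var 4) ?body) s' \<phi>' (k * (48 + cost (var 4) + 10) + cost (var 4) + 7)
        (\<lambda>\<phi>' s'. s' 13 0 = i \<and> ?I (Suc i) \<phi>' (s'(13 := (s' 13)(0 := Suc i))))"
    proof (rule steps_mono[OF step order.refl])
      fix \<phi>'' s'' assume J: "?J i k \<phi>'' s''"
      then have "keeps {3, 13, 14} s (s''(13 := (s'' 13)(0 := Suc i)))" by (auto simp: keeps_def)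
      then show "s'' 13 0 = i \<and> ?I (Suc i) \<phi>'' (s''(13 := (s'' 13)(0 := Suc i)))"
        unfolding eq using J by simp
    qed
  qed (use less in auto)
  let ?t = "Bin Less (threshold_expr dec) (var 12)"
  have t: "fits W ?t s" "val ?t s = of_bool b" "cost ?t \<le> 15"
  proof -
    have "2 < W" "s 12 0 < W" using less(1)[of 2] less(1)[of "s 12 0"] k(1) ans by (auto simp: answers_def)
    then show "fits W ?t s"
      using s less by (auto simp: threshold_expr_def globals_def of_bool_def)
    show "val ?t s = of_bool b"
    proof -
      have "s 4 0 = k" using s(1) by (simp add: globals_def)
      then have "val (threshold_expr dec) s = threshold dec k p"
        using s(3) by (simp add: threshold_expr_def threshold_def)
      then show ?thesis using ans by (simp add: answers_def)
    qed
  qed (auto simp: threshold_expr_def)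
  let ?Q = "\<lambda>\<phi>' s'. ?same \<phi>' s' \<and> s' 3 = (\<lambda>x. of_bool (hit x \<or> (\<exists>i<k. x = row r + i \<and> (\<exists>j<k. ?new x j))))"
  show ?thesis
  proof (cases b)
    case True
    have "steps W (search dec) s \<phi> (cost ?t + 1 + (100 * k ^ 2)) ?Q"
      unfolding search_def
    proof (rule steps_Cond[OF t(1)])
      have "k * ((k * (48 + cost (var 4) + 10) + cost (var 4) + 7) + cost (var 4) + 10) + cost (var 4) + 7
          = 60 * (k * k) + 21 * k + 9"
        by (simp add: algebra_simps)
      moreover have "k \<le> k ^ 2" "1 \<le> k" using k(1) powers_le(1) by blast+
      ultimately have "k * ((k * (48 + cost (var 4) + 10) + cost (var 4) + 7) + cost (var 4) + 10) + cost (var 4) + 7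
          \<le> 100 * k ^ 2"
        unfolding power2_eq_square by linarith
      then show "steps W (count_loop 13 (var 4) (count_loop 14 (var 4) ?body)) s \<phi> (100 * k ^ 2) ?Q"
        by (rule steps_mono[OF outer]) auto
    qed (use True t(2) in auto)
    then show ?thesis using True t(3) by (elim steps_mono) auto
  next
    case False
    have "?Q \<phi> s" using False b hit by (auto simp: keeps_def fun_eq_iff)
    then have "steps W (search dec) s \<phi> (cost ?t + 1 + 1) ?Q"
      unfolding search_def
      by (intro steps_Cond[OF t(1)] steps_Skip[where Q = ?Q]) (use False t(2) in auto)
    then show ?thesis using False t(3) by (elim steps_mono) auto
  qed
qed

end

text \<open>A local amortization: a quantity that falls from \<open>D\<close> to \<open>D'\<close>
  pays for \<open>e\<close> time units, and what remains of it is added to the potential of the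
  inner statement.\<close>

lemma steps_transfer:
  assumes "steps W c s \<psi> (T + e) Q" "\<psi> + D \<le> \<phi>" "D' + e \<le> D"
    and "\<And>\<psi>' s'. Q \<psi>' s' \<Longrightarrow> Q' (\<psi>' + D') s'"
  shows "steps W c s \<phi> T Q'"
proof -
  obtain t s' \<psi>' where "run W c s t s'" "t + \<psi>' \<le> \<psi> + (T + e)" "Q \<psi>' s'"
    using assms(1) unfolding steps_def by blast
  then show ?thesis unfolding steps_def using assms(2-)
    by (intro exI[of _ t] exI[of _ s'] exI[of _ "\<psi>' + D'"]) auto
qed

lemma filter_upt_ge: "p \<le> k \<Longrightarrow> filter (\<lambda>x. p \<le> x) [0..<k] = [p..<k]"
  by (induction k) (auto simp: le_Suc_eq)

section \<open>The schedule of phases and the multiplication of one vector\<close>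

context reduction begin

text \<open>
  \<open>hit c q x\<close>: row \<open>x\<close> of the product with vector \<open>c\<close> is found to be 1 in one of the first \<open>q\<close>
  blocks.
\<close>

definition hit :: "nat \<Rightarrow> nat \<Rightarrow> nat \<Rightarrow> bool" where
  "hit c q x \<longleftrightarrow> (\<exists>q'<q. q' div k ^ 2 = x div k \<and>
     (\<exists>j<k. Mp x (q' mod k ^ 2 * k + j) \<and> Vp c (q' mod k ^ 2 * k + j)))"

definition vector_of :: "nat \<Rightarrow> nat \<Rightarrow> nat" where
  "vector_of r p = r div k ^ 4 * k + p"

definition block :: "nat \<Rightarrow> nat \<Rightarrow> nat \<Rightarrow> bool" where
  "block r i j \<longleftrightarrow> Mp (row r + i) (col r + j)"

text \<open>The rows that the program asks about depend on earlier answers, but these are correct,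
  so \<open>hit\<close> expresses them without running anything. This makes the whole action list of
  an instance known in advance, as a bound on complete request sequences requires.\<close>

definition left :: "nat \<Rightarrow> nat \<Rightarrow> nat \<Rightarrow> bool" where
  "left r p i \<longleftrightarrow> \<not> hit (vector_of r p) (r mod k ^ 4) (row r + i)"

definition right :: "nat \<Rightarrow> nat \<Rightarrow> nat \<Rightarrow> bool" where
  "right r p j \<longleftrightarrow> Vp (vector_of r p) (col r + j)"

text \<open>
  Counting all executions of \<open>block_code\<close>, phase \<open>p\<close> of instance \<open>r\<close> takes place at time
  \<open>vector_of r p * k ^ 4 + r mod k ^ 4\<close>.
\<close>

definition todo :: "nat \<Rightarrow> nat \<Rightarrow> act list" where
  "todo \<tau> r = concat (map (\<lambda>p. phase dec k (block r) p (left r p) (right r p))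
     (filter (\<lambda>p. \<tau> \<le> vector_of r p * k ^ 4 + r mod k ^ 4) [0..<k]))"

lemma kpos: "0 < k" "0 < k ^ 4"
  using k(1) by auto

text \<open>A point of time determines the vector \<open>c\<close> and the block \<open>q\<close> as
  quotient and remainder modulo \<open>k ^ 4\<close>, hence the only instance that acts
  then.\<close>

lemma todo_other:
  assumes "q < k ^ 4" "r \<noteq> c div k * k ^ 4 + q"
  shows "todo (Suc (c * k ^ 4 + q)) r = todo (c * k ^ 4 + q) r"
proof -
  have "vector_of r p * k ^ 4 + r mod k ^ 4 \<noteq> c * k ^ 4 + q" if "p < k" for p
  proof
    assume "vector_of r p * k ^ 4 + r mod k ^ 4 = c * k ^ 4 + q"
    then have "vector_of r p = c" "r mod k ^ 4 = q"
      using interleave_eq_iff[of "r mod k ^ 4" "k ^ 4" q] assms(1) kpos by simp_all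
    moreover have "c div k = r div k ^ 4" using calculation(1) that by (auto simp: vector_of_def)
    ultimately have "r = c div k * k ^ 4 + q" by (metis div_mult_mod_eq)
    with assms(2) show False ..
  qed
  then have "Suc (c * k ^ 4 + q) \<le> vector_of r p * k ^ 4 + r mod k ^ 4 \<longleftrightarrow>
      c * k ^ 4 + q \<le> vector_of r p * k ^ 4 + r mod k ^ 4" if "p < k" for p
    using that unfolding Suc_le_eq order.strict_iff_order by metis
  then show ?thesis unfolding todo_def
    by (intro arg_cong[where f = concat] map_cong filter_cong) simp_all
qed

lemma todo_this:
  assumes "q < k ^ 4" and r: "r = c div k * k ^ 4 + q" and p: "p = c mod k"
  shows "todo (c * k ^ 4 + q) r =
    phase dec k (block r) p (left r p) (right r p) @ todo (Suc (c * k ^ 4 + q)) r"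
proof -
  have rm: "r mod k ^ 4 = q" "r div k ^ 4 = c div k" using assms(1) r kpos by auto
  have pk: "p < k" using p kpos by simp
  have vec: "vector_of r p' = c div k * k + p'" for p' by (simp add: vector_of_def rm)
  have cc: "c = c div k * k + p" using p by simp
  have 1: "c * k ^ 4 + q \<le> vector_of r p' * k ^ 4 + r mod k ^ 4 \<longleftrightarrow> p \<le> p'" for p'
  proof -
    have "c * k ^ 4 \<le> vector_of r p' * k ^ 4 \<longleftrightarrow> c \<le> vector_of r p'" using kpos by simp
    then show ?thesis using cc vec[of p'] rm by linarith
  qed
  have 2: "Suc (c * k ^ 4 + q) \<le> vector_of r p' * k ^ 4 + r mod k ^ 4 \<longleftrightarrow> Suc p \<le> p'" for p'
  proof -
    have "c * k ^ 4 < vector_of r p' * k ^ 4 \<longleftrightarrow> c < vector_of r p'" using kpos by simp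
    then show ?thesis using cc vec[of p'] rm by linarith
  qed
  show ?thesis unfolding todo_def 1 2
    using filter_upt_ge[of p k] filter_upt_ge[of "Suc p" k] pk by (simp add: upt_conv_Cons)
qed

lemma hit_Suc:
  assumes "q < k ^ 4" and r: "r = c div k * k ^ 4 + q"
  shows "hit c (Suc q) x \<longleftrightarrow> hit c q x \<or>
    (\<exists>i<k. x = row r + i \<and> (\<exists>j<k. Mp x (col r + j) \<and> Vp c (col r + j)))"
proof -
  have rm: "r mod k ^ 4 = q" using assms by auto
  have "q div k ^ 2 = x div k \<longleftrightarrow> (\<exists>i<k. x = row r + i)"
  proof
    assume "q div k ^ 2 = x div k"
    then show "\<exists>i<k. x = row r + i"
      using kpos by (intro exI[of _ "x mod k"]) (simp add: row_def rm)
  next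
    assume "\<exists>i<k. x = row r + i"
    then show "q div k ^ 2 = x div k" using kpos by (auto simp: row_def rm)
  qed
  then show ?thesis unfolding hit_def less_Suc_eq col_def rm by blast
qed

text \<open>The phase of the selected instance is consumed in three pieces, with \<open>?T1\<close>
  and \<open>?T2\<close> as intermediate lists; by \<open>todo_other\<close> all other lists are
  already those of the next point of time.\<close>

lemma steps_block_code:
  assumes c: "c < k ^ 3" and q: "q < k ^ 4" and r: "r = c div k * k ^ 4 + q" and p: "p = c mod k"
    and ready: "rdy (todo (c * k ^ 4 + q)) \<psi> s" and g: "globals s"
    and s: "s 2 = (\<lambda>j. of_bool (Vp c j))" "s 3 = (\<lambda>x. of_bool (hit c q x))"
      "s 11 0 = c" "s 15 0 = p" "s 10 0 = q"
    and b: "b \<longleftrightarrow> hits k (block r) (left r p) (right r p)"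
  shows "steps W (block_code dec upd qry) s \<psi> (2000 * k + (if b then 100 * k ^ 2 else 0))
    (\<lambda>\<psi>' s'. rdy (todo (Suc (c * k ^ 4 + q))) \<psi>' s' \<and> keeps {3, 6, 7, 8, 9, 12, 13, 14, 16, 17} s s' \<and>
      s' 3 = (\<lambda>x. of_bool (hit c (Suc q) x)))"
proof -
  have pk: "p < k" using p kpos by simp
  have "c div k < k ^ 2" using c by (intro less_mult_imp_div_less) (simp flip: power_Suc2)
  from interleave_less[OF this q] have rk: "r < k ^ 6" unfolding r by (simp flip: power_add)
  have rm: "r mod k ^ 4 = q" "r div k ^ 4 = c div k" using q r kpos by auto
  have vec: "vector_of r p = c" using p by (simp add: vector_of_def rm)
  let ?\<tau> = "c * k ^ 4 + q" and ?S = "answers k (threshold dec k p) b"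
  let ?A = "{6, 7, 8, 9, 12, 16, 17} :: nat set"
  let ?pre = "map (upd_pair k) (pre_list dec k p (left r p) (right r p))"
  let ?post = "map (upd_pair k) (post_list dec k p (left r p) (right r p))"
  let ?as = "todo (Suc ?\<tau>) r"
  have todo: "todo ?\<tau> r = ?pre @ Ask ?S # ?post @ ?as"
    using todo_this[OF q r p] b by (simp add: phase_def)
  have todo': "(todo ?\<tau>)(r := ?as) = todo (Suc ?\<tau>)"
    using todo_other[OF q] r by (auto simp: fun_eq_iff)
  have env: "globals s'" "s' 15 0 = p" "s' 2 = s 2" "s' 3 = s 3"
      "\<And>i. i < k \<Longrightarrow> s' 3 (row r + i) = of_bool (\<not> left r p i)"
      "\<And>j. j < k \<Longrightarrow> s' 2 (col r + j) = of_bool (right r p j)"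
    if "keeps ?A s s'" for s'
    using globals_keeps[OF g that] that s
    by (simp_all add: keeps_def left_def right_def vec rm)
  let ?e = "Bin Add (Bin Mul (Bin Div (var 11) (var 4)) (power_expr 4)) (var 10)"
  have 1: "steps W (select ?e) s \<psi> (cost ?e + 60) (\<lambda>\<psi>' s'. rdy (todo ?\<tau>) \<psi>' s' \<and> keeps ?A s s' \<and> at_block r s')"
  proof (rule steps_mono[OF steps_select[OF g] order.refl])
    have less: "c div k * k ^ 4 < W" "k < W" "c < W" "q < W" "c div k < W" "r < W" "0 < W"
      using rk small[of r] small[of "c div k * k ^ 4"] small[of c] small[of q] c q r powers_le R_less
        small[of "c div k"] small[of k] div_le_dividend[of c k]
      by linarith+
    show "fits W ?e s" using g fits_power[OF g, of 4] less s r by (auto simp: globals_def val_power[OF g])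
    show "val ?e s = r" using g s r by (auto simp: globals_def val_power[OF g])
    fix \<psi>' s' assume "\<psi>' = \<psi> \<and> keeps {6, 16, 17} s s' \<and> at_block r s' \<and> (\<forall>a\<ge>20. s' a = s a)"
    then show "rdy (todo ?\<tau>) \<psi>' s' \<and> keeps ?A s s' \<and> at_block r s'"
      using rdy_keeps[OF ready] by (auto simp: keeps_def)
  qed
  let ?T1 = "(todo ?\<tau>)(r := Ask ?S # ?post @ ?as)"
  let ?T2 = "(todo ?\<tau>)(r := ?post @ ?as)"
  have 2: "steps W (pre_code dec upd) s' \<psi>' (600 * k) (\<lambda>\<psi>' s'. rdy ?T1 \<psi>' s' \<and> keeps ?A s s' \<and> at_block r s')"
    if s': "rdy (todo ?\<tau>) \<psi>' s' \<and> keeps ?A s s' \<and> at_block r s'" for \<psi>' s'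
  proof -
    have k': "keeps ?A s s'" using s' by blast
    have "steps W (pre_code dec upd) s' \<psi>' (600 * k) (\<lambda>\<psi>' s''. rdy ?T1 \<psi>' s'' \<and> keeps {7, 8, 9} s' s'')"
      by (rule steps_pre_code[where p = p and u = "left r p" and v = "right r p"])
        (use s' todo rk pk env[OF k'] in blast)+
    then show ?thesis
      by (rule steps_mono) (use s' in \<open>auto simp: keeps_def at_block_def\<close>)
  qed
  have 3: "steps W (call_query qry) s' \<psi>' 60 (\<lambda>\<psi>' s'. rdy ?T2 \<psi>' s' \<and> keeps ?A s s' \<and> at_block r s' \<and> s' 12 0 \<in> ?S)"
    if s': "rdy ?T1 \<psi>' s' \<and> keeps ?A s s' \<and> at_block r s'" for \<psi>' s'
  proof -
    have "steps W (call_query qry) s' \<psi>' 60 (\<lambda>\<psi>' s''. rdy (?T1(r := ?post @ ?as)) \<psi>' s'' \<and>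
        (\<forall>a<20. a \<noteq> 12 \<longrightarrow> s'' a = s' a) \<and> s'' 12 0 \<in> ?S)"
    proof (rule steps_call_query[where m = m and qry = qry and S = ?S and R = "64 * k ^ 6" and I = "k ^ 6"])
      show "rdy ?T1 \<psi>' s'" using s' by blast
      show "s' 5 0 = 64 * k ^ 6" using env(1)[of s'] s' by (simp add: globals_def)
      show "s' 6 0 = r" using s' by (simp add: at_block_def)
      fix a assume "a \<in> ?S"
      then have "a \<le> 8 * k" by (simp add: answers_def)
      then show "a < W" using powers_le by (intro small) linarith
    qed (use rk I capacity in simp_all)
    then show ?thesis
      by (rule steps_mono) (use s' in \<open>auto simp: keeps_def at_block_def\<close>)
  qed
  have 4: "steps W (post_code dec upd) s' \<psi>' (300 * k)
      (\<lambda>\<psi>' s'. rdy (todo (Suc ?\<tau>)) \<psi>' s' \<and> keeps ?A s s' \<and> at_block r s' \<and> s' 12 0 \<in> ?S)"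
    if s': "rdy ?T2 \<psi>' s' \<and> keeps ?A s s' \<and> at_block r s' \<and> s' 12 0 \<in> ?S" for \<psi>' s'
  proof -
    have k': "keeps ?A s s'" using s' by blast
    have "steps W (post_code dec upd) s' \<psi>' (300 * k) (\<lambda>\<psi>' s''. rdy (?T2(r := ?as)) \<psi>' s'' \<and> keeps {7, 8, 9} s' s'')"
    proof (rule steps_post_code[where p = p and u = "left r p" and v = "right r p"])
      show "?T2 r = ?post @ ?as" by simp
    qed (use s' rk pk env[OF k'] in blast)+
    then show ?thesis
      by (rule steps_mono) (use s' todo' in \<open>auto simp: keeps_def at_block_def\<close>)
  qed
  have 5: "steps W (search dec) s' \<psi>' (30 + (if b then 100 * k ^ 2 else 0))
    (\<lambda>\<psi>' s'. rdy (todo (Suc ?\<tau>)) \<psi>' s' \<and> keeps {3, 6, 7, 8, 9, 12, 13, 14, 16, 17} s s' \<and>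
      s' 3 = (\<lambda>x. of_bool (hit c (Suc q) x)))"
    if s': "rdy (todo (Suc ?\<tau>)) \<psi>' s' \<and> keeps ?A s s' \<and> at_block r s' \<and> s' 12 0 \<in> ?S" for \<psi>' s'
  proof -
    have k': "keeps ?A s s'" using s' by blast
    have b': "b \<longleftrightarrow> hits k (\<lambda>i j. Mp (row r + i) (col r + j)) (\<lambda>i. \<not> hit c q (row r + i)) (\<lambda>j. Vp c (col r + j))"
      unfolding b block_def left_def right_def vec rm ..
    show ?thesis
    proof (rule steps_mono[OF steps_search[where hit = "hit c q" and v = "Vp c" and p = p and b = b and r = r] order.refl])
      show "b \<longleftrightarrow> hits k (\<lambda>i j. Mp (row r + i) (col r + j)) (\<lambda>i. \<not> hit c q (row r + i)) (\<lambda>j. Vp c (col r + j))"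
        by (rule b')
      show "globals s'" "s' 15 0 = p" "p < k" using env(1,2)[OF k'] pk by blast+
      show "s' 3 = (\<lambda>x. of_bool (hit c q x))" "s' 2 = (\<lambda>j. of_bool (Vp c j))"
        using env(3,4)[OF k'] s by simp_all
      show "at_block r s'" "s' 12 0 \<in> ?S" using s' by blast+
      fix \<psi>'' s'' assume s'': "\<psi>'' = \<psi>' \<and> keeps {3, 13, 14} s' s'' \<and> (\<forall>a\<ge>20. s'' a = s' a) \<and>
        s'' 3 = (\<lambda>x. of_bool (hit c q x \<or> (\<exists>i<k. x = row r + i \<and> (\<exists>j<k. Mp x (col r + j) \<and> Vp c (col r + j)))))"
      have "rdy (todo (Suc ?\<tau>)) \<psi>'' s''"
        using rdy_keeps[OF conjunct1[OF s'], of s''] s'' by simp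
      moreover have "keeps {3, 6, 7, 8, 9, 12, 13, 14, 16, 17} s s''"
        using k' s'' by (auto simp: keeps_def)
      ultimately show "rdy (todo (Suc ?\<tau>)) \<psi>'' s'' \<and> keeps {3, 6, 7, 8, 9, 12, 13, 14, 16, 17} s s'' \<and>
          s'' 3 = (\<lambda>x. of_bool (hit c (Suc q) x))"
        using s'' unfolding hit_Suc[OF q r] by blast
    qed
  qed
  have 34: "steps W (Seq (post_code dec upd) (search dec)) s' \<psi>' (300 * k + (30 + (if b then 100 * k ^ 2 else 0)))
    (\<lambda>\<psi>' s'. rdy (todo (Suc ?\<tau>)) \<psi>' s' \<and> keeps {3, 6, 7, 8, 9, 12, 13, 14, 16, 17} s s' \<and>
      s' 3 = (\<lambda>x. of_bool (hit c (Suc q) x)))"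
    if "rdy ?T2 \<psi>' s' \<and> keeps ?A s s' \<and> at_block r s' \<and> s' 12 0 \<in> ?S" for \<psi>' s'
    by (rule steps_SeqI[OF 4[OF that]]) (rule 5)
  have 24: "steps W (Seq (call_query qry) (Seq (post_code dec upd) (search dec))) s' \<psi>'
      (60 + (300 * k + (30 + (if b then 100 * k ^ 2 else 0))))
    (\<lambda>\<psi>' s'. rdy (todo (Suc ?\<tau>)) \<psi>' s' \<and> keeps {3, 6, 7, 8, 9, 12, 13, 14, 16, 17} s s' \<and>
      s' 3 = (\<lambda>x. of_bool (hit c (Suc q) x)))"
    if "rdy ?T1 \<psi>' s' \<and> keeps ?A s s' \<and> at_block r s'" for \<psi>' s'
    by (rule steps_SeqI[OF 3[OF that]]) (rule 34)
  have 14: "steps W (Seq (pre_code dec upd) (Seq (call_query qry) (Seq (post_code dec upd) (search dec)))) s' \<psi>'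
      (600 * k + (60 + (300 * k + (30 + (if b then 100 * k ^ 2 else 0)))))
    (\<lambda>\<psi>' s'. rdy (todo (Suc ?\<tau>)) \<psi>' s' \<and> keeps {3, 6, 7, 8, 9, 12, 13, 14, 16, 17} s s' \<and>
      s' 3 = (\<lambda>x. of_bool (hit c (Suc q) x)))"
    if "rdy (todo ?\<tau>) \<psi>' s' \<and> keeps ?A s s' \<and> at_block r s'" for \<psi>' s'
    by (rule steps_SeqI[OF 2[OF that]]) (rule 24)
  have "steps W (block_code dec upd qry) s \<psi>
      (cost ?e + 60 + (600 * k + (60 + (300 * k + (30 + (if b then 100 * k ^ 2 else 0))))))
    (\<lambda>\<psi>' s'. rdy (todo (Suc ?\<tau>)) \<psi>' s' \<and> keeps {3, 6, 7, 8, 9, 12, 13, 14, 16, 17} s s' \<and>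
      s' 3 = (\<lambda>x. of_bool (hit c (Suc q) x)))"
    unfolding block_code_def by (rule steps_SeqI[OF 1]) (rule 14)
  then show ?thesis
    by (rule steps_mono) (use k(1) in \<open>auto simp: cost_power_expr\<close>)
qed


lemma hit_all:
  assumes "x < n"
  shows "hit c (k ^ 4) x \<longleftrightarrow> bool_mat_vec n M (V c) x"
proof
  assume "hit c (k ^ 4) x"
  then show "bool_mat_vec n M (V c) x"
    by (auto simp: hit_def Mp_def Vp_def bool_mat_vec_def)
next
  assume "bool_mat_vec n M (V c) x"
  then obtain j where j: "j < n" "M x j" "V c j" by (auto simp: bool_mat_vec_def)
  have "x < k ^ 2 * k" "j < k ^ 2 * k" using assms j(1) k(2) by (simp_all flip: power_Suc2)
  then have xy: "x div k < k ^ 2" "j div k < k ^ 2" by (auto intro: less_mult_imp_div_less)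
  \<comment> \<open>The block that contains entry \<open>(x, j)\<close>, in the row-by-row numbering
    of blocks.\<close>
  have "x div k * k ^ 2 + j div k < k ^ 4" using interleave_less[OF xy] by (simp flip: power_add)
  moreover have "(x div k * k ^ 2 + j div k) div k ^ 2 = x div k" "(x div k * k ^ 2 + j div k) mod k ^ 2 = j div k"
    using xy by (simp_all add: div_mult_self3 kpos)
  moreover have "Mp x (j div k * k + j mod k)" "Vp c (j div k * k + j mod k)" "j mod k < k"
    using assms j kpos by (auto simp: Mp_def Vp_def)
  ultimately show "hit c (k ^ 4) x" unfolding hit_def by metis
qed

lemma hit_0: "\<not> hit c 0 x"
  by (simp add: hit_def)

text \<open>The loop clears only finitely many cells. The rest of bank 3 stays zero throughout,
  since \<open>Mp\<close> confines marks to rows below \<open>n\<close>, which is at most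
  \<open>k ^ 3\<close>.\<close>

lemma steps_clear:
  assumes g: "globals s" and zero: "\<And>x. k ^ 3 \<le> x \<Longrightarrow> s 3 x = 0"
  shows "steps W (count_loop 10 (power_expr 3) (Put 3 (var 10) (Const 0))) s \<psi>
      (k ^ 3 * (4 + cost (power_expr 3) + 10) + cost (power_expr 3) + 7)
    (\<lambda>\<psi>' s'. \<psi>' = \<psi> \<and> keeps {3, 10} s s' \<and> (\<forall>a\<ge>20. s' a = s a) \<and> s' 3 = (\<lambda>_. 0))"
proof -
  let ?I = "\<lambda>j \<psi>' s'. \<psi>' = \<psi> \<and> keeps {3, 10} s s' \<and> (\<forall>a\<ge>20. s' a = s a) \<and> s' 10 0 = j \<and>
    (\<forall>x. x < j \<or> k ^ 3 \<le> x \<longrightarrow> s' 3 x = 0)"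
  have "steps W (count_loop 10 (power_expr 3) (Put 3 (var 10) (Const 0))) s \<psi>
      (k ^ 3 * (4 + cost (power_expr 3) + 10) + cost (power_expr 3) + 7) (?I (k ^ 3))"
  proof (rule steps_count_loop[where I = ?I])
    show "?I 0 \<psi> (s(10 := (s 10)(0 := 0)))" using zero by (auto simp: keeps_def)
    show "s' 10 0 = j \<and> fits W (power_expr 3) s' \<and> val (power_expr 3) s' = k ^ 3" if I: "?I j \<psi>' s'" for j \<psi>' s'
    proof -
      have "keeps {3, 10} s s'" using I by blast
      then have "globals s'" by (rule globals_keeps[OF g]) simp
      then show ?thesis using fits_power val_power I by simp
    qed
    fix j \<psi>' s' assume j: "j < k ^ 3" and I: "?I j \<psi>' s'"
    have "j < W" "0 < W" using j powers_le small[of j] R_less by linarith+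
    let ?Q = "\<lambda>\<psi>' s'. s' 10 0 = j \<and> ?I (Suc j) \<psi>' (s'(10 := (s' 10)(0 := Suc j)))"
    show "steps W (Put 3 (var 10) (Const 0)) s' \<psi>' 4 ?Q"
      by (rule steps_mono[OF steps_Put[where Q = ?Q]])
        (use I \<open>j < W\<close> \<open>0 < W\<close> in \<open>auto simp: keeps_def less_Suc_eq\<close>)
  qed (use power_small[of 3] R_less in auto)
  then show ?thesis by (rule steps_mono) (auto simp: fun_eq_iff not_less[symmetric])
qed

definition unhit :: "nat \<Rightarrow> nat \<Rightarrow> nat" where
  "unhit c q = card {x. x < k ^ 3 \<and> \<not> hit c q x}"

text \<open>If \<open>b\<close> holds, at least one unmarked row becomes marked; the
  \<open>100 * k ^ 2\<close> reserved for it pay for the search of this block.\<close>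

lemma unhit_Suc:
  assumes "q < k ^ 4" and r: "r = c div k * k ^ 4 + q" and p: "p = c mod k"
    and b: "b \<longleftrightarrow> hits k (block r) (left r p) (right r p)"
  shows "100 * k ^ 2 * unhit c (Suc q) + (if b then 100 * k ^ 2 else 0) \<le> 100 * k ^ 2 * unhit c q"
proof -
  have rm: "r mod k ^ 4 = q" "r div k ^ 4 = c div k" using assms(1) r kpos by auto
  have vec: "vector_of r p = c" using p by (simp add: vector_of_def rm)
  have sub: "{x. x < k ^ 3 \<and> \<not> hit c (Suc q) x} \<subseteq> {x. x < k ^ 3 \<and> \<not> hit c q x}"
    using hit_Suc[OF assms(1) r] by auto
  have "unhit c (Suc q) + (if b then 1 else 0) \<le> unhit c q"
  proof (cases b)
    case True
    then obtain i j where ij: "i < k" "j < k" "Mp (row r + i) (col r + j)" "Vp c (col r + j)" "\<not> hit c q (row r + i)"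
      unfolding b block_def left_def right_def vec rm by blast
    then have "hit c (Suc q) (row r + i)" "row r + i < k ^ 3"
      using hit_Suc[OF assms(1) r] row_le[of r] by auto
    then have "{x. x < k ^ 3 \<and> \<not> hit c (Suc q) x} \<subset> {x. x < k ^ 3 \<and> \<not> hit c q x}"
      using sub ij(5) by blast
    then have "unhit c (Suc q) < unhit c q" unfolding unhit_def by (intro psubset_card_mono) auto
    then show ?thesis using True by simp
  next
    case False
    then show ?thesis using sub unfolding unhit_def by (auto intro: card_mono)
  qed
  then have "100 * k ^ 2 * (unhit c (Suc q) + (if b then 1 else 0)) \<le> 100 * k ^ 2 * unhit c q"
    by (intro mult_left_mono) auto
  then show ?thesis by (simp add: algebra_simps split: if_splits)
qed

text \<open>At most \<open>k ^ 3\<close> searches at \<open>100 * k ^ 2\<close> and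
  \<open>k ^ 4\<close> blocks at \<open>2000 * k\<close> are both of order \<open>k ^ 5\<close>,
  which makes \<open>k ^ 8\<close> for all vectors.\<close>

lemma steps_multiply:
  assumes c: "c < n" and ready: "rdy (todo (c * k ^ 4)) \<psi> s" and g: "globals s"
    and s: "s 2 = (\<lambda>j. of_bool (Vp c j))" "s 11 0 = c" "\<And>x. k ^ 3 \<le> x \<Longrightarrow> s 3 x = 0"
  shows "steps W (multiply dec upd qry) s \<psi> (3000 * k ^ 5)
    (\<lambda>\<psi>' s'. rdy (todo (Suc c * k ^ 4)) \<psi>' s' \<and> globals s' \<and> s' 11 0 = Suc c \<and>
      s' 3 = (\<lambda>x. of_bool (hit c (k ^ 4) x)))"
proof -
  have ck: "c < k ^ 3" using c k(2) by simp
  have less: "c < W" "Suc c < W" "k < W" "0 < W" "1 < W"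
    using ck powers_le small[of c] small[of "Suc c"] small[of k] R_less k(1) by linarith+
  define p where "p = c mod k"
  let ?J = "\<lambda>\<psi> s'. rdy (todo (c * k ^ 4)) \<psi> s' \<and> globals s' \<and> s' 2 = (\<lambda>j. of_bool (Vp c j)) \<and>
    s' 3 = (\<lambda>_. 0) \<and> s' 11 0 = c"
  have 1: "steps W (count_loop 10 (power_expr 3) (Put 3 (var 10) (Const 0))) s \<psi>
      (k ^ 3 * (4 + cost (power_expr 3) + 10) + cost (power_expr 3) + 7) ?J"
  proof (rule steps_mono[OF steps_clear[OF g s(3)] order.refl])
    fix \<psi>' s' assume s': "\<psi>' = \<psi> \<and> keeps {3, 10} s s' \<and> (\<forall>a\<ge>20. s' a = s a) \<and> s' 3 = (\<lambda>_. 0)"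
    then have "keeps {3, 10} s s'" by blast
    then have "globals s'" "s' 2 = s 2" "s' 11 = s 11" using globals_keeps[OF g, of "{3, 10}"] by (auto simp: keepsD)
    then show "?J \<psi>' s'" using s' s rdy_keeps[OF ready, of s'] by simp
  qed
  \<comment> \<open>The potential \<open>\<phi>\<close> splits into \<open>\<psi>\<close> for the
    simulated runs and a reserve for each row not yet found.\<close>
  let ?I = "\<lambda>q \<phi> s'. \<exists>\<psi>. rdy (todo (c * k ^ 4 + q)) \<psi> s' \<and> \<psi> + 100 * k ^ 2 * unhit c q \<le> \<phi> \<and> globals s' \<and>
    s' 2 = (\<lambda>j. of_bool (Vp c j)) \<and> s' 3 = (\<lambda>x. of_bool (hit c q x)) \<and> s' 11 0 = c \<and> s' 15 0 = p \<and> s' 10 0 = q"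
  have loop: "steps W (count_loop 10 (power_expr 4) (block_code dec upd qry)) s' \<phi>
      (k ^ 4 * (2000 * k + cost (power_expr 4) + 10) + cost (power_expr 4) + 7) (?I (k ^ 4))"
    if init: "?I 0 \<phi> (s'(10 := (s' 10)(0 := 0)))" for \<phi> s'
  proof (rule steps_count_loop[where I = ?I, OF init])
    show "s' 10 0 = q \<and> fits W (power_expr 4) s' \<and> val (power_expr 4) s' = k ^ 4" if "?I q \<phi> s'" for q \<phi> s'
      using that fits_power[of s' 4] val_power[of s' 4] by auto
    fix q \<phi> s' assume q: "q < k ^ 4" and "?I q \<phi> s'"
    then obtain \<psi> where I: "rdy (todo (c * k ^ 4 + q)) \<psi> s'" "\<psi> + 100 * k ^ 2 * unhit c q \<le> \<phi>" "globals s'"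
      "s' 2 = (\<lambda>j. of_bool (Vp c j))" "s' 3 = (\<lambda>x. of_bool (hit c q x))" "s' 11 0 = c" "s' 15 0 = p" "s' 10 0 = q"
      by blast
    define r where "r = c div k * k ^ 4 + q"
    define b where "b \<longleftrightarrow> hits k (block r) (left r p) (right r p)"
    show "steps W (block_code dec upd qry) s' \<phi> (2000 * k)
        (\<lambda>\<phi>' s'. s' 10 0 = q \<and> ?I (Suc q) \<phi>' (s'(10 := (s' 10)(0 := Suc q))))"
    proof (rule steps_transfer[OF steps_block_code[OF ck q r_def p_def I(1,3-8) b_def] I(2) unhit_Suc[OF q r_def p_def b_def]])
      fix \<psi>' s'' assume s'': "rdy (todo (Suc (c * k ^ 4 + q))) \<psi>' s'' \<and>
        keeps {3, 6, 7, 8, 9, 12, 13, 14, 16, 17} s' s'' \<and> s'' 3 = (\<lambda>x. of_bool (hit c (Suc q) x))"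
      then have keeps: "keeps {3, 6, 7, 8, 9, 12, 13, 14, 16, 17} s' s''" by blast
      let ?s = "s''(10 := (s'' 10)(0 := Suc q))"
      have "globals s''" by (rule globals_keeps[OF I(3) keeps]) simp
      then have "globals ?s" by (simp add: globals_def)
      moreover have "rdy (todo (c * k ^ 4 + Suc q)) \<psi>' ?s"
        using s'' rdy_keeps[of _ \<psi>' s'' ?s] by simp
      ultimately have "?I (Suc q) (\<psi>' + 100 * k ^ 2 * unhit c (Suc q)) ?s"
        using s'' I keepsD[OF keeps] by (intro exI[of _ \<psi>']) simp
      then show "s'' 10 0 = q \<and> ?I (Suc q) (\<psi>' + 100 * k ^ 2 * unhit c (Suc q)) ?s"
        using keepsD[OF keeps, of 10] I(8) by simp
    qed
  qed (use power_small[of 4] less in auto)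
  have un: "unhit c 0 \<le> k ^ 3"
    unfolding unhit_def by (simp add: hit_0)
  have 2: "steps W (Seq (assign 15 (Bin Mod (var 11) (var 4)))
     (Seq (count_loop 10 (power_expr 4) (block_code dec upd qry)) (assign 11 (Bin Add (var 11) (Const 1))))) s' \<psi>'
     (100 * k ^ 2 * k ^ 3 + (7 + ((k ^ 4 * (2000 * k + cost (power_expr 4) + 10) + cost (power_expr 4) + 7) + 6)))
    (\<lambda>\<psi>' s'. rdy (todo (Suc c * k ^ 4)) \<psi>' s' \<and> globals s' \<and> s' 11 0 = Suc c \<and>
      s' 3 = (\<lambda>x. of_bool (hit c (k ^ 4) x)))" (is "steps W ?c s' \<psi>' ?T ?Q")
    if J: "?J \<psi>' s'" for \<psi>' s'
  proof -
    let ?\<phi> = "\<psi>' + 100 * k ^ 2 * k ^ 3"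
    have reg: "s' 4 0 = k" "s' 11 0 = c" using J by (auto simp: globals_def)
    let ?s = "s'(15 := (s' 15)(0 := p))"
    have "steps W (Seq (count_loop 10 (power_expr 4) (block_code dec upd qry)) (assign 11 (Bin Add (var 11) (Const 1)))) ?s ?\<phi>
        ((k ^ 4 * (2000 * k + cost (power_expr 4) + 10) + cost (power_expr 4) + 7) + 6) ?Q"
    proof (rule steps_SeqI[OF loop])
      let ?s' = "?s(10 := (?s 10)(0 := 0))"
      have "rdy (todo (c * k ^ 4)) \<psi>' ?s'" using rdy_keeps[OF conjunct1[OF J], of ?s'] by simp
      moreover have "\<psi>' + 100 * k ^ 2 * unhit c 0 \<le> ?\<phi>" using un by simp
      moreover have "globals ?s'" using J by (simp add: globals_def)
      ultimately show "?I 0 ?\<phi> ?s'" using J by (intro exI[of _ \<psi>']) (simp add: hit_0)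
      fix \<phi>' s'' assume "?I (k ^ 4) \<phi>' s''"
      then obtain \<psi>'' where I: "rdy (todo (c * k ^ 4 + k ^ 4)) \<psi>'' s''" "\<psi>'' + 100 * k ^ 2 * unhit c (k ^ 4) \<le> \<phi>'"
        "globals s''" "s'' 3 = (\<lambda>x. of_bool (hit c (k ^ 4) x))" "s'' 11 0 = c" by blast
      let ?s'' = "s''(11 := (s'' 11)(0 := Suc c))"
      have "rdy (todo (Suc c * k ^ 4)) \<phi>' ?s''"
        using ready_cong[OF I(1), of ?s'' \<phi>'] I(2) by (simp add: add.commute)
      then have "?Q \<phi>' ?s''" using I(3-5) by (simp add: globals_def)
      then show "steps W (assign 11 (Bin Add (var 11) (Const 1))) s'' \<phi>' 6 ?Q"
        using I(5) less by (intro steps_mono[OF steps_assign[where Q = ?Q]]) auto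
    qed
    then have "steps W ?c s' ?\<phi> (cost (Bin Mod (var 11) (var 4)) + 2 + ((k ^ 4 * (2000 * k + cost (power_expr 4) + 10) +
        cost (power_expr 4) + 7) + 6)) ?Q"
      using reg less unfolding p_def
      by (intro steps_assign_Seq) (auto simp: mod_less_eq_dividend[THEN le_less_trans])
    then have "steps W ?c s' ?\<phi> (7 + ((k ^ 4 * (2000 * k + cost (power_expr 4) + 10) +
        cost (power_expr 4) + 7) + 6)) ?Q" by simp
    then show ?thesis by (rule steps_pot)
  qed
  have "steps W (multiply dec upd qry) s \<psi> ((k ^ 3 * (4 + cost (power_expr 3) + 10) + cost (power_expr 3) + 7) +
     (100 * k ^ 2 * k ^ 3 + (7 + ((k ^ 4 * (2000 * k + cost (power_expr 4) + 10) + cost (power_expr 4) + 7) + 6)))) ?Q"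
    unfolding multiply_def by (rule steps_SeqI[OF 1]) (rule 2)
  then show ?thesis
  proof (rule steps_mono)
    have "k ^ 2 * k ^ 3 = k ^ 5" "k ^ 4 * k = k ^ 5" by (simp_all flip: power_add power_Suc2)
    then have "(k ^ 3 * (4 + cost (power_expr 3) + 10) + cost (power_expr 3) + 7) +
     (100 * k ^ 2 * k ^ 3 + (7 + ((k ^ 4 * (2000 * k + cost (power_expr 4) + 10) + cost (power_expr 4) + 7) + 6)))
     = 24 * k ^ 3 + 23 * k ^ 4 + 2100 * k ^ 5 + 50"
      by (simp add: cost_power_expr algebra_simps)
    also have "\<dots> \<le> 3000 * k ^ 5" using powers_le k(1) by linarith
    finally show "(k ^ 3 * (4 + cost (power_expr 3) + 10) + cost (power_expr 3) + 7) +
     (100 * k ^ 2 * k ^ 3 + (7 + ((k ^ 4 * (2000 * k + cost (power_expr 4) + 10) + cost (power_expr 4) + 7) + 6)))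
     \<le> 3000 * k ^ 5" .
  qed
qed

text \<open>Between calls the program carries along the vector count in register 11, the zero tail
  of bank 3 and the instances. Delivering a vector writes bank 2 only, so all of this
  survives.\<close>

lemma serves_vectors:
  assumes "rdy (todo (c * k ^ 4)) \<psi> s" "globals s" "s 11 0 = c" "\<And>x. k ^ 3 \<le> x \<Longrightarrow> s 3 x = 0"
    "c + length vs \<le> n" "\<And>i. i < length vs \<Longrightarrow> V (c + i) = vs ! i"
  shows "\<exists>t. omv_serves W (multiply dec upd qry) n M vs s t \<and> t \<le> \<psi> + length vs * (3000 * k ^ 5)"
  using assms
proof (induction vs arbitrary: c \<psi> s)
  case Nil
  then show ?case using omv_serves.Nil by fastforce
next
  case (Cons v vs)
  have v: "v = V c" using Cons.prems(6)[of 0] by simp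
  let ?s = "put_vec n v s"
  have "rdy (todo (c * k ^ 4)) \<psi> ?s" using rdy_keeps[OF Cons.prems(1), of ?s] by (simp add: put_vec_def)
  moreover have "?s 2 = (\<lambda>j. of_bool (Vp c j))" by (simp add: put_vec_def v Vp_def)
  moreover have "globals ?s" "?s 11 0 = c" "\<And>x. k ^ 3 \<le> x \<Longrightarrow> ?s 3 x = 0"
    using Cons.prems(2-4) by (simp_all add: put_vec_def globals_def)
  ultimately obtain t s' \<psi>' where run: "run W (multiply dec upd qry) ?s t s'" "t + \<psi>' \<le> \<psi> + 3000 * k ^ 5"
    "rdy (todo (Suc c * k ^ 4)) \<psi>' s'" "globals s'" "s' 11 0 = Suc c" "s' 3 = (\<lambda>x. of_bool (hit c (k ^ 4) x))"
    using steps_multiply[of c \<psi> ?s] Cons.prems(5) unfolding steps_def by auto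
  have "s' 3 x = 0" if "k ^ 3 \<le> x" for x
    using that k(2) by (auto simp: run(6) hit_def Mp_def)
  then obtain t' where t': "omv_serves W (multiply dec upd qry) n M vs s' t'" "t' \<le> \<psi>' + length vs * (3000 * k ^ 5)"
    using Cons.IH[of "Suc c" \<psi>' s'] run(3-5) Cons.prems(5) Cons.prems(6)[of "Suc i" for i] by auto
  have "omv_serves W (multiply dec upd qry) n M (v # vs) s (t + t')"
    by (rule omv_serves.Cons[OF run(1) _ t'(1)]) (simp add: run(6) hit_all v)
  then show ?case using run(2) t'(2) by (intro exI[of _ "t + t'"]) auto
qed

end

section \<open>Preprocessing: block size, parameters and base graphs\<close>

definition start_mem :: "bool \<Rightarrow> nat \<Rightarrow> mem" where
  "start_mem dec k = (\<lambda>a i. if a = 0 \<and> i = 0 then 8 * k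
     else if a = 0 \<and> i = 1 then (if dec then 4 else 0) * k else 0)"

context reduction begin

lemma steps_find_k:
  assumes least: "\<And>j. 1 \<le> j \<Longrightarrow> j < k \<Longrightarrow> j ^ 3 < n"
  shows "steps W (Seq (assign 4 (Const 1))
       (While (Bin Less (power_expr 3) (var 0)) (assign 4 (Bin Add (var 4) (Const 1))))) (omv_start n M) \<phi> (40 * k)
    (\<lambda>\<phi>' s'. \<phi>' = \<phi> \<and> s' = (omv_start n M)(4 := (\<lambda>_. 0)(0 := k)))"
proof -
  let ?s = "\<lambda>j. (omv_start n M)(4 := (\<lambda>_. 0)(0 := j))"
  let ?I = "\<lambda>j \<phi>' s'. 1 \<le> j \<and> \<phi>' = \<phi> \<and> s' = ?s j"
  let ?e = "Bin Less (power_expr 3) (var 0)"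
  have nW: "n < W" using k(2) power_small[of 3] by simp
  have fits: "fits W ?e (?s j)" if "1 \<le> j" "j \<le> k" for j
  proof -
    have "j ^ 3 \<le> k ^ 3" using that(2) by (intro power_mono) auto
    then have "j ^ 3 < W" using power_small[of 3] by linarith
    then have "fits W (power_expr 3) (?s j)" using that(1) by (intro fits_power_expr) auto
    then show ?thesis using nW R_less by (auto simp: omv_start_def)
  qed
  have val: "val ?e (?s j) = of_bool (j ^ 3 < n)" for j
    by (simp add: val_power_expr omv_start_def)
  have loop: "steps W (While ?e (assign 4 (Bin Add (var 4) (Const 1)))) (?s 1) \<phi>
      ((k - 1) * (6 + cost ?e + 1) + cost ?e + 1) (?I k)"
  proof (rule steps_While[where I = ?I and j = 1 and m = k])
    fix j \<phi>' s' assume j: "j < k" and I: "?I j \<phi>' s'"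
    then have "Suc j < W" "j < W" using small[of "Suc j"] powers_le by linarith+
    then have "steps W (assign 4 (Bin Add (var 4) (Const 1))) s' \<phi>' 6 (?I (Suc j))"
      using I R_less by (intro steps_mono[OF steps_assign[where Q = "?I (Suc j)"]]) auto
    then show "fits W ?e s' \<and> val ?e s' \<noteq> 0 \<and> steps W (assign 4 (Bin Add (var 4) (Const 1))) s' \<phi>' 6 (?I (Suc j))"
      using I j fits[of j] val[of j] least[of j] by (auto simp del: val.simps fits.simps)
  next
    show "fits W ?e s' \<and> val ?e s' = 0" if "?I k \<phi>' s'" for \<phi>' s'
      using that fits[of k] val[of k] k by (auto simp del: val.simps fits.simps)
  qed (use k(1) in auto)
  have "(omv_start n M)(4 := (omv_start n M 4)(0 := 1)) = ?s 1"
    by (auto simp: omv_start_def fun_eq_iff)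
  then have "steps W (Seq (assign 4 (Const 1)) (While ?e (assign 4 (Bin Add (var 4) (Const 1))))) (omv_start n M) \<phi>
      (cost (Const 1) + 2 + ((k - 1) * (6 + cost ?e + 1) + cost ?e + 1)) (?I k)"
    using loop R_less by (intro steps_assign_Seq) auto
  then show ?thesis
    by (rule steps_mono) (use k(1) in \<open>auto simp: cost_power_expr algebra_simps\<close>)
qed

lemma steps_parameters:
  assumes s: "globals s" and zero: "\<And>a. 20 \<le> a \<Longrightarrow> s a = (\<lambda>_. 0)"
  shows "steps W (count_loop 10 (power_expr 6) (Seq (Put 21 (var 10) (Bin Mul (Const 8) (var 4)))
       (Put 21 (Bin Add (var 5) (var 10)) (Bin Mul (Const (if dec then 4 else 0)) (var 4))))) s \<phi> (100 * k ^ 6)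
    (\<lambda>\<phi>' s'. \<phi>' = \<phi> \<and> keeps {10} s s' \<and> (\<forall>a\<ge>20. a \<noteq> 21 \<longrightarrow> s' a = (\<lambda>_. 0)) \<and>
      (\<forall>r<k ^ 6. view (64 * k ^ 6) r s' = start_mem dec k))"
proof -
  let ?R = "64 * k ^ 6" and ?d = "if dec then 4 else 0 :: nat"
  let ?I = "\<lambda>j \<phi>' s'. \<phi>' = \<phi> \<and> keeps {10} s s' \<and> (\<forall>a\<ge>20. a \<noteq> 21 \<longrightarrow> s' a = (\<lambda>_. 0)) \<and>
    s' 21 = (\<lambda>i. if i < j then 8 * k else if ?R \<le> i \<and> i < ?R + j then ?d * k else 0) \<and> s' 10 0 = j"
  let ?body = "Seq (Put 21 (var 10) (Bin Mul (Const 8) (var 4)))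
       (Put 21 (Bin Add (var 5) (var 10)) (Bin Mul (Const ?d) (var 4)))"
  \<comment> \<open>Cell 1 of bank 0 of an instance lies beyond \<open>64 * k ^ 6\<close>, outside
    the range of \<open>small\<close>; the capacity hypothesis has enough slack.\<close>
  have W2: "x \<le> 8 * k \<Longrightarrow> x < W" "x \<le> 65 * k ^ 6 \<Longrightarrow> x < W" for x
  proof -
    have "64 * k ^ 6 * 1 \<le> (64 * k ^ 6) * (64 * k ^ 6)" using k(1) by (intro mult_left_mono) auto
    then have "2 * (64 * k ^ 6) < W" using capacity(2) by (simp only: mult_1_right mult.assoc)
    then show "x \<le> 8 * k \<Longrightarrow> x < W" "x \<le> 65 * k ^ 6 \<Longrightarrow> x < W" using powers_le by linarith+
  qed
  have less: "0 < W" "4 < W" "8 < W" "k < W" "8 * k < W" "4 * k < W"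
    using W2(1)[of 0] W2(1)[of 4] W2(1)[of 8] W2(1)[of k] W2(1)[of "8 * k"] W2(1)[of "4 * k"] k(1) by linarith+
  have "steps W (count_loop 10 (power_expr 6) ?body) s \<phi>
      (k ^ 6 * (17 + cost (power_expr 6) + 10) + cost (power_expr 6) + 7) (?I (k ^ 6))"
  proof (rule steps_count_loop[where I = ?I])
    show "?I 0 \<phi> (s(10 := (s 10)(0 := 0)))" using zero by (auto simp: keeps_def)
    show "s' 10 0 = j \<and> fits W (power_expr 6) s' \<and> val (power_expr 6) s' = k ^ 6" if I: "?I j \<phi>' s'" for j \<phi>' s'
    proof -
      have "keeps {10} s s'" using I by blast
      then have "globals s'" by (rule globals_keeps[OF s]) simp
      then show ?thesis using fits_power val_power I by simp
    qed
    fix j \<phi>' s' assume j: "j < k ^ 6" and I: "?I j \<phi>' s'"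
    have "keeps {10} s s'" using I by blast
    then have "globals s'" by (rule globals_keeps[OF s]) simp
    then have reg: "s' 4 0 = k" "s' 5 0 = ?R" "s' 10 0 = j" using I by (auto simp: globals_def)
    have jW: "j < W" "?R + j < W" "?R < W" using W2(2)[of j] W2(2)[of "?R + j"] W2(2)[of ?R] j by linarith+
    let ?s1 = "s'(21 := (s' 21)(j := 8 * k))"
    let ?s2 = "?s1(21 := (?s1 21)(?R + j := ?d * k))"
    let ?Q = "\<lambda>\<phi>' s'. s' 10 0 = j \<and> ?I (Suc j) \<phi>' (s'(10 := (s' 10)(0 := Suc j)))"
    have Q: "?Q \<phi>' ?s2"
      using I j by (auto simp: keeps_def fun_eq_iff)
    let ?x = "Bin Add (var 5) (var 10)" and ?y = "Bin Mul (Const ?d) (var 4)"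
    have v: "val ?x ?s1 = ?R + j" "val ?y ?s1 = ?d * k" "fits W ?x ?s1" "fits W ?y ?s1"
      using reg jW less by auto
    have "steps W (Put 21 ?x ?y) ?s1 \<phi>' (cost ?x + cost ?y + 1) ?Q"
      by (rule steps_Put[OF v(3,4)], unfold v(1,2)) (rule Q)
    then have 2: "steps W (Put 21 ?x ?y) ?s1 \<phi>' 10 ?Q"
      by (rule steps_mono) (simp, assumption)
    have "steps W (Put 21 (var 10) (Bin Mul (Const 8) (var 4))) s' \<phi>' 7 (\<lambda>\<phi>'' s''. \<phi>'' = \<phi>' \<and> s'' = ?s1)"
      using reg jW less by (intro steps_mono[OF steps_Put[where Q = "\<lambda>\<phi>'' s''. \<phi>'' = \<phi>' \<and> s'' = ?s1"]]) auto
    then have "steps W ?body s' \<phi>' (7 + 10) ?Q"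
      by (rule steps_SeqI) (use 2 in blast)
    then show "steps W ?body s' \<phi>' 17 ?Q" by simp
  qed (use power_small[of 6] less in auto)
  then show ?thesis
  proof (rule steps_mono)
    have "1 \<le> k ^ 6" using k(1) by simp
    then show "k ^ 6 * (17 + cost (power_expr 6) + 10) + cost (power_expr 6) + 7 \<le> 100 * k ^ 6"
      by (simp add: cost_power_expr)
    fix \<phi>' s' assume I: "?I (k ^ 6) \<phi>' s'"
    have "view ?R r s' a i = start_mem dec k a i" if r: "r < k ^ 6" for r a i
    proof (cases "a = 0")
      case True
      consider "i = 0" | "i = 1" | "2 \<le> i" by linarith
      then show ?thesis
      proof cases
        \<comment> \<open>From index 2 on, addresses start at \<open>2 * ?R\<close>, past both
          stretches written by the loop.\<close>
        case 3
        then have "2 * ?R \<le> i * ?R" by (rule mult_right_mono) simp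
        then have "\<not> i * ?R + r < k ^ 6" "\<not> i * ?R + r < ?R + k ^ 6" using r by linarith+
        then show ?thesis using True I 3 by (simp add: view_def start_mem_def)
      qed (use True I r in \<open>simp_all add: view_def start_mem_def\<close>)
    next
      case False
      then show ?thesis using I by (simp add: view_def start_mem_def)
    qed
    then show "\<phi>' = \<phi> \<and> keeps {10} s s' \<and> (\<forall>a\<ge>20. a \<noteq> 21 \<longrightarrow> s' a = (\<lambda>_. 0)) \<and>
      (\<forall>r<k ^ 6. view (64 * k ^ 6) r s' = start_mem dec k)"
      using I by (auto simp: fun_eq_iff)
  qed
qed

definition acts :: "nat \<Rightarrow> act list" where
  "acts r = instance_acts dec k (block r) (left r) (right r)"

lemma acts_eq: "acts r = map (upd_pair k) (base_list dec k (\<lambda>i j. Mp (row r + i) (col r + j))) @ todo 0 r"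
proof -
  have "block r = (\<lambda>i j. Mp (row r + i) (col r + j))" by (simp add: block_def fun_eq_iff)
  then show ?thesis by (simp add: acts_def instance_acts_def todo_def)
qed

text \<open>The initial potential pays the simulated work of all instances for the entire
  computation, not only for the base graphs. The time bound counts the loops over
  \<open>16 * k ^ 2\<close> pairs in \<open>k ^ 6\<close> instances.\<close>

lemma steps_preprocess:
  assumes least: "\<And>j. 1 \<le> j \<Longrightarrow> j < k \<Longrightarrow> j ^ 3 < n"
    and perf: "\<And>r. r < k ^ 6 \<Longrightarrow> performs m upd qry (acts r) (start_mem dec k) (b r)"
  shows "steps W (preprocess dec upd) (omv_start n M) (14 * (\<Sum>r<k ^ 6. b r)) (20000 * k ^ 8)
    (\<lambda>\<phi>' s'. rdy (todo 0) \<phi>' s' \<and> globals s' \<and> s' 11 0 = 0 \<and> s' 3 = (\<lambda>_. 0))"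
proof -
  let ?\<phi> = "14 * (\<Sum>r<k ^ 6. b r)" and ?R = "64 * k ^ 6"
  define s1 where "s1 = (omv_start n M)(4 := (\<lambda>_. 0)(0 := k))"
  define s2 where "s2 = s1(5 := (s1 5)(0 := ?R))"
  have g2: "globals s2" by (simp add: globals_def s2_def s1_def omv_start_def)
  have z2: "s2 a = (\<lambda>_. 0)" if "20 \<le> a" for a using that by (simp add: s2_def s1_def omv_start_def fun_eq_iff)
  let ?L = "\<lambda>\<phi>' s'. rdy acts \<phi>' s' \<and> keeps {10} s2 s'"
  let ?I = "\<lambda>j \<phi>' s'. rdy (\<lambda>r. if r < j then todo 0 r else acts r) \<phi>' s' \<and>
    keeps {6, 7, 8, 9, 10, 16, 17} s2 s' \<and> s' 10 0 = j"
  let ?Q = "\<lambda>\<phi>' s'. rdy (todo 0) \<phi>' s' \<and> globals s' \<and> s' 11 0 = 0 \<and> s' 3 = (\<lambda>_. 0)"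
  let ?c3 = "count_loop 10 (power_expr 6) (Seq (Put 21 (var 10) (Bin Mul (Const 8) (var 4)))
       (Put 21 (Bin Add (var 5) (var 10)) (Bin Mul (Const (if dec then 4 else 0)) (var 4))))"
  let ?c4 = "count_loop 10 (power_expr 6) (Seq (select (var 10)) (init_code dec upd))"
  have 3: "steps W ?c3 s2 ?\<phi> (100 * k ^ 6) ?L"
  proof (rule steps_mono[OF steps_parameters[OF g2 z2] order.refl])
    fix \<phi>' s' assume s': "\<phi>' = ?\<phi> \<and> keeps {10} s2 s' \<and> (\<forall>a\<ge>20. a \<noteq> 21 \<longrightarrow> s' a = (\<lambda>_. 0)) \<and>
      (\<forall>r<k ^ 6. view ?R r s' = start_mem dec k)"
    have "length (acts r) < ?R" for r
    proof -
      have "length (acts r) \<le> 23 * k ^ 2" unfolding acts_def by (rule length_instance_acts)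
      also have "\<dots> < 64 * k ^ 6" using powers_le k(1) by linarith
      finally show ?thesis .
    qed
    then have "rdy acts \<phi>' s'"
      unfolding ready_def using s' perf by (intro exI[of _ b]) simp
    then show "?L \<phi>' s'" using s' by blast
  qed simp
  have 4: "steps W ?c4 s' \<phi>' (k ^ 6 * ((62 + 10000 * k ^ 2) + cost (power_expr 6) + 10) + cost (power_expr 6) + 7) ?Q"
    if L: "?L \<phi>' s'" for \<phi>' s'
  proof -
    have "steps W ?c4 s' \<phi>' (k ^ 6 * ((62 + 10000 * k ^ 2) + cost (power_expr 6) + 10) + cost (power_expr 6) + 7) (?I (k ^ 6))"
    proof (rule steps_count_loop[where I = ?I])
      have "rdy acts \<phi>' (s'(10 := (s' 10)(0 := 0)))" using rdy_keeps[OF conjunct1[OF L]] by simp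
      then show "?I 0 \<phi>' (s'(10 := (s' 10)(0 := 0)))" using L by (auto simp: keeps_def)
      show "s'' 10 0 = j \<and> fits W (power_expr 6) s'' \<and> val (power_expr 6) s'' = k ^ 6" if I: "?I j \<phi>'' s''" for j \<phi>'' s''
      proof -
        have "keeps {6, 7, 8, 9, 10, 16, 17} s2 s''" using I by blast
        then have "globals s''" by (rule globals_keeps[OF g2]) simp
        then show ?thesis using fits_power val_power I by simp
      qed
      fix r \<phi>'' s'' assume r: "r < k ^ 6" and I: "?I r \<phi>'' s''"
      let ?K = "{6, 7, 8, 9, 10, 16, 17} :: nat set"
      have keeps: "keeps ?K s2 s''" using I by blast
      have g: "globals s''" by (rule globals_keeps[OF g2 keeps]) simp
      let ?f = "\<lambda>j r. if r < j then todo 0 r else acts r"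
      let ?P = "\<lambda>\<psi> s. rdy (?f r) \<psi> s \<and> keeps {6, 16, 17} s'' s \<and> at_block r s"
      have "r < W" "0 < W" using r small[of r] R_less by linarith+
      then have sel: "steps W (select (var 10)) s'' \<phi>'' (cost (var 10) + 60) ?P"
        using I by (intro steps_mono[OF steps_select[OF g, where r = r]]) (auto intro: rdy_keeps)
      let ?Q' = "\<lambda>\<phi>' s'. s' 10 0 = r \<and> ?I (Suc r) \<phi>' (s'(10 := (s' 10)(0 := Suc r)))"
      have init: "steps W (init_code dec upd) s \<psi> (10000 * k ^ 2) ?Q'" if P: "?P \<psi> s" for \<psi> s
      proof -
        have ks: "keeps {6, 16, 17} s'' s" using P by blast
        have "steps W (init_code dec upd) s \<psi> (10000 * k ^ 2)
          (\<lambda>\<phi>' s'. rdy ((?f r)(r := todo 0 r)) \<phi>' s' \<and> keeps {7, 8, 9} s s')"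
        proof (rule steps_init_code)
          show "rdy (?f r) \<psi> s" using P by blast
          show "?f r r = map (upd_pair k) (base_list dec k (\<lambda>i j. Mp (row r + i) (col r + j))) @ todo 0 r"
            by (simp add: acts_eq)
          show "globals s" by (rule globals_keeps[OF g ks]) simp
          show "at_block r s" using P by blast
        qed (rule r)
        moreover have "(?f r)(r := todo 0 r) = ?f (Suc r)" by (auto simp: fun_eq_iff less_Suc_eq)
        ultimately have "steps W (init_code dec upd) s \<psi> (10000 * k ^ 2)
          (\<lambda>\<phi>' s'. rdy (?f (Suc r)) \<phi>' s' \<and> keeps {7, 8, 9} s s')" by simp
        then show ?thesis
        proof (rule steps_mono)
          fix \<phi> t assume t: "rdy (?f (Suc r)) \<phi> t \<and> keeps {7, 8, 9} s t"
          have "rdy (?f (Suc r)) \<phi> (t(10 := (t 10)(0 := Suc r)))"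
            using rdy_keeps[OF conjunct1[OF t]] by simp
          moreover have "t 10 0 = r" using t ks I by (simp add: keeps_def)
          moreover have "keeps ?K s2 (t(10 := (t 10)(0 := Suc r)))"
            using t ks keeps by (auto simp: keeps_def)
          ultimately show "?Q' \<phi> t" by simp
        qed simp
      qed
      have "steps W (Seq (select (var 10)) (init_code dec upd)) s'' \<phi>'' (cost (var 10) + 60 + 10000 * k ^ 2) ?Q'"
        by (rule steps_SeqI[OF sel]) (rule init)
      then show "steps W (Seq (select (var 10)) (init_code dec upd)) s'' \<phi>'' (62 + 10000 * k ^ 2) ?Q'" by simp
    qed (use power_small[of 6] R_less in auto)
    then show ?thesis
    proof (rule steps_mono)
      fix \<phi> t assume I: "?I (k ^ 6) \<phi> t"
      have "rdy (todo 0) \<phi> t" using I by (auto simp: ready_def)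
      moreover have "keeps {6, 7, 8, 9, 10, 16, 17} s2 t" using I by blast
      then have "globals t" "t 11 = s2 11" "t 3 = s2 3"
        using globals_keeps[OF g2, of "{6, 7, 8, 9, 10, 16, 17}" t] by (simp_all add: keepsD)
      ultimately show "?Q \<phi> t" by (simp add: s2_def s1_def omv_start_def fun_eq_iff)
    qed simp
  qed
  let ?e = "Bin Mul (Const 64) (power_expr 6)"
  have 34: "steps W (Seq ?c3 ?c4) s2 ?\<phi>
      (100 * k ^ 6 + (k ^ 6 * ((62 + 10000 * k ^ 2) + cost (power_expr 6) + 10) + cost (power_expr 6) + 7)) ?Q"
    by (rule steps_SeqI[OF 3]) (rule 4)
  have e: "fits W ?e s1" "val ?e s1 = ?R"
  proof -
    have "64 < W" using small[of 64] k(1) by simp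
    moreover have "fits W (power_expr 6) s1"
      using k(1) power_small[of 6] by (intro fits_power_expr) (auto simp: s1_def)
    ultimately show "fits W ?e s1" "val ?e s1 = ?R"
      using R_less by (simp_all add: val_power_expr s1_def)
  qed
  have "steps W (Seq (assign 5 ?e) (Seq ?c3 ?c4)) s1 ?\<phi> (cost ?e + 2 +
      (100 * k ^ 6 + (k ^ 6 * ((62 + 10000 * k ^ 2) + cost (power_expr 6) + 10) + cost (power_expr 6) + 7))) ?Q"
    by (rule steps_assign_Seq[OF e(1)], unfold e(2)) (use R_less 34 in \<open>simp_all add: s2_def\<close>)
  note 234 = this
  have "steps W (preprocess dec upd) (omv_start n M) ?\<phi> (40 * k + (cost ?e + 2 +
      (100 * k ^ 6 + (k ^ 6 * ((62 + 10000 * k ^ 2) + cost (power_expr 6) + 10) + cost (power_expr 6) + 7)))) ?Q"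
    unfolding preprocess_def
    by (rule steps_SeqI[OF steps_find_k[OF least]]) (use 234 in \<open>simp_all only: s1_def\<close>)
  then show ?thesis
  proof (rule steps_mono)
    have "k ^ 6 * k ^ 2 = k ^ 8" by (simp flip: power_add)
    then have "40 * k + (cost ?e + 2 + (100 * k ^ 6 + (k ^ 6 * ((62 + 10000 * k ^ 2) + cost (power_expr 6) + 10)
        + cost (power_expr 6) + 7))) = 40 * k + 49 + 191 * k ^ 6 + 10000 * k ^ 8"
      by (simp add: cost_power_expr algebra_simps)
    also have "\<dots> \<le> 20000 * k ^ 8"
    proof -
      have "k ^ 6 \<le> k ^ 8" using k(1) by (intro power_increasing) auto
      then show ?thesis using powers_le k(1) by linarith
    qed
    finally show "40 * k + (cost ?e + 2 + (100 * k ^ 6 + (k ^ 6 * ((62 + 10000 * k ^ 2) + cost (power_expr 6) + 10)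
        + cost (power_expr 6) + 7))) \<le> 20000 * k ^ 8" .
  qed
qed

end

section \<open>Choice of the block size\<close>

definition block_size :: "nat \<Rightarrow> nat" where
  "block_size n = (LEAST k. 1 \<le> k \<and> n \<le> k ^ 3)"

lemma block_size: "1 \<le> block_size n \<and> n \<le> block_size n ^ 3"
  unfolding block_size_def
  by (rule LeastI[of _ "Suc n"]) (simp add: power3_eq_cube)

lemma block_size_least:
  assumes "1 \<le> j" "j < block_size n"
  shows "j ^ 3 < n"
proof -
  have "\<not> (1 \<le> j \<and> n \<le> j ^ 3)" using assms(2) unfolding block_size_def by (rule not_less_Least)
  then show ?thesis using assms(1) by simp
qed

lemma block_size_le: "block_size n \<le> n + 2"
  unfolding block_size_def by (rule Least_le) (simp add: power3_eq_cube)

text \<open>By minimality \<open>(k - 1) ^ 3 < n\<close>, and \<open>k\<close> is at most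
  \<open>2 * (k - 1)\<close> unless \<open>k = 1\<close>; in that case \<open>n = 0\<close> has to
  be excluded.\<close>

lemma block_size_cube_le:
  assumes "1 \<le> n"
  shows "block_size n ^ 3 \<le> 8 * n"
proof (cases "block_size n \<le> 1")
  case True
  then have "block_size n = 1" using block_size[of n] by simp
  then show ?thesis using assms by simp
next
  case False
  then have "block_size n \<le> 2 * (block_size n - 1)" by simp
  then have "block_size n ^ 3 \<le> (2 * (block_size n - 1)) ^ 3" by (rule power_mono) simp
  also have "\<dots> = 8 * (block_size n - 1) ^ 3" by (simp add: power_mult_distrib)
  also have "(block_size n - 1) ^ 3 < n" using False by (intro block_size_least) auto
  then have "8 * (block_size n - 1) ^ 3 \<le> 8 * n" by simp
  finally show ?thesis .
qed

text \<open>With \<open>x = n + 2\<close>, the sum \<open>8 * k + 2\<close> is at most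
  \<open>x ^ 5\<close>, whence the 5, and \<open>64 * k ^ 6\<close> is at most
  \<open>x ^ 12\<close>. The 26 exceeds 24, for two such factors, and 25, for these and the
  additional 2.\<close>

lemma capacity_bounds:
  fixes k n w :: nat
  assumes "k \<le> n + 2" "1 \<le> k"
  shows "capacity w (8 * k) * (64 * k ^ 6) * (64 * k ^ 6) < capacity (5 * w + 26) n"
    "2 * (64 * k ^ 6) * (64 * k ^ 6) < capacity (5 * w + 26) n"
proof -
  define x where "x = n + 2"
  have x: "2 \<le> x" "k \<le> x" using assms by (auto simp: x_def)
  have "2 ^ 4 \<le> x ^ 4" "2 ^ 6 \<le> x ^ 6" using x(1) by (intro power_mono; simp)+
  then have x46: "16 \<le> x ^ 4" "64 \<le> x ^ 6" by simp_all
  have "8 * k + 2 \<le> 16 * x" using x by linarith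
  also have "\<dots> \<le> x ^ 4 * x" using x46(1) by (rule mult_right_mono) simp
  also have "\<dots> = x ^ 5" by (simp flip: power_Suc2)
  finally have "(8 * k + 2) ^ w \<le> (x ^ 5) ^ w" by (rule power_mono) simp
  then have 1: "capacity w (8 * k) \<le> x ^ (5 * w)" by (simp add: capacity_def power_mult)
  have "64 * k ^ 6 \<le> x ^ 6 * x ^ 6" using x46(2) x(2) by (intro mult_mono power_mono) auto
  also have "\<dots> = x ^ 12" by (simp flip: power_add)
  finally have 2: "64 * k ^ 6 \<le> x ^ 12" .
  have "capacity w (8 * k) * (64 * k ^ 6) * (64 * k ^ 6) \<le> x ^ (5 * w) * x ^ 12 * x ^ 12"
    by (intro mult_mono 1 2) auto
  also have "\<dots> = x ^ (5 * w + 24)" by (simp flip: power_add add: add.assoc)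
  also have "\<dots> < x ^ (5 * w + 26)" using x(1) by (intro power_strict_increasing) auto
  finally show "capacity w (8 * k) * (64 * k ^ 6) * (64 * k ^ 6) < capacity (5 * w + 26) n"
    by (simp add: capacity_def x_def)
  have "2 * (64 * k ^ 6) * (64 * k ^ 6) \<le> x * x ^ 12 * x ^ 12"
    by (intro mult_mono x 2) auto
  also have "\<dots> = x ^ 25" by (simp flip: power_Suc power_add)
  also have "\<dots> < x ^ (5 * w + 26)" using x(1) by (intro power_strict_increasing) auto
  finally show "2 * (64 * k ^ 6) * (64 * k ^ 6) < capacity (5 * w + 26) n"
    by (simp add: capacity_def x_def)
qed

section \<open>The reduction\<close>

text \<open>14 is the simulation factor, and 23000 combines preprocessing and multiplications.
  Absolute values appear because the number of updates is only bounded from above and no sign is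
  assumed for \<open>f\<close>.\<close>

definition total_time :: "(nat \<Rightarrow> real) \<Rightarrow> (nat \<Rightarrow> real) \<Rightarrow> nat \<Rightarrow> real" where
  "total_time f g k = 14 * real k ^ 6 * (23 * real k ^ 2 * \<bar>f (8 * k)\<bar> + real k * \<bar>g (8 * k)\<bar>) + 23000 * real k ^ 8"

definition solves_instances ::
    "bool \<Rightarrow> com \<Rightarrow> com \<Rightarrow> nat \<Rightarrow> (nat \<Rightarrow> real) \<Rightarrow> (nat \<Rightarrow> real) \<Rightarrow> bool" where
  "solves_instances dec upd qry w f g \<longleftrightarrow>
     (\<forall>k as. legal dec k (if dec then board k else {}) as \<longrightarrow>
       (\<exists>t. performs (capacity w (8 * k)) upd qry as (start_mem dec k) t \<and>
         real t \<le> real (num_updates (map request_of as)) * f (8 * k) +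
           real (num_queries (map request_of as)) * g (8 * k)))"

lemma incremental_solves:
  assumes "incremental_matching_algorithm upd qry w f g"
  shows "solves_instances False upd qry w f g"
  unfolding solves_instances_def
proof (intro allI impI)
  fix k as assume "legal False k (if False then board k else {}) as"
  then have l: "legal False k {} as" by simp
  have "valid_insertions (8 * k) {} (map request_of as)" using legal_valid[OF l] by simp
  then obtain t where t: "serves (capacity w (8 * k)) upd qry insert_edge (map request_of as) {}
      (\<lambda>a i. if a = 0 \<and> i = 0 then 8 * k else 0) t"
    "real t \<le> real (num_updates (map request_of as)) * f (8 * k) +
           real (num_queries (map request_of as)) * g (8 * k)"
    using assms unfolding incremental_matching_algorithm_def by blast
  have "(\<lambda>a i. if a = 0 \<and> i = 0 then 8 * k else 0) = start_mem False k"
    by (auto simp: start_mem_def fun_eq_iff)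
  then have "performs (capacity w (8 * k)) upd qry as (start_mem False k) t"
    using legal_performs[OF l, of "capacity w (8 * k)" upd qry "start_mem False k" t] t(1)
    by (simp add: change_def)
  then show "\<exists>t. performs (capacity w (8 * k)) upd qry as (start_mem False k) t \<and>
         real t \<le> real (num_updates (map request_of as)) * f (8 * k) +
           real (num_queries (map request_of as)) * g (8 * k)"
    using t(2) by blast
qed

lemma edge_board: "edge k ` board k = complete_bipartite {..<4 * k} {4 * k..<8 * k}"
proof
  show "edge k ` board k \<subseteq> complete_bipartite {..<4 * k} {4 * k..<8 * k}"
    by (force simp: edge_def board_def complete_bipartite_def)
  show "complete_bipartite {..<4 * k} {4 * k..<8 * k} \<subseteq> edge k ` board k"
  proof
    fix e assume "e \<in> complete_bipartite {..<4 * k} {4 * k..<8 * k}"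
    then obtain a b where "e = {a, b}" "a < 4 * k" "4 * k \<le> b" "b < 8 * k"
      by (auto simp: complete_bipartite_def)
    then show "e \<in> edge k ` board k"
      by (intro image_eqI[of _ _ "(a, b - 4 * k)"]) (auto simp: edge_def board_def)
  qed
qed

lemma decremental_solves:
  assumes "decremental_matching_algorithm upd qry w f g"
  shows "solves_instances True upd qry w f g"
  unfolding solves_instances_def
proof (intro allI impI)
  fix k as assume "legal True k (if True then board k else {}) as"
  then have l: "legal True k (board k) as" by simp
  let ?K = "complete_bipartite {..<4 * k} {4 * k..<8 * k}"
  have "valid_deletions ?K (map request_of as)" using legal_valid[OF l] by (simp add: edge_board)
  moreover have "4 * k \<le> 8 * k" by simp
  ultimately obtain t where t: "serves (capacity w (8 * k)) upd qry delete_edge (map request_of as) ?K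
      (\<lambda>a i. if a = 0 \<and> i = 0 then 8 * k else if a = 0 \<and> i = 1 then 4 * k else 0) t"
    "real t \<le> real (num_updates (map request_of as)) * f (8 * k) +
           real (num_queries (map request_of as)) * g (8 * k)"
    using assms unfolding decremental_matching_algorithm_def by blast
  have "(\<lambda>a i. if a = 0 \<and> i = 0 then 8 * k else if a = 0 \<and> i = 1 then 4 * k else 0) = start_mem True k"
    by (auto simp: start_mem_def fun_eq_iff)
  then have "performs (capacity w (8 * k)) upd qry as (start_mem True k) t"
    using legal_performs[OF l, of "capacity w (8 * k)" upd qry "start_mem True k" t] t(1)
    by (simp add: change_def edge_board)
  then show "\<exists>t. performs (capacity w (8 * k)) upd qry as (start_mem True k) t \<and>
         real t \<le> real (num_updates (map request_of as)) * f (8 * k) +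
           real (num_queries (map request_of as)) * g (8 * k)"
    using t(2) by blast
qed

lemma omv_algorithm_from_matching:
  assumes "solves_instances dec upd qry w f g"
  shows "omv_algorithm (preprocess dec upd) (multiply dec upd qry) (5 * w + 26) (\<lambda>n. total_time f g (block_size n))"
  unfolding omv_algorithm_def
proof (intro allI impI)
  fix n and M :: "nat \<Rightarrow> nat \<Rightarrow> bool" and vs :: "(nat \<Rightarrow> bool) list"
  assume len: "length vs = n"
  define k where "k = block_size n"
  have k: "1 \<le> k" "n \<le> k ^ 3" using block_size unfolding k_def by blast+
  have kn: "k \<le> n + 2" using block_size_le unfolding k_def .
  \<comment> \<open>The slots provide for \<open>k ^ 3\<close> vectors, possibly more than
    \<open>n\<close>. For \<open>c\<close> beyond the list, \<open>vs ! c\<close> is some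
    unspecified vector; its phases are legal and paid for, but never executed.\<close>
  interpret reduction "capacity w (8 * k)" "capacity (5 * w + 26) n" upd qry dec k n M "\<lambda>c. vs ! c"
    by unfold_locales (use k capacity_bounds[OF kn k(1)] in auto)
  let ?t = "23 * real k ^ 2 * \<bar>f (8 * k)\<bar> + real k * \<bar>g (8 * k)\<bar>"
  have "\<exists>t. performs (capacity w (8 * k)) upd qry (acts r) (start_mem dec k) t \<and> real t \<le> ?t" for r
  proof -
    obtain t where t: "performs (capacity w (8 * k)) upd qry (acts r) (start_mem dec k) t"
      "real t \<le> real (num_updates (map request_of (acts r))) * f (8 * k) +
        real (num_queries (map request_of (acts r))) * g (8 * k)"
      using assms legal_instance unfolding solves_instances_def acts_def by blast
    have "real (num_updates (map request_of (acts r))) \<le> real (23 * k ^ 2)"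
      unfolding acts_def of_nat_le_iff by (rule num_updates_instance)
    then have "real (num_updates (map request_of (acts r))) * \<bar>f (8 * k)\<bar> \<le> 23 * real k ^ 2 * \<bar>f (8 * k)\<bar>"
      by (intro mult_right_mono) auto
    moreover have "real (num_updates (map request_of (acts r))) * f (8 * k) \<le>
        real (num_updates (map request_of (acts r))) * \<bar>f (8 * k)\<bar>"
      by (intro mult_left_mono) auto
    moreover have "real (num_queries (map request_of (acts r))) * g (8 * k) \<le> real k * \<bar>g (8 * k)\<bar>"
      unfolding acts_def num_queries_instance by (intro mult_left_mono) auto
    ultimately show ?thesis using t by (intro exI[of _ t]) simp
  qed
  then obtain b where b: "\<And>r. performs (capacity w (8 * k)) upd qry (acts r) (start_mem dec k) (b r)"
    "\<And>r. real (b r) \<le> ?t" by metis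
  have "steps (capacity (5 * w + 26) n) (preprocess dec upd) (omv_start n M) (14 * (\<Sum>r<k ^ 6. b r)) (20000 * k ^ 8)
    (\<lambda>\<phi>' s'. rdy (todo 0) \<phi>' s' \<and> globals s' \<and> s' 11 0 = 0 \<and> s' 3 = (\<lambda>_. 0))"
    by (rule steps_preprocess) (use b(1) block_size_least in \<open>auto simp: k_def\<close>)
  then obtain t0 s \<psi> where s: "run (capacity (5 * w + 26) n) (preprocess dec upd) (omv_start n M) t0 s"
    "t0 + \<psi> \<le> 14 * (\<Sum>r<k ^ 6. b r) + 20000 * k ^ 8" "rdy (todo 0) \<psi> s" "globals s" "s 11 0 = 0" "s 3 = (\<lambda>_. 0)"
    unfolding steps_def by blast
  obtain t where t: "omv_serves (capacity (5 * w + 26) n) (multiply dec upd qry) n M vs s t"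
    "t \<le> \<psi> + length vs * (3000 * k ^ 5)"
    using serves_vectors[of 0 \<psi> s vs] s len by auto
  have "length vs * (3000 * k ^ 5) \<le> k ^ 3 * (3000 * k ^ 5)" using len k(2) by (intro mult_right_mono) auto
  also have "\<dots> = 3000 * k ^ 8" by (simp flip: power_add)
  finally have "t0 + t \<le> 14 * (\<Sum>r<k ^ 6. b r) + 23000 * k ^ 8" using s(2) t(2) by linarith
  then have "real (t0 + t) \<le> real (14 * (\<Sum>r<k ^ 6. b r) + 23000 * k ^ 8)" by (rule of_nat_mono)
  also have "\<dots> = 14 * (\<Sum>r<k ^ 6. real (b r)) + 23000 * real k ^ 8" by simp
  also have "\<dots> \<le> 14 * (real k ^ 6 * ?t) + 23000 * real k ^ 8"
    using sum_bounded_above[of "{..<k ^ 6}" "\<lambda>r. real (b r)" ?t] b(2) by simp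
  finally have "real (t0 + t) \<le> total_time f g (block_size n)"
    by (simp add: total_time_def flip: k_def)
  then show "\<exists>t0 s t. run (capacity (5 * w + 26) n) (preprocess dec upd) (omv_start n M) t0 s \<and>
      omv_serves (capacity (5 * w + 26) n) (multiply dec upd qry) n M vs s t \<and>
      real (t0 + t) \<le> total_time f g (block_size n)"
    using s(1) t(1) by blast
qed

section \<open>The exponent of the total time\<close>

lemma filterlim_block_size: "filterlim block_size at_top at_top"
proof (rule filterlim_at_top[THEN iffD2], intro allI)
  fix k
  show "\<forall>\<^sub>F n in at_top. k \<le> block_size n"
    using eventually_gt_at_top[of "k ^ 3"]
  proof eventually_elim
    case (elim n)
    then have "k ^ 3 < block_size n ^ 3" using block_size[of n] by simp
    then show ?case by (meson less_imp_le_nat power_less_imp_less_base zero_le)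
  qed
qed

text \<open>The minimum with 1 keeps the bookkeeping of order \<open>k ^ 8\<close> below
  \<open>k powr (9 - e)\<close>. Since \<open>k ^ 3\<close> is at most \<open>8 * n\<close>, this is
  of order \<open>n powr (3 - e / 3)\<close>. In \<open>C\<close>, 8 and 64 bound the powers of the
  8 in \<open>8 * k\<close>; 512 is \<open>8 ^ 3\<close>.\<close>

lemma total_time_bigo:
  assumes f: "f \<in> O(\<lambda>n. real n powr (1 - \<epsilon>))" and g: "g \<in> O(\<lambda>n. real n powr (2 - \<epsilon>))" and "0 < \<epsilon>"
  shows "(\<lambda>n. total_time f g (block_size n)) \<in> O(\<lambda>n. real n powr (3 - min \<epsilon> 1 / 3))"
proof -
  define e where "e = min \<epsilon> 1"
  have e: "0 < e" "e \<le> 1" "e \<le> \<epsilon>" using assms(3) by (auto simp: e_def)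
  obtain c where c: "0 < c" "\<forall>\<^sub>F n in at_top. norm (f n) \<le> c * norm (real n powr (1 - \<epsilon>))"
    using f by (elim landau_o.bigE)
  obtain d where d: "0 < d" "\<forall>\<^sub>F n in at_top. norm (g n) \<le> d * norm (real n powr (2 - \<epsilon>))"
    using g by (elim landau_o.bigE)
  have lim: "filterlim (\<lambda>n. 8 * block_size n) at_top at_top"
    by (rule filterlim_at_top_mono[OF filterlim_block_size]) simp
  define C where "C = 14 * (23 * (8 * c) + 64 * d) + 23000"
  have "\<forall>\<^sub>F n in at_top. norm (total_time f g (block_size n)) \<le> C * 512 * norm (real n powr (3 - e / 3))"
    using lim[unfolded filterlim_iff, rule_format, OF c(2)] lim[unfolded filterlim_iff, rule_format, OF d(2)]
      eventually_ge_at_top[of 1]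
  proof eventually_elim
    case (elim n)
    define k where "k = block_size n"
    have k: "1 \<le> real k" using block_size[of n] by (simp add: k_def)
    have "\<bar>f (8 * k)\<bar> \<le> c * real (8 * k) powr (1 - \<epsilon>)" using elim(1) by (simp add: k_def)
    also have "\<dots> \<le> c * real (8 * k) powr (1 - e)"
      using c(1) e k by (intro mult_left_mono powr_mono) auto
    also have "\<dots> = c * (8 powr (1 - e) * real k powr (1 - e))" by (simp add: powr_mult)
    also have "\<dots> \<le> c * (8 powr 1 * real k powr (1 - e))"
      using c(1) e by (intro mult_left_mono mult_right_mono powr_mono) auto
    finally have F: "\<bar>f (8 * k)\<bar> \<le> 8 * c * real k powr (1 - e)" by simp
    have "\<bar>g (8 * k)\<bar> \<le> d * real (8 * k) powr (2 - \<epsilon>)" using elim(2) by (simp add: k_def)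
    also have "\<dots> \<le> d * real (8 * k) powr (2 - e)"
      using d(1) e k by (intro mult_left_mono powr_mono) auto
    also have "\<dots> = d * (8 powr (2 - e) * real k powr (2 - e))" by (simp add: powr_mult)
    also have "\<dots> \<le> d * (8 powr 2 * real k powr (2 - e))"
      using d(1) e by (intro mult_left_mono mult_right_mono powr_mono) auto
    finally have G: "\<bar>g (8 * k)\<bar> \<le> 64 * d * real k powr (2 - e)" by simp
    have pk: "real k ^ i = real k powr real i" for i using k by (simp add: powr_realpow)
    have "real k ^ 2 * real k powr (1 - e) = real k powr (3 - e)" "real k * real k powr (2 - e) = real k powr (3 - e)"
      "real k ^ 6 * real k powr (3 - e) = real k powr (9 - e)"
      using k powr_add[of "real k" 2 "1 - e"] powr_add[of "real k" 1 "2 - e"] powr_add[of "real k" 6 "3 - e"]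
      by simp_all
    note eqs = this
    have "23 * real k ^ 2 * \<bar>f (8 * k)\<bar> + real k * \<bar>g (8 * k)\<bar> \<le>
        23 * real k ^ 2 * (8 * c * real k powr (1 - e)) + real k * (64 * d * real k powr (2 - e))"
      using F G by (intro add_mono mult_left_mono) auto
    also have "\<dots> = 23 * (8 * c) * (real k ^ 2 * real k powr (1 - e)) + 64 * d * (real k * real k powr (2 - e))"
      by (simp add: algebra_simps)
    also have "\<dots> = (23 * (8 * c) + 64 * d) * real k powr (3 - e)"
      unfolding eqs by (simp add: algebra_simps)
    finally have "14 * real k ^ 6 * (23 * real k ^ 2 * \<bar>f (8 * k)\<bar> + real k * \<bar>g (8 * k)\<bar>) \<le>
        14 * real k ^ 6 * ((23 * (8 * c) + 64 * d) * real k powr (3 - e))"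
      by (intro mult_left_mono) auto
    also have "\<dots> = 14 * (23 * (8 * c) + 64 * d) * (real k ^ 6 * real k powr (3 - e))"
      by (simp add: algebra_simps)
    finally have 1: "14 * real k ^ 6 * (23 * real k ^ 2 * \<bar>f (8 * k)\<bar> + real k * \<bar>g (8 * k)\<bar>) \<le>
        14 * (23 * (8 * c) + 64 * d) * real k powr (9 - e)"
      unfolding eqs .
    have 2: "real k ^ 8 \<le> real k powr (9 - e)"
      unfolding pk using k e by (intro powr_mono) auto
    have le: "total_time f g k \<le> C * real k powr (9 - e)"
      using 1 2 unfolding total_time_def C_def by (simp add: algebra_simps)
    have "real k powr (9 - e) = (real k powr 3) powr (3 - e / 3)"
      unfolding powr_powr by (rule arg_cong[where f = "\<lambda>x. real k powr x"]) simp
    also have "\<dots> \<le> (8 * real n) powr (3 - e / 3)"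
    proof (rule powr_mono2)
      have "real (k ^ 3) \<le> real (8 * n)"
        using block_size_cube_le[OF elim(3)] unfolding k_def of_nat_le_iff .
      then show "real k powr 3 \<le> 8 * real n" by simp
    qed (use e in auto)
    also have "\<dots> = 8 powr (3 - e / 3) * real n powr (3 - e / 3)" by (simp add: powr_mult)
    also have "\<dots> \<le> 8 powr 3 * real n powr (3 - e / 3)"
      using e by (intro mult_right_mono powr_mono) auto
    finally have "C * real k powr (9 - e) \<le> C * (8 powr 3 * real n powr (3 - e / 3))"
      using c(1) d(1) by (intro mult_left_mono) (auto simp: C_def)
    with le have "total_time f g k \<le> C * 512 * real n powr (3 - e / 3)" by simp
    moreover have "0 \<le> total_time f g k" by (simp add: total_time_def)
    ultimately show ?case by (simp add: k_def)
  qed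
  then show ?thesis unfolding e_def by (rule bigoI)
qed

lemma no_fast_instances:
  assumes "OMv_conjecture" "0 < \<epsilon>" "f \<in> O(\<lambda>n. real n powr (1 - \<epsilon>))" "g \<in> O(\<lambda>n. real n powr (2 - \<epsilon>))"
  shows "\<not> solves_instances dec upd qry w f g"
proof
  assume "solves_instances dec upd qry w f g"
  from omv_algorithm_from_matching[OF this] total_time_bigo[OF assms(3,4,2)] assms(1,2)
  show False unfolding OMv_conjecture_def by (metis divide_pos_pos min_less_iff_conj zero_less_numeral zero_less_one)
qed

theorem theorem1:
  assumes "OMv_conjecture"
  shows "(\<forall>\<epsilon>>0. \<not> (\<exists>upd qry w f g.
            f \<in> O(\<lambda>n. real n powr (1 - \<epsilon>)) \<and> g \<in> O(\<lambda>n. real n powr (2 - \<epsilon>)) \<and>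
            incremental_matching_algorithm upd qry w f g)) \<and>
         (\<forall>\<epsilon>>0. \<not> (\<exists>upd qry w f g.
            f \<in> O(\<lambda>n. real n powr (1 - \<epsilon>)) \<and> g \<in> O(\<lambda>n. real n powr (2 - \<epsilon>)) \<and>
            decremental_matching_algorithm upd qry w f g))"
  using no_fast_instances[OF assms] incremental_solves decremental_solves by blast

end
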